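(* Let $K\subset\mathbb{R}^n$ be a convex body with positive volume, let $\mu$ be the uniform probability measure on $K$, and let $\|\cdot\|$ be any norm on $\mathbb{R}^n$. Then for every measurable $S\subset K$ with $0<\mu(S)\le1/2$, $$(\operatorname{diam}K)\,\mu^+(S)\ \ge\ \mu(S)\,G_n(1/\mu(S)),$$ where $G_n$ is defined in the context. Moreover this bound is sharp for every $x=\mu(S)\in(0,1/2]$, every dimension $n$ and every norm: the infimum of $(\operatorname{diam}K)\mu^+(S)/\mu(S)$ over all convex bodies $K\subset\mathbb{R}^n$ and measurable $S\subset K$ with $\mu(S)=x$ equals $G_n(1/x)$.
   Context: A convex body is a closed, bounded convex set. For a norm $\|\cdot\|$, $\operatorname{diam}K=\sup_{a,b\in K}\|a-b\|$, $S_h=\{y:\exists s\in S,\|y-s\|\le h\}$, and $\mu^+(S)=\lim_{h\to0^+}\mu(S_h\setminus S)/h$. The function $G_n$ on $[2,\infty)$: for $n=1$, $x\,G_1(1/x)=1$, i.e. $G_1(1/x)=1/x$. For $n>1$, $G_n(2)=2$, and for every $\gamma>0$, $$x\,G_n(1/x)=\frac{\gamma n}{(1+\gamma)^n-1}\left[\frac{(1+\gamma)^{n-1}\gamma(n-1)}{(1+\gamma)^{n-1}-1}\right]^{1-1/n}\quad\text{where}\quad x=\frac{(1+\gamma)^{n-1}[\gamma(n-1)-1]+1}{[(1+\gamma)^{n-1}-1][(1+\gamma)^n-1]}\in(0,1/2).$$ *)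

theory Defs
  imports "HOL-Analysis.Analysis"
begin

definition is_norm :: "('a::real_vector \<Rightarrow> real) \<Rightarrow> bool" where
  "is_norm N \<longleftrightarrow>
     (\<forall>x. N x = 0 \<longleftrightarrow> x = 0) \<and>
     (\<forall>c x. N (c *\<^sub>R x) = \<bar>c\<bar> * N x) \<and>
     (\<forall>x y. N (x + y) \<le> N x + N y)"

definition convex_body :: "'a::euclidean_space set \<Rightarrow> bool" where
  "convex_body K \<longleftrightarrow> closed K \<and> bounded K \<and> convex K"

definition norm_diam :: "('a::real_vector \<Rightarrow> real) \<Rightarrow> 'a set \<Rightarrow> real" where
  "norm_diam N K = (SUP p\<in>K \<times> K. N (fst p - snd p))"

definition norm_nbhd :: "('a::real_vector \<Rightarrow> real) \<Rightarrow> 'a set \<Rightarrow> real \<Rightarrow> 'a set" where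
  "norm_nbhd N S h = {y. \<exists>s\<in>S. N (y - s) \<le> h}"

definition unif_meas :: "'a::euclidean_space set \<Rightarrow> 'a set \<Rightarrow> real" where
  "unif_meas K A = measure lebesgue (A \<inter> K) / measure lebesgue K"

definition has_boundary_measure ::
  "('a::euclidean_space \<Rightarrow> real) \<Rightarrow> 'a set \<Rightarrow> 'a set \<Rightarrow> real \<Rightarrow> bool" where
  "has_boundary_measure N K S L \<longleftrightarrow>
     ((\<lambda>h. unif_meas K (norm_nbhd N S h - S) / h) \<longlongrightarrow> L) (at_right 0)"

definition Gx :: "nat \<Rightarrow> real \<Rightarrow> real" where
  "Gx n \<gamma> = ((1+\<gamma>)^(n-1) * (\<gamma> * real (n-1) - 1) + 1) /
             (((1+\<gamma>)^(n-1) - 1) * ((1+\<gamma>)^n - 1))"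

definition Gval :: "nat \<Rightarrow> real \<Rightarrow> real" where
  "Gval n \<gamma> = \<gamma> * real n / ((1+\<gamma>)^n - 1) *
     ((1+\<gamma>)^(n-1) * \<gamma> * real (n-1) / ((1+\<gamma>)^(n-1) - 1)) powr (1 - 1 / real n)"

text \<open>G_n(t) for t \<ge> 2: for n>1 and t>2, t = 1/x with x = Gx n \<gamma>, and x G_n(1/x) = Gval n \<gamma>.\<close>
definition G :: "nat \<Rightarrow> real \<Rightarrow> real" where
  "G n t = (if n = 1 then t
            else if t = 2 then 2
            else (THE y. \<exists>\<gamma>>0. 1 / t = Gx n \<gamma> \<and> y / t = Gval n \<gamma>))"

end

theory Submission
  imports Defs
begin

text \<open>
  The lower bound is proved by localisation. Bisecting \<open>K\<close> by half-planes in pairs of coordinates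
  that keep the proportion of \<open>S\<close> fixed, one reaches a convex piece which is as thin as desired
  around a line and on which \<open>S\<close> and the complement of its \<open>h\<close>-neighbourhood still leave at most
  the same proportion uncovered. By the Brunn-Minkowski inequality the marginal of this piece along
  the line has a density \<open>g ^ (n - 1)\<close> with \<open>g\<close> concave. Replacing \<open>g\<close> by a supporting line shows that
  at the quantile \<open>x\<close> the length times the density is at least that of some truncated cone, hence at
  least the infimum \<open>I x\<close> over all truncated cones. This \<open>I\<close> is symmetric and subadditive, which
  allows passing from half-lines to arbitrary sets on the line. For \<open>n > 1\<close> and \<open>x < 1/2\<close> the infimum is attained
  at exactly one ratio \<open>1 + \<gamma>\<close> of the two ends, and this gives the parametric formula for
  \<open>x G(1/x)\<close>. The same truncated cones, taken thin around a vector at which the norm has a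
  supporting functional, show sharpness.\<close>

text \<open>The boundary measure is a limit as \<open>h\<close> tends to 0, and such a limit does
  not pass to the pieces of a bisection. Hence the localised statement has a fixed \<open>h\<close>
  and two compact sets, \<open>F\<close> inside \<open>S\<close> and \<open>T\<close> outside its
  open \<open>h\<close>-neighbourhood; the limit is taken last. The angle of a cut is a single
  parameter and balances a single set: it fixes the proportion of \<open>F\<close>, and the half is
  chosen by averaging so that \<open>T\<close> loses nothing. The pieces keep positive volume, so
  Brunn-Minkowski applies to them directly and no limit measure on a segment is formed; the price is
  an error in all distances proportional to the thickness, which tends to 0 afterwards. On the line
  the two sets may interlace, so the bound obtained is \<open>I \<sigma>\<close> for some \<sigma>
  between the proportion of \<open>T\<close> and one minus that of \<open>F\<close>; lower
  semicontinuity of \<open>I\<close> closes this gap as \<open>h\<close> shrinks. Subadditivity and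
  semicontinuity both come from symmetry and one property inherited from every truncated cone:
  \<open>I x / x\<close> is nonincreasing.\<close>

abbreviation (input) vol :: "'a::euclidean_space set \<Rightarrow> real" where
  "vol \<equiv> measure lebesgue"

section \<open>Half-spaces and measure\<close>

text \<open>With these rules the simplifier would move Borel sets from \<open>lebesgue\<close> to \<open>lborel\<close>.\<close>

declare measure_completion [simp del] emeasure_completion [simp del]

text \<open>Dominated convergence: off the null set where \<open>g a\<close> vanishes, the sign of
  \<open>g (u k) y\<close> is eventually that of \<open>g a y\<close>. A general family
  \<open>g\<close> serves both for translated hyperplanes and for half-planes that rotate about a
  point.\<close>

lemma continuous_on_measure_halfspace:
  fixes K :: "'a::euclidean_space set" and g :: "real \<Rightarrow> 'a \<Rightarrow> real"
  assumes K: "K \<in> lmeasurable"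
    and cont: "\<And>y. continuous_on UNIV (\<lambda>t. g t y)"
    and neg: "\<And>t. negligible {y. g t y = 0}"
    and meas: "\<And>t. {y. g t y > 0} \<in> sets lebesgue"
  shows "continuous_on UNIV (\<lambda>t. vol (K \<inter> {y. g t y > 0}))"
proof (rule continuous_on_sequentiallyI)
  fix u :: "nat \<Rightarrow> real" and a assume u: "u \<longlonglongrightarrow> a"
  have Ks: "K \<in> sets lebesgue" using K by auto
  have m: "K \<inter> {y. g t y > 0} \<in> lmeasurable" for t
    using fmeasurable.Int[OF K, of "{y. g t y > 0}"] K meas by (simp add: fmeasurable_Int_fmeasurable)
  have AE: "AE y in lebesgue. g a y \<noteq> 0"
    using neg[of a] by (simp add: negligible_iff_null_sets AE_iff_null_sets null_setsD2 AE_not_in[of "{y. g a y = 0}" lebesgue, simplified])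
  have "(\<lambda>k. integral\<^sup>L lebesgue (indicator (K \<inter> {y. g (u k) y > 0}) :: 'a \<Rightarrow> real))
      \<longlonglongrightarrow> integral\<^sup>L lebesgue (indicator (K \<inter> {y. g a y > 0}))"
  proof (rule integral_dominated_convergence[where w = "indicator K"])
    show "integrable lebesgue (indicator K :: 'a \<Rightarrow> real)"
      using K by (simp add: integrable_indicator_iff fmeasurable_def)
    show "AE y in lebesgue. (\<lambda>k. indicator (K \<inter> {y. g (u k) y > 0}) y :: real)
        \<longlonglongrightarrow> indicator (K \<inter> {y. g a y > 0}) y"
      using AE
    proof eventually_elim
      case (elim y)
      have lim: "(\<lambda>k. g (u k) y) \<longlonglongrightarrow> g a y"
        using continuous_on_tendsto_compose[OF cont[of y] u] by simp
      have "eventually (\<lambda>k. (g (u k) y > 0) = (g a y > 0)) sequentially"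
      proof (cases "g a y > 0")
        case True
        then show ?thesis using order_tendstoD(1)[OF lim True] by (auto elim!: eventually_mono)
      next
        case False
        then have "g a y < 0" using elim by simp
        then show ?thesis using order_tendstoD(2)[OF lim, of 0] False by (auto elim!: eventually_mono)
      qed
      then have "eventually (\<lambda>k. indicator (K \<inter> {y. g (u k) y > 0}) y = (indicator (K \<inter> {y. g a y > 0}) y::real)) sequentially"
        by eventually_elim (auto simp: indicator_def)
      then show ?case by (rule tendsto_eventually)
    qed
  qed (use m Ks meas in \<open>auto simp: indicator_def fmeasurableD\<close>)
  then show "(\<lambda>k. vol (K \<inter> {y. g (u k) y > 0})) \<longlonglongrightarrow> vol (K \<inter> {y. g a y > 0})"
    by simp
qed

lemma lmeasurable_Int_halfspaces:
  fixes K :: "'a::euclidean_space set"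
  assumes "K \<in> lmeasurable"
  shows "K \<inter> {y. c < y \<bullet> i} \<in> lmeasurable" "K \<inter> {y. y \<bullet> i < c} \<in> lmeasurable"
    "K \<inter> {y. c \<le> y \<bullet> i} \<in> lmeasurable" "K \<inter> {y. y \<bullet> i \<le> c} \<in> lmeasurable"
proof -
  have "{y::'a. c < y \<bullet> i} \<in> sets borel" "{y::'a. y \<bullet> i < c} \<in> sets borel"
    "{y::'a. c \<le> y \<bullet> i} \<in> sets borel" "{y::'a. y \<bullet> i \<le> c} \<in> sets borel" by measurable
  then show "K \<inter> {y. c < y \<bullet> i} \<in> lmeasurable" "K \<inter> {y. y \<bullet> i < c} \<in> lmeasurable"
    "K \<inter> {y. c \<le> y \<bullet> i} \<in> lmeasurable" "K \<inter> {y. y \<bullet> i \<le> c} \<in> lmeasurable"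
    using assms by (auto intro!: fmeasurable_Int_fmeasurable)
qed

lemma continuous_on_measure_less:
  fixes K :: "'a::euclidean_space set"
  assumes "K \<in> lmeasurable" "i \<noteq> 0"
  shows "continuous_on UNIV (\<lambda>t. vol (K \<inter> {y. y \<bullet> i < t}))"
proof -
  have "continuous_on UNIV (\<lambda>t. vol (K \<inter> {y. t - y \<bullet> i > 0}))"
  proof (rule continuous_on_measure_halfspace[OF assms(1)])
    show "continuous_on UNIV (\<lambda>t. t - y \<bullet> i)" for y :: 'a by (intro continuous_intros)
    have "{y. t - y \<bullet> i = 0} = {y. i \<bullet> y = t}" for t by (auto simp: inner_commute)
    then show "negligible {y. t - y \<bullet> i = 0}" for t
      using negligible_hyperplane[of i t] assms(2) by simp
    have "{y::'a. t - y \<bullet> i > 0} \<in> sets borel" for t by measurable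
    then show "{y. t - y \<bullet> i > 0} \<in> sets lebesgue" for t by auto
  qed
  then show ?thesis by simp
qed

lemma measure_split_halfspaces:
  fixes K :: "'a::euclidean_space set"
  assumes K: "K \<in> lmeasurable" and "i \<noteq> 0"
  shows "vol K = vol (K \<inter> {y. y \<bullet> i < t}) + vol (K \<inter> {y. t < y \<bullet> i})"
proof -
  let ?P = "K \<inter> {y. y \<bullet> i < t}" and ?Q = "K \<inter> {y. t < y \<bullet> i}"
  have PQ: "?P \<in> lmeasurable" "?Q \<in> lmeasurable" using lmeasurable_Int_halfspaces[OF K] by auto
  have "vol K = vol (?P \<union> ?Q)"
  proof (rule measure_negligible_symdiff)
    show "?P \<union> ?Q \<in> lmeasurable" using PQ by blast
    show "negligible ((?P \<union> ?Q - K) \<union> (K - (?P \<union> ?Q)))"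
      by (rule negligible_subset[OF negligible_hyperplane[of i t]]) (use assms in \<open>auto simp: inner_commute\<close>)
  qed
  also have "\<dots> = measure lebesgue ?P + measure lebesgue ?Q"
    by (rule measure_Un_AE[OF _ PQ]) auto
  finally show ?thesis .
qed

lemma open_measure_pos:
  fixes S :: "'a::euclidean_space set"
  assumes "open S" "S \<noteq> {}" "bounded S" shows "vol S > 0"
proof -
  have "S \<in> lmeasurable" using assms by (simp add: lmeasurable_open)
  then show ?thesis
    using open_not_negligible[OF assms(1,2)] by (metis negligible_iff_measure zero_less_measure_iff)
qed

section \<open>The Brunn-Minkowski inequality\<close>

text \<open>The Minkowski sum, written in the shape of \<open>open_sums\<close>,
  \<open>bounded_sums\<close> and \<open>compact_closed_sums\<close>.\<close>

definition sumset :: "'a::real_vector set \<Rightarrow> 'a set \<Rightarrow> 'a set" where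
  "sumset A B = (\<Union>x\<in>A. \<Union>y\<in>B. {x + y})"

abbreviation BM_ineq :: "'a::euclidean_space set \<Rightarrow> 'a set \<Rightarrow> bool" where
  "BM_ineq A B \<equiv> root DIM('a) (vol A) + root DIM('a) (vol B) \<le> root DIM('a) (vol (sumset A B))"

lemma sumset_iff: "z \<in> sumset A B \<longleftrightarrow> (\<exists>x\<in>A. \<exists>y\<in>B. z = x + y)"
  by (auto simp: sumset_def)

lemma sumset_mono: "A \<subseteq> A' \<Longrightarrow> B \<subseteq> B' \<Longrightarrow> sumset A B \<subseteq> sumset A' B'"
  by (auto simp: sumset_def)

lemma sumset_commute: "sumset A B = sumset B A"
  by (auto simp: sumset_iff) (metis add.commute)+

lemma sumset_open_bounded:
  fixes A B :: "'a::euclidean_space set"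
  assumes "open A" "bounded A" "bounded B"
  shows "open (sumset A B)" "bounded (sumset A B)"
proof -
  show "open (sumset A B)" using open_sums[of A B] assms(1) by (simp add: sumset_def)
  show "bounded (sumset A B)" using bounded_sums[OF assms(2,3)] by (simp add: sumset_def)
qed

text \<open>Empty boxes are excluded so that the cardinality, on which the Brunn-Minkowski induction
  runs, counts only boxes of positive volume, and any two of them can be separated.\<close>

definition box_family :: "'a::euclidean_space set set \<Rightarrow> bool" where
  "box_family \<A> \<longleftrightarrow> finite \<A> \<and> (\<forall>X\<in>\<A>. X \<noteq> {} \<and> (\<exists>a b. X = box a b)) \<and> pairwise disjnt \<A>"

lemma box_Int_halfspace:
  fixes a b :: "'a::euclidean_space"
  assumes i: "i \<in> Basis"
  shows "\<exists>a' b'. box a b \<inter> {y. y \<bullet> i < t} = box a' b'" "\<exists>a' b'. box a b \<inter> {y. t < y \<bullet> i} = box a' b'"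
proof -
  have "box a b \<inter> {y. y \<bullet> i < t} = box a (\<Sum>j\<in>Basis. (if j = i then min (b \<bullet> j) t else b \<bullet> j) *\<^sub>R j)"
    using i by (auto simp: mem_box) (metis min_less_iff_conj)+
  then show "\<exists>a' b'. box a b \<inter> {y. y \<bullet> i < t} = box a' b'" by blast
  have "box a b \<inter> {y. t < y \<bullet> i} = box (\<Sum>j\<in>Basis. (if j = i then max (a \<bullet> j) t else a \<bullet> j) *\<^sub>R j) b"
    using i by (auto simp: mem_box) (metis max_less_iff_conj)+
  then show "\<exists>a' b'. box a b \<inter> {y. t < y \<bullet> i} = box a' b'" by blast
qed

text \<open>A half-space cuts each box to one box or to nothing, and empty remnants are dropped. The
  strict decrease when some box is missed is what makes the induction terminate.\<close>

lemma box_family_Int: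
  assumes "box_family \<A>" and H: "\<And>a b. \<exists>a' b'. box a b \<inter> H = box a' b'"
  obtains \<A>' where "box_family \<A>'" "\<Union>\<A>' = \<Union>\<A> \<inter> H" "card \<A>' \<le> card \<A>"
    "\<And>X. X \<in> \<A> \<Longrightarrow> X \<inter> H = {} \<Longrightarrow> card \<A>' < card \<A>"
proof
  let ?A = "(\<lambda>X. X \<inter> H) ` {X\<in>\<A>. X \<inter> H \<noteq> {}}"
  have fin: "finite \<A>" using assms(1) by (simp add: box_family_def)
  show "box_family ?A"
    using assms(1) H unfolding box_family_def pairwise_image pairwise_def disjnt_def
    by (auto; metis (no_types, lifting) disjoint_iff IntI)
  show "\<Union>?A = \<Union>\<A> \<inter> H" by auto
  have "card ?A \<le> card {X\<in>\<A>. X \<inter> H \<noteq> {}}" using fin by (intro card_image_le) auto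
  moreover have "card {X\<in>\<A>. X \<inter> H \<noteq> {}} \<le> card \<A>" using fin by (intro card_mono) auto
  ultimately show "card ?A \<le> card \<A>" by simp
  fix X assume X: "X \<in> \<A>" "X \<inter> H = {}"
  then have "{X\<in>\<A>. X \<inter> H \<noteq> {}} \<subset> \<A>" by auto
  then have "card {X\<in>\<A>. X \<inter> H \<noteq> {}} < card \<A>" using fin by (intro psubset_card_mono) auto
  with \<open>card ?A \<le> card {X\<in>\<A>. X \<inter> H \<noteq> {}}\<close> show "card ?A < card \<A>" by simp
qed

lemma box_family_Union:
  fixes \<A> :: "'a::euclidean_space set set"
  assumes "box_family \<A>"
  shows "open (\<Union>\<A>)" "bounded (\<Union>\<A>)"
  using assms by (auto simp: box_family_def intro!: open_Union bounded_Union)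

text \<open>Open boxes meet as soon as their projections to every axis meet, so disjointness is
  visible on a single axis.\<close>

lemma disjoint_boxes_separated:
  fixes a b c d :: "'a::euclidean_space"
  assumes "box a b \<noteq> {}" "box c d \<noteq> {}" "disjnt (box a b) (box c d)"
  obtains i t where "i \<in> Basis" "box a b \<subseteq> {y. y \<bullet> i < t}" "box c d \<subseteq> {y. t < y \<bullet> i}"
  | i t where "i \<in> Basis" "box a b \<subseteq> {y. t < y \<bullet> i}" "box c d \<subseteq> {y. y \<bullet> i < t}"
proof -
  from assms(3) obtain i where i: "i \<in> Basis" "min (b \<bullet> i) (d \<bullet> i) \<le> max (a \<bullet> i) (c \<bullet> i)"
    unfolding disjnt_def box_Int_box box_eq_empty by auto
  have "a \<bullet> i < b \<bullet> i" "c \<bullet> i < d \<bullet> i" using assms(1,2) i(1) by (auto simp: box_ne_empty)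
  then consider "b \<bullet> i \<le> c \<bullet> i" | "d \<bullet> i \<le> a \<bullet> i" using i(2) by linarith
  then show thesis
  proof cases
    case 1
    show ?thesis by (rule that(1)[OF i(1), of "b \<bullet> i"]) (use 1 i in \<open>auto simp: mem_box\<close>; fastforce)+
  next
    case 2
    show ?thesis by (rule that(2)[OF i(1), of "d \<bullet> i"]) (use 2 i in \<open>auto simp: mem_box\<close>; fastforce)+
  qed
qed

lemma sumset_boxes:
  fixes a b c d :: "'a::euclidean_space"
  assumes "box a b \<noteq> {}" "box c d \<noteq> {}"
  shows "box (a + c) (b + d) \<subseteq> sumset (box a b) (box c d)"
proof
  fix z assume z: "z \<in> box (a + c) (b + d)"
  have ab: "\<And>i. i \<in> Basis \<Longrightarrow> a \<bullet> i < b \<bullet> i" "\<And>i. i \<in> Basis \<Longrightarrow> c \<bullet> i < d \<bullet> i"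
    using assms by (auto simp: box_ne_empty)
  have zi: "\<And>i. i \<in> Basis \<Longrightarrow> a \<bullet> i + c \<bullet> i < z \<bullet> i \<and> z \<bullet> i < b \<bullet> i + d \<bullet> i"
    using z by (auto simp: mem_box inner_add_left)
  have "\<exists>u. a \<bullet> i < u \<and> u < b \<bullet> i \<and> c \<bullet> i < z \<bullet> i - u \<and> z \<bullet> i - u < d \<bullet> i" if "i \<in> Basis" for i
  proof -
    have "max (a \<bullet> i) (z \<bullet> i - d \<bullet> i) < min (b \<bullet> i) (z \<bullet> i - c \<bullet> i)"
      using ab[OF that] zi[OF that] by auto
    then obtain u where "max (a \<bullet> i) (z \<bullet> i - d \<bullet> i) < u" "u < min (b \<bullet> i) (z \<bullet> i - c \<bullet> i)"
      using dense by blast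
    then show ?thesis by (intro exI[of _ u]) auto
  qed
  then obtain u where u: "\<And>i. i \<in> Basis \<Longrightarrow> a \<bullet> i < u i \<and> u i < b \<bullet> i \<and> c \<bullet> i < z \<bullet> i - u i \<and> z \<bullet> i - u i < d \<bullet> i"
    by metis
  let ?x = "\<Sum>i\<in>Basis. u i *\<^sub>R i"
  have "?x \<in> box a b" "z - ?x \<in> box c d" using u by (auto simp: mem_box inner_diff_left)
  then show "z \<in> sumset (box a b) (box c d)" by (force simp: sumset_iff)
qed

lemma measure_lebesgue_box:
  fixes a b :: "'a::euclidean_space"
  assumes "\<And>i. i \<in> Basis \<Longrightarrow> a \<bullet> i < b \<bullet> i"
  shows "vol (box a b) = (\<Prod>i\<in>Basis. b \<bullet> i - a \<bullet> i)"
  using assms by (simp add: measure_completion measure_lborel_box inner_diff_left less_imp_le)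

text \<open>After division by the right-hand side this is the arithmetic-geometric mean inequality
  for the ratios \<open>l i / (l i + m i)\<close> and for the ratios
  \<open>m i / (l i + m i)\<close>; the two means add up to 1.\<close>

lemma Brunn_Minkowski_box:
  fixes a b c d :: "'a::euclidean_space"
  assumes ne: "box a b \<noteq> {}" "box c d \<noteq> {}"
  shows "BM_ineq (box a b) (box c d)"
proof -
  let ?n = "DIM('a)"
  define l m where "l = (\<lambda>i::'a. b \<bullet> i - a \<bullet> i)" and "m = (\<lambda>i::'a. d \<bullet> i - c \<bullet> i)"
  have lm: "\<And>i. i \<in> Basis \<Longrightarrow> 0 < l i" "\<And>i. i \<in> Basis \<Longrightarrow> 0 < m i"
    using ne by (auto simp: box_ne_empty l_def m_def)
  have Ml: "vol (box a b) = prod l Basis" "vol (box c d) = prod m Basis"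
    "vol (box (a + c) (b + d)) = prod (\<lambda>i. l i + m i) Basis"
    using lm by (auto simp: measure_lebesgue_box l_def m_def inner_add_left add_strict_mono intro!: prod.cong)
  have am: "root ?n (prod g Basis) \<le> (\<Sum>i\<in>Basis. g i / ?n)" if "\<And>i::'a. i \<in> Basis \<Longrightarrow> 0 < g i" for g
  proof -
    have "prod g Basis > 0" using that by (intro prod_pos) auto
    then have "root ?n (prod g Basis) = prod g Basis powr (1 / ?n)" by (simp add: root_powr_inverse)
    then show ?thesis using arith_geom_mean[of "Basis :: 'a set" g] that by (simp add: less_imp_le)
  qed
  let ?s = "\<lambda>i. l i + m i"
  have P: "prod ?s Basis > 0" using lm by (intro prod_pos) (auto simp: add_pos_pos)
  have "root ?n (prod l Basis) / root ?n (prod ?s Basis) + root ?n (prod m Basis) / root ?n (prod ?s Basis)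
      = root ?n (\<Prod>i\<in>Basis. l i / ?s i) + root ?n (\<Prod>i\<in>Basis. m i / ?s i)"
    by (simp add: prod_dividef real_root_divide)
  also have "\<dots> \<le> (\<Sum>i\<in>Basis. (l i / ?s i) / ?n) + (\<Sum>i\<in>Basis. (m i / ?s i) / ?n)"
    using lm by (intro add_mono am) (auto simp: add_pos_pos)
  also have "\<dots> = (\<Sum>i\<in>(Basis::'a set). 1 / ?n)"
    unfolding sum.distrib[symmetric]
  proof (rule sum.cong)
    fix i :: 'a assume "i \<in> Basis"
    with lm have "l i > 0" "m i > 0" by auto
    then show "l i / ?s i / ?n + m i / ?s i / ?n = 1 / ?n" by (simp add: add_divide_distrib[symmetric])
  qed simp
  also have "\<dots> = 1" by simp
  finally have "root ?n (prod l Basis) + root ?n (prod m Basis) \<le> root ?n (prod ?s Basis)"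
    using P by (simp add: add_divide_distrib[symmetric] real_root_gt_zero)
  also have "\<dots> \<le> root ?n (vol (sumset (box a b) (box c d)))"
  proof -
    have "vol (box (a + c) (b + d)) \<le> vol (sumset (box a b) (box c d))"
      using sumset_open_bounded[OF open_box bounded_box bounded_box, of a b c d]
      by (intro measure_mono_fmeasurable sumset_boxes ne) (auto simp: lmeasurable_open)
    then show ?thesis by (simp add: Ml)
  qed
  finally show ?thesis by (simp add: Ml)
qed

text \<open>Induction step of Hadwiger and Ohmann. \<open>B\<close> is cut parallel to the cut of
  \<open>A\<close>, at the level \<open>s\<close> that splits the two volumes in the same ratio
  \<alpha>. The sums of corresponding halves lie on opposite sides of the level
  \<open>t + s\<close>, so their volumes add, and the equal ratio makes the two lower bounds add up
  to the n-th power of the sum of roots. \<open>BM\<close> is assumed for all \<open>s\<close>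
  because the right level is found only inside, by the intermediate value theorem.\<close>

lemma measure_root_split:
  fixes A B :: "'a::euclidean_space set"
  assumes opn: "open A" "open B" "bounded A" "bounded B" "B \<noteq> {}" and i: "i \<in> Basis"
    and ne: "A \<inter> {y. y \<bullet> i < t} \<noteq> {}" "A \<inter> {y. t < y \<bullet> i} \<noteq> {}"
    and BM: "\<And>s. B \<inter> {y. y \<bullet> i < s} \<noteq> {} \<Longrightarrow> B \<inter> {y. s < y \<bullet> i} \<noteq> {} \<Longrightarrow>
      BM_ineq (A \<inter> {y. y \<bullet> i < t}) (B \<inter> {y. y \<bullet> i < s}) \<and>
      BM_ineq (A \<inter> {y. t < y \<bullet> i}) (B \<inter> {y. s < y \<bullet> i})"
  shows "BM_ineq A B"
proof -
  let ?n = "DIM('a)"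
  let ?L = "\<lambda>s. {y::'a. y \<bullet> i < s}" and ?R = "\<lambda>s. {y::'a. s < y \<bullet> i}"
  have i0: "i \<noteq> 0" using i by auto
  have op: "open (?L s)" "open (?R s)" for s
    by (auto intro!: open_Collect_less continuous_intros)
  have lm: "A \<in> lmeasurable" "B \<in> lmeasurable" using opn by (auto simp: lmeasurable_open)
  have pA: "vol A > 0" "vol B > 0" using opn ne open_measure_pos by blast+
  have pA1: "vol (A \<inter> ?L t) > 0" "vol (A \<inter> ?R t) > 0"
    using opn ne op by (auto intro!: open_measure_pos bounded_Int)
  have sA: "vol A = vol (A \<inter> ?L t) + vol (A \<inter> ?R t)" by (rule measure_split_halfspaces[OF lm(1) i0])
  define \<alpha> where "\<alpha> = vol (A \<inter> ?L t) / vol A"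
  have \<alpha>: "0 < \<alpha>" "\<alpha> < 1" using pA pA1 sA by (auto simp: \<alpha>_def)
  obtain C where C: "\<And>y. y \<in> B \<Longrightarrow> norm y \<le> C" "C > 0" using opn(4) bounded_pos by blast
  have Ci: "\<bar>y \<bullet> i\<bar> \<le> C" if "y \<in> B" for y using C(1)[OF that] Basis_le_norm[OF i, of y] by linarith
  have "\<exists>s\<ge>-(C+1). s \<le> C+1 \<and> vol (B \<inter> ?L s) = \<alpha> * vol B"
  proof (rule IVT')
    have "B \<inter> ?L (-(C+1)) = {}" "B \<inter> ?L (C+1) = B" using Ci by fastforce+
    then show "vol (B \<inter> ?L (-(C+1))) \<le> \<alpha> * vol B" "\<alpha> * vol B \<le> vol (B \<inter> ?L (C+1))"
      using \<alpha> pA by (auto simp: mult_left_le_one_le)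
    show "continuous_on {-(C+1)..C+1} (\<lambda>s. vol (B \<inter> ?L s))"
      using continuous_on_measure_less[OF lm(2) i0] continuous_on_subset by blast
  qed (use C in auto)
  then obtain s where s: "vol (B \<inter> ?L s) = \<alpha> * vol B" by auto
  have sB: "vol B = vol (B \<inter> ?L s) + vol (B \<inter> ?R s)" by (rule measure_split_halfspaces[OF lm(2) i0])
  then have s': "vol (B \<inter> ?R s) = (1 - \<alpha>) * vol B" using s by (simp add: algebra_simps)
  have A1: "vol (A \<inter> ?L t) = \<alpha> * vol A" "vol (A \<inter> ?R t) = (1 - \<alpha>) * vol A"
    using sA pA by (auto simp: \<alpha>_def field_simps)
  have neB: "B \<inter> ?L s \<noteq> {}" "B \<inter> ?R s \<noteq> {}"
    using s s' \<alpha> pA by (auto simp: less_le)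
  let ?r = "root ?n (vol A) + root ?n (vol B)"
  let ?S1 = "sumset (A \<inter> ?L t) (B \<inter> ?L s)" and ?S2 = "sumset (A \<inter> ?R t) (B \<inter> ?R s)"
  have r0: "?r \<ge> 0" using pA by (simp add: real_root_ge_zero)
  have key: "\<beta> * ?r ^ ?n \<le> x" if "0 < \<beta>" "root ?n (\<beta> * vol A) + root ?n (\<beta> * vol B) \<le> root ?n x" "x \<ge> 0" for \<beta> x
  proof -
    have "root ?n \<beta> * ?r \<le> root ?n x" using that(2) by (simp add: real_root_mult algebra_simps)
    then have "(root ?n \<beta> * ?r) ^ ?n \<le> root ?n x ^ ?n" using r0 that(1)
      by (intro power_mono) (auto simp: real_root_ge_zero)
    then show ?thesis using that by (simp add: power_mult_distrib)
  qed
  have k1: "\<alpha> * ?r ^ ?n \<le> vol ?S1" using BM[OF neB] A1 s \<alpha> by (intro key) auto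
  have k2: "(1 - \<alpha>) * ?r ^ ?n \<le> vol ?S2" using BM[OF neB] A1 s' \<alpha> by (intro key) auto
  have mS: "?S1 \<in> lmeasurable" "?S2 \<in> lmeasurable" "sumset A B \<in> lmeasurable"
    using sumset_open_bounded[of "A \<inter> ?L t" "B \<inter> ?L s"] sumset_open_bounded[of "A \<inter> ?R t" "B \<inter> ?R s"]
      sumset_open_bounded[of A B] opn op by (auto intro!: lmeasurable_open bounded_Int)
  have "?S1 \<inter> ?S2 = {}"
  proof -
    have "?S1 \<subseteq> ?L (t + s)" "?S2 \<subseteq> ?R (t + s)" by (auto simp: sumset_iff inner_add_left)
    then show ?thesis by fastforce
  qed
  then have "vol ?S1 + vol ?S2 = vol (?S1 \<union> ?S2)"
    by (subst measure_Un_AE[OF _ mS(1,2)]) (auto simp: disjoint_iff)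
  also have "\<dots> \<le> vol (sumset A B)"
    using mS by (intro measure_mono_fmeasurable Un_least sumset_mono) auto
  finally have "?r ^ ?n \<le> vol (sumset A B)" using k1 k2 by (simp add: algebra_simps)
  then have "root ?n (?r ^ ?n) \<le> root ?n (vol (sumset A B))" by simp
  then show ?thesis using r0 by (simp add: real_root_power_cancel)
qed

text \<open>Induction on the total number of boxes. A hyperplane separating two boxes of one family
  lowers the number on that side of the sum strictly in both halves, while the number for the other
  family does not grow.\<close>

lemma Brunn_Minkowski_box_family:
  fixes \<A> \<B> :: "'a::euclidean_space set set"
  assumes "box_family \<A>" "box_family \<B>" "\<A> \<noteq> {}" "\<B> \<noteq> {}"
  shows "BM_ineq (\<Union>\<A>) (\<Union>\<B>)"
  using assms
proof (induction "card \<A> + card \<B>" arbitrary: \<A> \<B> rule: less_induct)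
  case less
  \<comment> \<open>Stated for any pair with the same total number of boxes, so that it can also be
    used with the two families exchanged.\<close>
  have step: "BM_ineq (\<Union>\<C>) (\<Union>\<D>)"
    if CD: "box_family \<C>" "box_family \<D>" "\<C> \<noteq> {}" "\<D> \<noteq> {}" "card \<C> + card \<D> = card \<A> + card \<B>" "2 \<le> card \<C>"
    for \<C> \<D> :: "'a set set"
  proof -
    from CD(6) have "\<not> card \<C> \<le> Suc 0" by simp
    then obtain X Y where XY: "X \<in> \<C>" "Y \<in> \<C>" "X \<noteq> Y"
      using card_le_Suc0_iff_eq[of \<C>] CD(1) by (auto simp: box_family_def)
    have XYn: "X \<noteq> {}" "Y \<noteq> {}" "disjnt X Y"
      using XY CD(1) by (auto simp: box_family_def pairwise_def)
    obtain a b c d where ab: "X = box a b" "Y = box c d" using XY CD(1) unfolding box_family_def by meson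
    from disjoint_boxes_separated[of a b c d] XYn ab
    have "\<exists>i t. i \<in> Basis \<and> (X \<subseteq> {y. y \<bullet> i < t} \<and> Y \<subseteq> {y. t < y \<bullet> i} \<or> X \<subseteq> {y. t < y \<bullet> i} \<and> Y \<subseteq> {y. y \<bullet> i < t})"
      by metis
    then obtain i t Z W where i: "i \<in> Basis" and ZW: "Z \<in> \<C>" "W \<in> \<C>" "Z \<noteq> {}" "W \<noteq> {}"
      and sub: "Z \<subseteq> {y. y \<bullet> i < t}" "W \<subseteq> {y. t < y \<bullet> i}"
      using XY XYn by metis
    have disj: "W \<inter> {y. y \<bullet> i < t} = {}" "Z \<inter> {y. t < y \<bullet> i} = {}" using sub by fastforce+
    show ?thesis
    proof (rule measure_root_split[where i = i and t = t])
      show "open (\<Union>\<C>)" "open (\<Union>\<D>)" "bounded (\<Union>\<C>)" "bounded (\<Union>\<D>)" using CD box_family_Union by blast+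
      show "\<Union>\<D> \<noteq> {}" using CD by (auto simp: box_family_def)
      show "\<Union>\<C> \<inter> {y. y \<bullet> i < t} \<noteq> {}" "\<Union>\<C> \<inter> {y. t < y \<bullet> i} \<noteq> {}" using ZW sub by blast+
      have ih: "BM_ineq (\<Union>\<C> \<inter> H) (\<Union>\<D> \<inter> H')"
        if H: "\<And>a b. \<exists>a' b'. box a b \<inter> H = box a' b'" "\<And>a b. \<exists>a' b'. box a b \<inter> H' = box a' b'"
          and ne: "\<Union>\<C> \<inter> H \<noteq> {}" "\<Union>\<D> \<inter> H' \<noteq> {}" and Q: "Q \<in> \<C>" "Q \<inter> H = {}" for H H' Q
      proof -
        obtain \<C>' where C': "box_family \<C>'" "\<Union>\<C>' = \<Union>\<C> \<inter> H" "card \<C>' < card \<C>"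
          using box_family_Int[OF CD(1) H(1)] Q by metis
        obtain \<D>' where D': "box_family \<D>'" "\<Union>\<D>' = \<Union>\<D> \<inter> H'" "card \<D>' \<le> card \<D>"
          using box_family_Int[OF CD(2) H(2)] by metis
        have "\<C>' \<noteq> {}" "\<D>' \<noteq> {}" using ne C' D' by auto
        moreover have "card \<C>' + card \<D>' < card \<A> + card \<B>" using C' D' CD by linarith
        ultimately show ?thesis using less.hyps[of \<C>' \<D>'] C' D' by metis
      qed
      fix s assume neD: "\<Union>\<D> \<inter> {y. y \<bullet> i < s} \<noteq> {}" "\<Union>\<D> \<inter> {y. s < y \<bullet> i} \<noteq> {}"
      have neC: "\<Union>\<C> \<inter> {y. y \<bullet> i < t} \<noteq> {}" "\<Union>\<C> \<inter> {y. t < y \<bullet> i} \<noteq> {}" using ZW sub by blast+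
      show "BM_ineq (\<Union>\<C> \<inter> {y. y \<bullet> i < t}) (\<Union>\<D> \<inter> {y. y \<bullet> i < s}) \<and>
      BM_ineq (\<Union>\<C> \<inter> {y. t < y \<bullet> i}) (\<Union>\<D> \<inter> {y. s < y \<bullet> i})"
        using ih[OF box_Int_halfspace(1)[OF i] box_Int_halfspace(1)[OF i] neC(1) neD(1) ZW(2) disj(1)]
          ih[OF box_Int_halfspace(2)[OF i] box_Int_halfspace(2)[OF i] neC(2) neD(2) ZW(1) disj(2)] by blast
    qed (use i in auto)
  qed
  have fin: "finite \<A>" "finite \<B>" using less.prems by (auto simp: box_family_def)
  have "card \<A> \<ge> 1" "card \<B> \<ge> 1" using fin less.prems by (auto simp: Suc_le_eq card_gt_0_iff)
  then consider "2 \<le> card \<A>" | "2 \<le> card \<B>" | "card \<A> = 1" "card \<B> = 1" by linarith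
  then show ?case
  proof cases
    case 1 then show ?thesis using step[of \<A> \<B>] less.prems by blast
  next
    case 2 then show ?thesis using step[of \<B> \<A>] less.prems
      by (simp add: sumset_commute[of "\<Union>\<A>"] add.commute)
  next
    case 3
    then obtain X Y where "\<A> = {X}" "\<B> = {Y}" by (meson card_1_singletonE)
    moreover obtain a b c d where "X = box a b" "Y = box c d" "X \<noteq> {}" "Y \<noteq> {}"
      using less.prems calculation unfolding box_family_def by (metis insertI1)
    ultimately show ?thesis using Brunn_Minkowski_box[of a b c d] by simp
  qed
qed

text \<open>An open set is a countable union of closed boxes, and finitely many of them carry all
  but \<epsilon> of the volume. Refining these to a division confines overlaps to frontiers, so
  passing to interiors loses only a null set.\<close>

lemma open_inner_box_family:
  fixes S :: "'a::euclidean_space set"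
  assumes "open S" "bounded S" "S \<noteq> {}" "0 < \<epsilon>"
  obtains \<A> where "box_family \<A>" "\<Union>\<A> \<subseteq> S" "vol S - \<epsilon> < vol (\<Union>\<A>)"
proof -
  obtain \<D> where D: "countable \<D>" "\<D> \<subseteq> Pow S" "\<And>X. X \<in> \<D> \<Longrightarrow> \<exists>a b. X = cbox a b" "\<Union>\<D> = S"
    using open_countable_Union_open_cbox[OF assms(1)] by metis
  have S: "S \<in> lmeasurable" using assms by (simp add: lmeasurable_open)
  have D': "d \<in> lmeasurable" if "d \<in> \<D>" for d using D(3)[OF that] by auto
  obtain \<F> where F: "\<F> \<subseteq> \<D>" "finite \<F>" "vol (\<Union>\<D>) - \<epsilon> < vol (\<Union>\<F>)"
  proof (rule measure_countable_Union_approachable[OF D(1) assms(4) D'])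
    show "vol (\<Union>\<F>) \<le> vol S" if "\<F> \<subseteq> \<D>" "finite \<F>" for \<F>
      using that D(2) S D' by (intro measure_mono_fmeasurable fmeasurableD[OF fmeasurable.finite_Union]) auto
  qed auto
  obtain p where p: "p division_of \<Union>\<F>"
    using elementary_unions_intervals[OF F(2)] D(3) F(1) by (metis subsetD)
  define \<A> where "\<A> = interior ` p - {{}}"
  show thesis
  proof
    show "box_family \<A>"
      using p unfolding box_family_def \<A>_def pairwise_def disjnt_def
      by (auto dest: division_ofD(5)[OF p] simp: division_of_def) (metis interior_cbox)
    have "\<Union>\<A> \<subseteq> \<Union>p" using interior_subset by (auto simp: \<A>_def)
    also have "\<dots> = \<Union>\<F>" using p by (rule division_ofD(6))
    also have "\<dots> \<subseteq> S" using D(4) F(1) by auto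
    finally show sub: "\<Union>\<A> \<subseteq> S" .
    have opn: "open (\<Union>\<A>)" by (auto simp: \<A>_def)
    have pm: "finite p" "\<And>X. X \<in> p \<Longrightarrow> \<exists>a b. X = cbox a b" using p by (auto simp: division_of_def)
    have "vol (\<Union>\<F>) = vol (\<Union>\<A>)"
    proof (rule measure_negligible_symdiff)
      show "\<Union>\<A> \<in> lmeasurable" using opn sub assms(2) bounded_subset lmeasurable_open by blast
      have "\<Union>\<A> \<subseteq> \<Union>\<F>"
        using \<open>\<Union>\<A> \<subseteq> \<Union>p\<close> division_ofD(6)[OF p] by simp
      moreover have "\<Union>p - \<Union>\<A> \<subseteq> \<Union>(frontier ` p)"
        using closure_subset by (fastforce simp: \<A>_def frontier_def)
      then have "\<Union>\<F> - \<Union>\<A> \<subseteq> \<Union>(frontier ` p)" using division_ofD(6)[OF p] by simp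
      moreover have "negligible (\<Union>(frontier ` p))"
        using pm negligible_convex_frontier convex_box(1) by (intro negligible_Union) blast+
      ultimately show "negligible ((\<Union>\<A> - \<Union>\<F>) \<union> (\<Union>\<F> - \<Union>\<A>))"
        by (metis Diff_eq_empty_iff negligible_subset sup_bot_left)
    qed
    then show "vol S - \<epsilon> < vol (\<Union>\<A>)" using F(3) D(4) by simp
  qed
qed

theorem Brunn_Minkowski_open:
  fixes A B :: "'a::euclidean_space set"
  assumes "open A" "open B" "bounded A" "bounded B" "A \<noteq> {}" "B \<noteq> {}"
  shows "BM_ineq A B"
proof (rule tendsto_upperbound)
  let ?n = "DIM('a)"
  have pos: "vol A > 0" "vol B > 0" using assms open_measure_pos by blast+
  show "((\<lambda>\<epsilon>. root ?n (vol A - \<epsilon>) + root ?n (vol B - \<epsilon>)) \<longlongrightarrow> root ?n (vol A) + root ?n (vol B)) (at_right 0)"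
  proof -
    have "((\<lambda>\<epsilon>. m - \<epsilon>) \<longlongrightarrow> m) (at_right 0)" for m :: real
      using tendsto_diff[OF tendsto_const tendsto_ident_at, of m "0::real"] by simp
    then show ?thesis by (intro tendsto_add tendsto_real_root)
  qed
  have "root ?n (vol A - \<epsilon>) + root ?n (vol B - \<epsilon>) \<le> root ?n (vol (sumset A B))"
    if e: "0 < \<epsilon>" "\<epsilon> < min (vol A) (vol B)" for \<epsilon>
  proof -
    obtain \<A> \<B> where AB: "box_family \<A>" "\<Union>\<A> \<subseteq> A" "vol A - \<epsilon> < vol (\<Union>\<A>)"
      "box_family \<B>" "\<Union>\<B> \<subseteq> B" "vol B - \<epsilon> < vol (\<Union>\<B>)"
      using open_inner_box_family[OF assms(1,3,5) e(1)] open_inner_box_family[OF assms(2,4,6) e(1)] by metis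
    have "\<A> \<noteq> {}" "\<B> \<noteq> {}" using AB e by auto
    then have "root ?n (vol (\<Union>\<A>)) + root ?n (vol (\<Union>\<B>)) \<le> root ?n (vol (sumset (\<Union>\<A>) (\<Union>\<B>)))"
      using Brunn_Minkowski_box_family AB by blast
    also have "\<dots> \<le> root ?n (vol (sumset A B))"
    proof -
      have "sumset (\<Union>\<A>) (\<Union>\<B>) \<in> lmeasurable" "sumset A B \<in> lmeasurable"
        using sumset_open_bounded[of "\<Union>\<A>" "\<Union>\<B>"] sumset_open_bounded[of A B] AB box_family_Union assms
        by (metis lmeasurable_open)+
      then have "vol (sumset (\<Union>\<A>) (\<Union>\<B>)) \<le> vol (sumset A B)"
        by (intro measure_mono_fmeasurable sumset_mono AB) auto
      then show ?thesis by simp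
    qed
    moreover have "root ?n (vol A - \<epsilon>) \<le> root ?n (vol (\<Union>\<A>))" "root ?n (vol B - \<epsilon>) \<le> root ?n (vol (\<Union>\<B>))"
      using AB by auto
    ultimately show ?thesis by linarith
  qed
  then show "\<forall>\<^sub>F \<epsilon> in at_right 0. root ?n (vol A - \<epsilon>) + root ?n (vol B - \<epsilon>) \<le> root ?n (vol (sumset A B))"
    unfolding eventually_at_right_field using pos by (intro exI[of _ "min (vol A) (vol B)"]) auto
qed auto

text \<open>By convexity of \<open>K\<close> the sum of the slabs scaled by \<open>1 - u\<close> and
  \<open>u\<close> lies in the intermediate slab, so Brunn-Minkowski applies. Using slabs instead of
  hyperplane sections keeps every volume full-dimensional and avoids Fubini.\<close>

lemma open_convex_slab_concave:
  fixes K :: "'a::euclidean_space set" and e :: 'a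
  defines "M \<equiv> \<lambda>a b. vol (K \<inter> {y. a < y \<bullet> e \<and> y \<bullet> e < b})"
  assumes K: "open K" "bounded K" "convex K"
    and pos: "M a b > 0" "M c d > 0" and l: "0 < u" "u < 1"
  shows "(1 - u) * root DIM('a) (M a b) + u * root DIM('a) (M c d)
     \<le> root DIM('a) (M ((1 - u) * a + u * c) ((1 - u) * b + u * d))"
proof -
  let ?n = "DIM('a)"
  let ?S = "\<lambda>a b. K \<inter> {y. a < y \<bullet> e \<and> y \<bullet> e < b}"
  have opn: "open (?S a b)" for a b
    by (intro open_Int K open_Collect_conj open_Collect_less continuous_intros)
  have bdd: "bounded (?S a b)" for a b using K(2) by (auto intro: bounded_subset)
  have ne: "?S a b \<noteq> {}" "?S c d \<noteq> {}" using pos by (auto simp: M_def)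
  have sc: "open ((*\<^sub>R) r ` ?S a b)" "bounded ((*\<^sub>R) r ` ?S a b)"
    "root ?n (vol ((*\<^sub>R) r ` ?S a b)) = r * root ?n (vol (?S a b))" if "r > 0" for r a b
  proof -
    show "open ((*\<^sub>R) r ` ?S a b)" using open_scaling opn that by fastforce
    show "bounded ((*\<^sub>R) r ` ?S a b)" using bounded_scaling bdd by blast
    have "vol ((*\<^sub>R) r ` ?S a b) = r ^ ?n * vol (?S a b)"
      using measure_lebesgue_affine[of r 0 "?S a b"] that by (simp add: image_def)
    then show "root ?n (vol ((*\<^sub>R) r ` ?S a b)) = r * root ?n (vol (?S a b))"
      using that by (simp add: real_root_mult real_root_power_cancel)
  qed
  let ?A = "(*\<^sub>R) (1 - u) ` ?S a b" and ?B = "(*\<^sub>R) u ` ?S c d"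
  have "root ?n (vol ?A) + root ?n (vol ?B) \<le> root ?n (vol (sumset ?A ?B))"
    using ne l sc by (intro Brunn_Minkowski_open) auto
  also have "\<dots> \<le> root ?n (M ((1 - u) * a + u * c) ((1 - u) * b + u * d))"
  proof -
    have "sumset ?A ?B \<subseteq> ?S ((1 - u) * a + u * c) ((1 - u) * b + u * d)"
      using l convexD[OF K(3), of _ _ "1 - u" u]
      by (auto simp: sumset_iff inner_add_left add_strict_mono)
    moreover have "open (sumset ?A ?B)" using sumset_open_bounded[OF sc(1,2) sc(2)] l by simp
    ultimately have "vol (sumset ?A ?B) \<le> M ((1 - u) * a + u * c) ((1 - u) * b + u * d)"
      unfolding M_def using opn bdd by (intro measure_mono_fmeasurable) (auto simp: lmeasurable_open)
    then show ?thesis by simp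
  qed
  finally show ?thesis using sc(3) l by (simp add: M_def)
qed

lemma convex_slab_concave:
  fixes K :: "'a::euclidean_space set" and e :: 'a
  defines "M \<equiv> \<lambda>a b. vol (K \<inter> {y. a < y \<bullet> e \<and> y \<bullet> e < b})"
  assumes K: "bounded K" "convex K"
    and pos: "M a b > 0" "M c d > 0" and l: "0 < u" "u < 1"
  shows "(1 - u) * root DIM('a) (M a b) + u * root DIM('a) (M c d)
     \<le> root DIM('a) (M ((1 - u) * a + u * c) ((1 - u) * b + u * d))"
proof -
  have "M a b = vol (interior K \<inter> {y. a < y \<bullet> e \<and> y \<bullet> e < b})" for a b
    unfolding M_def
  proof (rule measure_negligible_symdiff)
    have "open (interior K \<inter> {y. a < y \<bullet> e \<and> y \<bullet> e < b})"
      by (intro open_Int open_interior open_Collect_conj open_Collect_less continuous_intros)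
    then show "interior K \<inter> {y. a < y \<bullet> e \<and> y \<bullet> e < b} \<in> lmeasurable"
      using K(1) by (intro lmeasurable_open bounded_Int disjI1 bounded_interior) auto
    show "negligible (interior K \<inter> {y. a < y \<bullet> e \<and> y \<bullet> e < b} - K \<inter> {y. a < y \<bullet> e \<and> y \<bullet> e < b} \<union>
         (K \<inter> {y. a < y \<bullet> e \<and> y \<bullet> e < b} - interior K \<inter> {y. a < y \<bullet> e \<and> y \<bullet> e < b}))"
      by (rule negligible_subset[OF negligible_convex_frontier[OF K(2)]])
        (use interior_subset closure_subset in \<open>fastforce simp: frontier_def\<close>)
  qed
  then show ?thesis
    using open_convex_slab_concave[where K = "interior K" and a = a and b = b and c = c and d = d and e = e and u = u] K pos l
    by (simp add: bounded_interior convex_interior)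
qed

section \<open>One-dimensional marginals\<close>

text \<open>\<open>A - B\<close> is nonnegative near \<open>t\<close> and vanishes at
  \<open>t\<close>, so its derivative there is 0; the remainder of \<open>f\<close> is then bounded
  by those of \<open>A\<close> and \<open>B\<close>.\<close>

lemma has_real_derivative_sandwich:
  fixes f A B :: "real \<Rightarrow> real"
  assumes A: "(A has_real_derivative \<alpha>) (at t)" and B: "(B has_real_derivative \<beta>) (at t)"
    and ev: "eventually (\<lambda>s. B s \<le> f s \<and> f s \<le> A s) (at t)" and eq: "A t = f t" "B t = f t"
  shows "\<alpha> = \<beta>" "(f has_real_derivative \<alpha>) (at t)"
proof -
  obtain d where d: "d > 0" "\<And>s. s \<noteq> t \<Longrightarrow> dist s t < d \<Longrightarrow> B s \<le> f s \<and> f s \<le> A s"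
    using ev by (auto simp: eventually_at)
  have "((\<lambda>s. A s - B s) has_real_derivative \<alpha> - \<beta>) (at t)" by (intro DERIV_diff A B)
  moreover have "\<forall>s. \<bar>t - s\<bar> < d \<longrightarrow> A t - B t \<le> A s - B s"
    using d(2) eq by (force simp: dist_real_def abs_minus_commute)
  ultimately have "\<alpha> - \<beta> = 0" using DERIV_local_min d(1) by blast
  then show ab: "\<alpha> = \<beta>" by simp
  let ?r = "\<lambda>h s. (h s - h t - \<alpha> * (s - t)) /\<^sub>R norm (s - t)"
  have 1: "(?r A \<longlongrightarrow> 0) (at t)" "(?r B \<longlongrightarrow> 0) (at t)"
    using A B ab by (auto simp: has_field_derivative_def has_derivative_at_within)
  have "(?r f \<longlongrightarrow> 0) (at t)"
  proof (rule Lim_null_comparison)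
    show "((\<lambda>s. norm (?r A s) + norm (?r B s)) \<longlongrightarrow> 0) (at t)"
      using tendsto_add[OF tendsto_norm[OF 1(1)] tendsto_norm[OF 1(2)]] by simp
    show "eventually (\<lambda>s. norm (?r f s) \<le> norm (?r A s) + norm (?r B s)) (at t)"
      using ev
    proof eventually_elim
      case (elim s)
      then have "\<bar>f s - f t - \<alpha> * (s - t)\<bar> \<le> \<bar>A s - A t - \<alpha> * (s - t)\<bar> + \<bar>B s - B t - \<alpha> * (s - t)\<bar>"
        using eq by linarith
      then show ?case
        by (simp add: abs_mult divide_inverse distrib_left[symmetric] mult_left_mono)
    qed
  qed
  then show "(f has_real_derivative \<alpha>) (at t)"
    by (simp add: has_field_derivative_def has_derivative_at_within bounded_linear_mult_right)
qed

lemma concave_supporting_line: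
  fixes f :: "real \<Rightarrow> real"
  assumes conc: "\<And>a b u. p < a \<Longrightarrow> a < q \<Longrightarrow> p < b \<Longrightarrow> b < q \<Longrightarrow> 0 < u \<Longrightarrow> u < 1 \<Longrightarrow>
      (1 - u) * f a + u * f b \<le> f ((1 - u) * a + u * b)"
    and t: "p < t" "t < q"
  obtains k where "\<And>s. p < s \<Longrightarrow> s < q \<Longrightarrow> f s \<le> f t + k * (s - t)"
proof -
  have "convex_on {p<..<q} (\<lambda>s. - f s)"
  proof (rule convex_onI)
    show "- f ((1 - u) *\<^sub>R a + u *\<^sub>R b) \<le> (1 - u) * - f a + u * - f b"
      if "0 < u" "u < 1" "a \<in> {p<..<q}" "b \<in> {p<..<q}" for u a b
      using conc[of a b u] that by simp
  qed (rule convex_real_interval)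
  from convex_le_Inf_differential[OF this, of t] t
  obtain m where "\<And>s. s \<in> {p<..<q} \<Longrightarrow> - f s \<ge> - f t + m * (s - t)"
    by (simp add: interior_open) blast
  then have "f s \<le> f t + (- m) * (s - t)" if "p < s" "s < q" for s using that by fastforce
  then show thesis by (rule that)
qed

text \<open>The cumulative distribution function of a marginal of an \<open>n\<close>-dimensional convex body: the
  inequality is the Brunn-Minkowski inequality for slabs.\<close>

definition needle :: "nat \<Rightarrow> real \<Rightarrow> real \<Rightarrow> (real \<Rightarrow> real) \<Rightarrow> bool" where
  "needle n p q V \<longleftrightarrow> p < q \<and> V p = 0 \<and> V q = 1 \<and> continuous_on {p..q} V \<and>
     (\<forall>a b. p \<le> a \<longrightarrow> a < b \<longrightarrow> b \<le> q \<longrightarrow> V a < V b) \<and>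
     (\<forall>a b c d u. p \<le> a \<longrightarrow> a < b \<longrightarrow> b \<le> q \<longrightarrow> p \<le> c \<longrightarrow> c < d \<longrightarrow> d \<le> q \<longrightarrow> 0 < u \<longrightarrow> u < 1 \<longrightarrow>
        (1 - u) * root n (V b - V a) + u * root n (V d - V c)
          \<le> root n (V ((1 - u) * b + u * d) - V ((1 - u) * a + u * c)))"

lemma needle_mono: "needle n p q V \<Longrightarrow> p \<le> a \<Longrightarrow> a < b \<Longrightarrow> b \<le> q \<Longrightarrow> V a < V b"
  by (auto simp: needle_def)

lemma needle_BM:
  "needle n p q V \<Longrightarrow> p \<le> a \<Longrightarrow> a < b \<Longrightarrow> b \<le> q \<Longrightarrow> p \<le> c \<Longrightarrow> c < d \<Longrightarrow> d \<le> q \<Longrightarrow> 0 < u \<Longrightarrow> u < 1 \<Longrightarrow>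
     (1 - u) * root n (V b - V a) + u * root n (V d - V c)
       \<le> root n (V ((1 - u) * b + u * d) - V ((1 - u) * a + u * c))"
  unfolding needle_def by blast

text \<open>Slabs with one end at \<open>p\<close> or at \<open>q\<close> make
  \<open>root n V\<close> and \<open>root n (1 - V)\<close> concave. The n-th powers of their
  supporting lines touch \<open>V\<close> at \<open>t\<close> from above and from below, so
  \<open>V\<close> is differentiable at every inner point, not just almost everywhere.\<close>

lemma needle_derivative:
  assumes N: "needle n p q V" and n: "0 < n" and t: "p < t" "t < q"
  obtains \<rho> \<alpha> \<beta> where "(V has_real_derivative \<rho>) (at t)" "0 < \<rho>"
    "\<And>s. p < s \<Longrightarrow> s < q \<Longrightarrow> root n (V s) \<le> root n (V t) + \<alpha> * (s - t)"
    "\<And>s. p < s \<Longrightarrow> s < q \<Longrightarrow> root n (1 - V s) \<le> root n (1 - V t) + \<beta> * (s - t)"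
    "\<rho> = real n * root n (V t) ^ (n - 1) * \<alpha>" "\<rho> = - (real n * root n (1 - V t) ^ (n - 1) * \<beta>)"
proof -
  have V: "p < q" "V p = 0" "V q = 1" using N by (auto simp: needle_def)
  have V01: "0 < V s" "V s < 1" if "p < s" "s < q" for s
    using needle_mono[OF N, of p s] needle_mono[OF N, of s q] that V by auto
  obtain \<alpha> where a: "\<And>s. p < s \<Longrightarrow> s < q \<Longrightarrow> root n (V s) \<le> root n (V t) + \<alpha> * (s - t)"
  proof (rule concave_supporting_line[of p q "\<lambda>s. root n (V s)", OF _ t])
    fix a b u :: real assume "p < a" "a < q" "p < b" "b < q" "0 < u" "u < 1"
    then have "(1 - u) * root n (V a - V p) + u * root n (V b - V p)
      \<le> root n (V ((1 - u) * a + u * b) - V ((1 - u) * p + u * p))" by (intro needle_BM[OF N]) auto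
    then show "(1 - u) * root n (V a) + u * root n (V b) \<le> root n (V ((1 - u) * a + u * b))"
      using V by (simp add: algebra_simps)
  qed blast
  obtain \<beta> where b: "\<And>s. p < s \<Longrightarrow> s < q \<Longrightarrow> root n (1 - V s) \<le> root n (1 - V t) + \<beta> * (s - t)"
  proof (rule concave_supporting_line[of p q "\<lambda>s. root n (1 - V s)", OF _ t])
    fix a b u :: real assume "p < a" "a < q" "p < b" "b < q" "0 < u" "u < 1"
    then have "(1 - u) * root n (V q - V a) + u * root n (V q - V b)
      \<le> root n (V ((1 - u) * q + u * q) - V ((1 - u) * a + u * b))" by (intro needle_BM[OF N]) auto
    then show "(1 - u) * root n (1 - V a) + u * root n (1 - V b) \<le> root n (1 - V ((1 - u) * a + u * b))"
      using V by (simp add: algebra_simps)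
  qed blast
  let ?x = "root n (V t)" and ?y = "root n (1 - V t)"
  have xy: "?x > 0" "?y > 0" using V01[OF t] n by auto
  define A B where "A = (\<lambda>s. (?x + \<alpha> * (s - t)) ^ n)" and "B = (\<lambda>s. 1 - (?y + \<beta> * (s - t)) ^ n)"
  have dA: "(A has_real_derivative real n * ?x ^ (n - 1) * \<alpha>) (at t)"
    unfolding A_def by (auto intro!: derivative_eq_intros)
  have dB: "(B has_real_derivative - (real n * ?y ^ (n - 1) * \<beta>)) (at t)"
    unfolding B_def by (auto intro!: derivative_eq_intros)
  have AB: "B s \<le> V s \<and> V s \<le> A s" if s: "p < s" "s < q" for s
  proof -
    have "root n (V s) ^ n \<le> A s" unfolding A_def using a[OF s] V01[OF s]
      by (intro power_mono) (auto simp: real_root_ge_zero less_imp_le)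
    moreover have "root n (1 - V s) ^ n \<le> 1 - B s" unfolding B_def using b[OF s] V01[OF s]
      by (auto intro!: power_mono simp: real_root_ge_zero less_imp_le)
    ultimately show ?thesis using V01[OF s] n by (auto simp: real_root_pow_pos2 less_imp_le)
  qed
  have ev: "eventually (\<lambda>s. B s \<le> V s \<and> V s \<le> A s) (at t)"
    unfolding eventually_at using AB t
    by (intro exI[of _ "min (t - p) (q - t)"]) (auto simp: dist_real_def)
  have eq: "A t = V t" "B t = V t" using V01[OF t] n by (auto simp: A_def B_def real_root_pow_pos2)
  note S = has_real_derivative_sandwich[OF dA dB ev eq]
  obtain s where s: "t < s" "s < q" using t dense by blast
  have "?x < root n (V s)" using needle_mono[OF N, of t s] s t n by auto
  then have "0 < \<alpha> * (s - t)" using a[of s] s t by auto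
  then have "0 < \<alpha>" using s by (simp add: zero_less_mult_iff)
  then have "0 < real n * ?x ^ (n - 1) * \<alpha>" using xy n by simp
  then show thesis using that[OF S(2) _ a b] S(1) by auto
qed

lemma secant_at_right:
  fixes V :: "real \<Rightarrow> real"
  assumes "(V has_real_derivative \<rho>) (at t)" "0 < c"
  shows "((\<lambda>h. (V (t + h * c) - V t) / h) \<longlongrightarrow> \<rho> * c) (at_right 0)"
proof -
  have "((\<lambda>h. V (t + h * c)) has_real_derivative \<rho> * c) (at 0)"
    using assms(1) by (auto intro!: derivative_eq_intros DERIV_chain2[of V])
  then have "((\<lambda>h. (V (t + h * c) - V t) / h) \<longlongrightarrow> \<rho> * c) (at 0)"
    by (simp add: has_field_derivative_iff)
  then show ?thesis by (rule filterlim_mono) (auto simp: at_le)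
qed

text \<open>The slabs compared have widths \<open>h * ga\<close> and \<open>h * gb\<close>,
  proportional to the (n-1)-th root of the density at their position. Since the n-th root of r times
  \<open>root (n - 1) r\<close> is again \<open>root (n - 1) r\<close>, the inequality for n-th
  roots becomes concavity of the (n-1)-th root of the density as \<open>h\<close> tends to 0. Equal
  widths would only give concavity of its n-th root.\<close>

lemma needle_density_concave:
  assumes N: "needle n p q V" and n: "2 \<le> n"
    and \<rho>: "\<And>t. p < t \<Longrightarrow> t < q \<Longrightarrow> (V has_real_derivative \<rho> t) (at t) \<and> 0 < \<rho> t"
    and ab: "p < a" "a < q" "p < b" "b < q" and u: "0 < u" "u < 1"
  shows "(1 - u) * root (n - 1) (\<rho> a) + u * root (n - 1) (\<rho> b) \<le> root (n - 1) (\<rho> ((1 - u) * a + u * b))"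
proof -
  define ga gb m where "ga = root (n - 1) (\<rho> a)" and "gb = root (n - 1) (\<rho> b)" and "m = (1 - u) * a + u * b"
  define c where "c = (1 - u) * ga + u * gb"
  have n1: "0 < n - 1" "0 < n" using n by auto
  have g: "0 < ga" "0 < gb" using \<rho> ab n1 by (auto simp: ga_def gb_def)
  have c: "0 < c" using g u by (auto simp: c_def intro!: add_pos_pos)
  have m: "p < m" "m < q"
    unfolding m_def using convex_bound_lt[of "-a" "-p" "-b" "1-u" u] convex_bound_lt[of a q b "1-u" u] ab u
    by (auto simp: algebra_simps)
  let ?D = "\<lambda>t w h. root n ((V (t + h * w) - V t) / h)"
  have lim: "(?D t w \<longlongrightarrow> root n (\<rho> t * w)) (at_right 0)" if "p < t" "t < q" "0 < w" for t w
    using secant_at_right \<rho> that by (intro tendsto_real_root) blast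
  have "(1 - u) * root n (\<rho> a * ga) + u * root n (\<rho> b * gb) \<le> root n (\<rho> m * c)"
  proof (rule tendsto_le)
    show "((\<lambda>h. (1 - u) * ?D a ga h + u * ?D b gb h) \<longlongrightarrow> (1 - u) * root n (\<rho> a * ga) + u * root n (\<rho> b * gb)) (at_right 0)"
      using ab g by (intro tendsto_add tendsto_mult_left lim) auto
    show "(?D m c \<longlongrightarrow> root n (\<rho> m * c)) (at_right 0)" using lim m c by auto
    have "(1 - u) * ?D a ga h + u * ?D b gb h \<le> ?D m c h"
      if h: "0 < h" "h < min ((q - a) / ga) ((q - b) / gb)" for h
    proof -
      have "h * ga < q - a" "h * gb < q - b" using h g by (auto simp: pos_less_divide_eq)
      then have "(1 - u) * root n (V (a + h * ga) - V a) + u * root n (V (b + h * gb) - V b)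
          \<le> root n (V ((1 - u) * (a + h * ga) + u * (b + h * gb)) - V ((1 - u) * a + u * b))"
        using h g ab u by (intro needle_BM[OF N]) auto
      moreover have "(1 - u) * (a + h * ga) + u * (b + h * gb) = m + h * c"
        by (simp add: m_def c_def algebra_simps)
      ultimately have "((1 - u) * root n (V (a + h * ga) - V a) + u * root n (V (b + h * gb) - V b)) / root n h
          \<le> root n (V (m + h * c) - V m) / root n h"
        using h n1 by (intro divide_right_mono) (auto simp: m_def real_root_ge_zero)
      then show ?thesis by (simp add: real_root_divide add_divide_distrib)
    qed
    then show "\<forall>\<^sub>F h in at_right 0. (1 - u) * ?D a ga h + u * ?D b gb h \<le> ?D m c h"
      unfolding eventually_at_right_field using g ab
      by (intro exI[of _ "min ((q - a) / ga) ((q - b) / gb)"]) auto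
  qed auto
  moreover have "root n (\<rho> a * ga) = ga" "root n (\<rho> b * gb) = gb"
  proof -
    have *: "root n (r * root (n - 1) r) = root (n - 1) r" if "0 < r" for r
    proof -
      have "r = root (n - 1) r ^ (n - 1)" using that n1 by simp
      then have "r * root (n - 1) r = root (n - 1) r ^ n" using n1 by (metis power_minus_mult)
      then show ?thesis using that n1 by (simp add: real_root_power_cancel less_imp_le)
    qed
    show "root n (\<rho> a * ga) = ga" "root n (\<rho> b * gb) = gb" unfolding ga_def gb_def using * \<rho> ab by auto
  qed
  ultimately have "c \<le> root n (\<rho> m * c)" by (simp add: c_def)
  then have "c ^ n \<le> root n (\<rho> m * c) ^ n" using c by (intro power_mono) auto
  also have "\<dots> = \<rho> m * c" using \<rho>[OF m] c n1 by (simp add: real_root_pow_pos2)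
  finally have "c ^ (n - 1) * c \<le> \<rho> m * c" by (simp only: power_minus_mult[OF n1(2)])
  then have "c ^ (n - 1) \<le> \<rho> m" using c by simp
  then have "root (n - 1) (c ^ (n - 1)) \<le> root (n - 1) (\<rho> m)" using n1 by simp
  moreover have "root (n - 1) (c ^ (n - 1)) = c" using c n1 by (intro real_root_power_cancel) auto
  ultimately show ?thesis by (simp add: c_def ga_def gb_def m_def)
qed

text \<open>For the measure on an interval whose density is the \<open>(n-1)\<close>-th power of an affine function
  running from \<open>A\<close> to \<open>B\<close>: interval length times normalised density at the quantile \<open>x\<close>.\<close>

definition cone_profile :: "nat \<Rightarrow> real \<Rightarrow> real \<Rightarrow> real \<Rightarrow> real" where
  "cone_profile n A B x =
     real n * root n ((1 - x) * A ^ n + x * B ^ n) ^ (n - 1) / (\<Sum>i<n. A ^ (n - Suc i) * B ^ i)"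

lemma power_diff_sum: "(B::real) ^ n - A ^ n = (B - A) * (\<Sum>i<n. A ^ (n - Suc i) * B ^ i)"
  by (simp add: power_diff_sumr2)

lemma cone_profile_const:
  assumes "0 < n" shows "cone_profile n 1 1 x = 1"
  using assms by (simp add: cone_profile_def)

text \<open>A supporting line of the (n-1)-th root of the density at \<open>t\<close> gives a
  truncated cone that dominates the density and agrees with it at \<open>t\<close>. To carry the
  same masses \<open>V t\<close> and \<open>1 - V t\<close> on the two sides of \<open>t\<close>,
  the cone needs no more length than \<open>q - p\<close>.\<close>

lemma needle_profile:
  assumes N: "needle n p q V" and n: "0 < n" and t: "p < t" "t < q"
  obtains \<rho> A B where "(V has_real_derivative \<rho>) (at t)" "0 \<le> A" "0 \<le> B" "0 < A \<or> 0 < B"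
    "cone_profile n A B (V t) \<le> (q - p) * \<rho>"
proof -
  note intro_thesis = that
  have V: "p < q" "V p = 0" "V q = 1" "continuous_on {p..q} V" using N by (auto simp: needle_def)
  define x where "x = V t"
  have x: "0 < x" "x < 1"
    using needle_mono[OF N, of p t] needle_mono[OF N, of t q] t V by (auto simp: x_def)
  have "\<exists>r. (V has_real_derivative r) (at s) \<and> 0 < r" if "p < s" "s < q" for s
    using needle_derivative[OF N n that] by metis
  then obtain \<rho> where \<rho>: "\<And>s. p < s \<Longrightarrow> s < q \<Longrightarrow> (V has_real_derivative \<rho> s) (at s) \<and> 0 < \<rho> s"
    by metis
  \<comment> \<open>Comparison of masses under two densities without integrals: the difference of
    the primitives is monotone.\<close>
  have cmp: "V b - V a \<le> W b - W a"
    if ab: "p \<le> a" "a < b" "b \<le> q" and W: "\<And>s. p \<le> s \<Longrightarrow> s \<le> q \<Longrightarrow> (W has_real_derivative w s) (at s)"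
      and le: "\<And>s. p < s \<Longrightarrow> s < q \<Longrightarrow> \<rho> s \<le> w s" for a b W w
  proof -
    have "V a - W a \<ge> V b - W b"
    proof (rule DERIV_nonpos_imp_decreasing_open[of a b "\<lambda>s. V s - W s"])
      fix s assume "a < s" "s < b"
      then have "p < s" "s < q" "p \<le> s" "s \<le> q" using ab by auto
      then show "\<exists>y. ((\<lambda>s. V s - W s) has_real_derivative y) (at s) \<and> y \<le> 0"
        using \<rho>[of s] W[of s] le[of s] by (intro exI[of _ "\<rho> s - w s"]) (auto intro!: DERIV_diff)
      next
      have "continuous_on {a..b} W"
        using W ab by (intro DERIV_atLeastAtMost_imp_continuous_on) (meson order_trans)
      then show "continuous_on {a..b} (\<lambda>s. V s - W s)"
        using V(4) ab by (intro continuous_intros) (auto intro: continuous_on_subset)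
    qed (use ab in auto)
    then show ?thesis by simp
  qed
  \<comment> \<open>A density that is largest at \<open>t\<close> is compared with a cylinder,
    \<open>A = B = 1\<close>. This covers n = 1 and slope 0, where the length cannot be expressed as
    a quotient by the slope.\<close>
  have flat: thesis if "\<And>s. p < s \<Longrightarrow> s < q \<Longrightarrow> \<rho> s \<le> \<rho> t"
  proof -
    have W: "((\<lambda>s. \<rho> t * s) has_real_derivative \<rho> t) (at s)" for s by (auto intro!: derivative_eq_intros)
    have "V t - V p \<le> \<rho> t * t - \<rho> t * p" "V q - V t \<le> \<rho> t * q - \<rho> t * t"
      using cmp[of p t "\<lambda>s. \<rho> t * s" "\<lambda>_. \<rho> t"] cmp[of t q "\<lambda>s. \<rho> t * s" "\<lambda>_. \<rho> t"] W that t by auto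
    then have "1 \<le> (q - p) * \<rho> t" using V by (simp add: algebra_simps)
    then show thesis using \<rho>[OF t] cone_profile_const[OF n] by (intro intro_thesis[of "\<rho> t" 1 1]) auto
  qed
  show thesis
  proof (cases "n = 1")
    case True
    show thesis
    proof (rule flat)
      fix s assume s: "p < s" "s < q"
      obtain r \<alpha> \<beta> where r0: "(V has_real_derivative r) (at t)"
        "\<And>s. p < s \<Longrightarrow> s < q \<Longrightarrow> root n (V s) \<le> root n (V t) + \<alpha> * (s - t)"
        "\<And>s. p < s \<Longrightarrow> s < q \<Longrightarrow> root n (1 - V s) \<le> root n (1 - V t) + \<beta> * (s - t)"
        "r = real n * root n (V t) ^ (n - 1) * \<alpha>" "r = - (real n * root n (1 - V t) ^ (n - 1) * \<beta>)"
        using needle_derivative[OF N n t] by metis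
      note r = r0[unfolded True, simplified]
      \<comment> \<open>For n = 1 the two supporting lines have opposite slopes and bound
        \<open>V\<close> from both sides, so \<open>V\<close> is affine.\<close>
      have "V s' = V t + r * (s' - t)" if "p < s'" "s' < q" for s'
        using r(2,3)[OF that] r(4,5) by (auto simp: algebra_simps)
      then have "((\<lambda>s'. V t + r * (s' - t)) has_real_derivative \<rho> s) (at s)"
        using \<rho>[OF s] s by (subst DERIV_cong_ev[OF refl _ refl, where g = V])
          (auto intro!: eventually_mono[OF eventually_nhds_in_open[of "{p<..<q}"]])
      moreover have "((\<lambda>s'. V t + r * (s' - t)) has_real_derivative r) (at s)"
        by (auto intro!: derivative_eq_intros)
      ultimately have "\<rho> s = r" by (rule DERIV_unique)
      moreover have "\<rho> t = r" using DERIV_unique[OF r(1)] \<rho>[OF t] by blast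
      ultimately show "\<rho> s \<le> \<rho> t" by simp
    qed
  next
    case False
    then have n2: "2 \<le> n" and n1: "0 < n - 1" using n by auto
    define c where "c = root (n - 1) (\<rho> t)"
    have c: "0 < c" "c ^ (n - 1) = \<rho> t" using \<rho>[OF t] n1 by (auto simp: c_def)
    obtain k where k: "\<And>s. p < s \<Longrightarrow> s < q \<Longrightarrow> root (n - 1) (\<rho> s) \<le> c + k * (s - t)"
    proof (rule concave_supporting_line[of p q "\<lambda>s. root (n - 1) (\<rho> s)" t])
      fix a b u :: real assume "p < a" "a < q" "p < b" "b < q" "0 < u" "u < 1"
      then show "(1 - u) * root (n - 1) (\<rho> a) + u * root (n - 1) (\<rho> b) \<le> root (n - 1) (\<rho> ((1 - u) * a + u * b))"
        using needle_density_concave[OF N n2 \<rho>] by blast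
    qed (use t in \<open>auto simp: c_def\<close>)
    define L where "L = (\<lambda>s. c + k * (s - t))"
    have Lpos: "0 < L s" if "p < s" "s < q" for s
      using k[OF that] \<rho>[OF that] n1 real_root_gt_zero[of "n - 1" "\<rho> s"] unfolding L_def by linarith
    have \<rho>L: "\<rho> s \<le> L s ^ (n - 1)" if "p < s" "s < q" for s
    proof -
      have "root (n - 1) (\<rho> s) ^ (n - 1) \<le> L s ^ (n - 1)"
        using k[OF that] \<rho>[OF that] n1 by (intro power_mono) (auto simp: L_def)
      then show ?thesis using \<rho>[OF that] n1 by simp
    qed
    have Lcont: "continuous_on {p..q} L" unfolding L_def by (intro continuous_intros)
    have L0: "0 \<le> L p" "0 \<le> L q"
    proof -
      have "{p..q} = closure {p<..<q}" using V by simp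
      then have "0 \<le> L s" if "s \<in> {p..q}" for s
        using continuous_ge_on_closure[of "{p<..<q}" L s 0] Lcont Lpos that by (force simp: less_imp_le)
      then show "0 \<le> L p" "0 \<le> L q" using V by auto
    qed
    show thesis
    proof (cases "k = 0")
      case True
      then show thesis using flat \<rho>L c by (simp add: L_def)
    next
      case k0: False
      have W: "((\<lambda>s. L s ^ n / (n * k)) has_real_derivative L s ^ (n - 1)) (at s)" for s
        unfolding L_def using n k0 by (auto intro!: derivative_eq_intros)
      have Lt: "L t = c" by (simp add: L_def)
      have x1: "x \<le> (c ^ n - L p ^ n) / (n * k)" "1 - x \<le> (L q ^ n - c ^ n) / (n * k)"
        using cmp[of p t, OF _ _ _ W \<rho>L] cmp[of t q, OF _ _ _ W \<rho>L] t V
        by (auto simp: x_def Lt diff_divide_distrib)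
      \<comment> \<open>The end values of the supporting line once it is trimmed or prolonged so as
        to carry mass exactly \<open>x\<close> left of \<open>t\<close> and \<open>1 - x\<close>
        right of it: along the line, \<open>L ^ n\<close> changes by \<open>n * k\<close> times the
        mass. The trimmed length is \<open>(B - A) / k\<close>.\<close>
      define A B where "A = root n (c ^ n - n * k * x)" and "B = root n (c ^ n + n * k * (1 - x))"
      have cn: "0 < c ^ n" using c by simp
      have pos: "0 \<le> c ^ n - n * k * x \<and> 0 \<le> c ^ n + n * k * (1 - x)" and BA: "(B - A) / k \<le> q - p"
      proof -
        have "0 \<le> c ^ n - n * k * x \<and> 0 \<le> c ^ n + n * k * (1 - x) \<and> (B - A) / k \<le> q - p"
        proof (cases "0 < k")
          case True
          then have nk: "0 < n * k" using n by simp
          have 1: "L p ^ n \<le> c ^ n - n * k * x" "c ^ n + n * k * (1 - x) \<le> L q ^ n"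
            using x1[unfolded pos_le_divide_eq[OF nk]] by (auto simp: algebra_simps)
          have "root n (L p ^ n) \<le> A" "B \<le> root n (L q ^ n)" unfolding A_def B_def using 1 n by auto
          then have "B - A \<le> L q - L p" using L0 n by (simp add: real_root_power_cancel)
          also have "\<dots> = k * (q - p)" by (simp add: L_def algebra_simps)
          moreover have "0 \<le> L p ^ n" using L0 by simp
          moreover have "0 \<le> n * k * (1 - x)" using nk x by simp
          ultimately show ?thesis using True 1 cn by (auto simp: pos_divide_le_eq mult.commute)
        next
          case False
          then have kn: "k < 0" using k0 by simp
          then have nk: "n * k < 0" using n by (simp add: mult_pos_neg)
          have 1: "c ^ n - n * k * x \<le> L p ^ n" "L q ^ n \<le> c ^ n + n * k * (1 - x)"
            using x1[unfolded neg_le_divide_eq[OF nk]] by (auto simp: algebra_simps)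
          have "A \<le> root n (L p ^ n)" "root n (L q ^ n) \<le> B" unfolding A_def B_def using 1 n by auto
          then have "L q - L p \<le> B - A" using L0 n by (simp add: real_root_power_cancel)
          moreover have "L q - L p = k * (q - p)" by (simp add: L_def algebra_simps)
          moreover have "0 \<le> L q ^ n" using L0 by simp
          moreover have "n * k * x \<le> 0" using nk x by (simp add: mult_nonpos_nonneg)
          ultimately show ?thesis using kn 1 cn by (auto simp: neg_divide_le_eq mult.commute)
        qed
        then show "0 \<le> c ^ n - n * k * x \<and> 0 \<le> c ^ n + n * k * (1 - x)" "(B - A) / k \<le> q - p" by auto
      qed
      have AB: "0 \<le> A" "0 \<le> B" "A ^ n = c ^ n - n * k * x" "B ^ n = c ^ n + n * k * (1 - x)"
        using pos n by (auto simp: A_def B_def real_root_pow_pos2)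
      have BAn: "B ^ n - A ^ n = n * k" using AB by (simp add: algebra_simps)
      have "A \<noteq> B" using BAn n k0 by auto
      let ?S = "\<Sum>i<n. A ^ (n - Suc i) * B ^ i"
      have S: "(B - A) * ?S = n * k" using BAn power_diff_sum[of B n A] by simp
      then have S0: "?S \<noteq> 0" using n k0 by auto
      have "(1 - x) * A ^ n + x * B ^ n = c ^ n" unfolding AB by (simp add: algebra_simps)
      then have "cone_profile n A B x = n * \<rho> t / ?S"
        using c n by (simp add: cone_profile_def real_root_power_cancel)
      also have "\<dots> = (n / ?S) * \<rho> t" by simp
      also have "\<dots> = (B - A) / k * \<rho> t"
      proof -
        have "n / ?S = (B - A) / k" unfolding frac_eq_eq[OF S0 k0] using S by (simp add: mult.commute)
        then show ?thesis by simp
      qed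
      also have "\<dots> \<le> (q - p) * \<rho> t" using BA \<rho>[OF t] by (intro mult_right_mono) auto
      finally show thesis
        using AB \<open>A \<noteq> B\<close> \<rho>[OF t] by (intro intro_thesis[of "\<rho> t" A B]) (auto simp: x_def)
    qed
  qed
qed

section \<open>Separated sets on the line\<close>

text \<open>Sweeping from left to right across the gaps between \<open>F\<close> and \<open>T\<close>, \<open>\<sigma>\<close> is the mass to the left
  of \<open>s\<close> of a union of intervals that contains all of one set and misses the other; each gap adds one
  boundary point \<open>\<xi>\<close> and replaces \<open>\<sigma>\<close> by \<open>V \<xi> - \<sigma>\<close>.\<close>

lemma gap_sweep:
  fixes M :: "real measure" and I V :: "real \<Rightarrow> real"
  assumes M: "finite_measure M" "sets M = sets borel"
    and V: "\<And>a b. p \<le> a \<Longrightarrow> a \<le> b \<Longrightarrow> b \<le> q \<Longrightarrow> measure M {a..b} = V b - V a"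
      "\<And>t. p \<le> t \<Longrightarrow> t \<le> q \<Longrightarrow> measure M {..t} = V t" "\<And>t. V t \<le> 1"
    and cont: "continuous_on {p..q} V"
    and der: "\<And>t. p < t \<Longrightarrow> t < q \<Longrightarrow> \<exists>\<rho>. (V has_real_derivative \<rho>) (at t) \<and> I (V t) \<le> l * \<rho>"
    and l: "0 < l" and h: "0 < h"
    and I: "I 0 = 0" "\<And>x y. 0 \<le> y \<Longrightarrow> y \<le> x \<Longrightarrow> x \<le> 1 \<Longrightarrow> I (x - y) \<le> I x + I y"
      "\<And>x. 0 \<le> x \<Longrightarrow> x \<le> 1 \<Longrightarrow> 0 \<le> I x"
    and FT: "compact F" "compact T" "F \<subseteq> {p..q}" "T \<subseteq> {p..q}"
      "\<And>a b. a \<in> F \<Longrightarrow> b \<in> T \<Longrightarrow> h \<le> \<bar>a - b\<bar>"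
    and s: "s \<in> F" "s \<le> p + real k * h"
  shows "\<exists>\<sigma>. measure M (T \<inter> {..s}) \<le> \<sigma> \<and> \<sigma> \<le> V s - measure M (F \<inter> {..s}) \<and>
           h * I \<sigma> \<le> l * (V s - measure M (F \<inter> {..s}) - measure M (T \<inter> {..s}))"
  using FT s
proof (induction k arbitrary: F T s)
  case (0 F T s)
  then have sp: "s = p" by force
  then have "T \<inter> {..s} \<subseteq> {s}" using 0 by force
  moreover have "s \<notin> T" using 0(5)[of s s] 0(6) h by auto
  ultimately have T0: "T \<inter> {..s} = {}" by auto
  interpret finite_measure M by (rule M)
  have "measure M (F \<inter> {..s}) \<le> measure M {..s}"
    by (intro finite_measure_mono) (auto simp: M)
  then have "measure M (F \<inter> {..s}) \<le> V s" using V(2)[of s] 0 by force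
  then show ?case using T0 I(1) l by (intro exI[of _ 0]) auto
next
  case (Suc k F T s)
  interpret finite_measure M by (rule M)
  have mF: "F \<inter> A \<in> sets M" "T \<inter> A \<in> sets M" if "A \<in> sets borel" for A
    using Suc.prems(1,2) that by (auto simp: M(2) borel_compact)
  have spq: "p \<le> s" "s \<le> q" using Suc.prems by auto
  have dis: "F \<inter> T = {}" using Suc.prems(5) h by force
  have FT_le: "measure M (F \<inter> {..t}) + measure M (T \<inter> {..t}) \<le> V t" if "p \<le> t" "t \<le> q" for t
  proof -
    have "measure M (F \<inter> {..t}) + measure M (T \<inter> {..t}) = measure M ((F \<inter> {..t}) \<union> (T \<inter> {..t}))"
      using dis by (intro finite_measure_Union[symmetric] mF) auto
    also have "\<dots> \<le> measure M {..t}" by (intro finite_measure_mono) (auto simp: M)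
    finally show ?thesis using V(2) that by simp
  qed
  show ?case
  proof (cases "T \<inter> {..s} = {}")
    case True
    then show ?thesis using FT_le[OF spq] I(1) l by (intro exI[of _ 0]) auto
  next
    case False
    have cT: "compact (T \<inter> {..s})" using Suc.prems(2) by (intro compact_Int_closed) auto
    obtain t where t: "t \<in> T" "t \<le> s" "\<And>x. x \<in> T \<Longrightarrow> x \<le> s \<Longrightarrow> x \<le> t"
      using compact_attains_sup[OF cT False] by auto
    have ts: "h \<le> s - t" using Suc.prems(5)[OF Suc.prems(6) t(1)] t(2) by auto
    have tpq: "p \<le> t" "t \<le> q" using t(1) Suc.prems(4) by auto
    have cF: "compact (F \<inter> {t..})" using Suc.prems(1) by (intro compact_Int_closed) auto
    have "F \<inter> {t..} \<noteq> {}" using Suc.prems(6) t(2) by auto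
    from compact_attains_inf[OF cF this] obtain r where r: "r \<in> F" "t \<le> r" "\<And>x. x \<in> F \<Longrightarrow> t \<le> x \<Longrightarrow> r \<le> x"
      by auto
    \<comment> \<open>\<open>t\<close> is the last point of \<open>T\<close> up to \<open>s\<close>
      and \<open>r\<close> the first point of \<open>F\<close> from \<open>t\<close> on, so the open
      interval between them misses both sets and has length at least \<open>h\<close>.\<close>
    have tr: "h \<le> r - t" using Suc.prems(5)[OF r(1) t(1)] r(2) by auto
    have rs: "r \<le> s" using r(3)[OF Suc.prems(6)] t(2) by simp
    \<comment> \<open>Stepping from \<open>s\<close> to \<open>t\<close> moves left by at least
      \<open>h\<close>, which pays for one unit of \<open>k\<close>; the induction hypothesis is
      used with \<open>F\<close> and \<open>T\<close> exchanged.\<close>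
    have "t \<le> p + real k * h" using ts Suc.prems(7) by (simp add: algebra_simps)
    moreover have "\<And>a b. a \<in> T \<Longrightarrow> b \<in> F \<Longrightarrow> h \<le> \<bar>a - b\<bar>"
      using Suc.prems(5) by (metis abs_minus_commute)
    ultimately obtain \<sigma> where \<sigma>: "measure M (F \<inter> {..t}) \<le> \<sigma>" "\<sigma> \<le> V t - measure M (T \<inter> {..t})"
        "h * I \<sigma> \<le> l * (V t - measure M (T \<inter> {..t}) - measure M (F \<inter> {..t}))"
      using Suc.IH[OF Suc.prems(2,1,4,3) _ t(1)] by blast
    \<comment> \<open>At the mean value point the density equals the average over the gap, so the
      mass of the gap is at least \<open>h\<close> times the density at \<xi>, where
      \<open>I\<close> gives a lower bound.\<close>
    have "\<exists>\<xi>>t. \<xi> < r \<and> (\<exists>d. (V has_real_derivative d) (at \<xi>) \<and> V r - V t = (r - t) * d)"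
    proof -
      have "continuous_on {t..r} V" using tpq rs spq by (intro continuous_on_subset[OF cont]) auto
      moreover have "V differentiable (at x)" if "t < x" "x < r" for x
        using der[of x] that tpq rs spq by (auto simp: real_differentiable_def)
      ultimately show ?thesis using MVT[of t r V] tr h by (metis diff_gt_0_iff_gt less_le_trans)
    qed
    then obtain \<xi> d where \<xi>: "t < \<xi>" "\<xi> < r" "(V has_real_derivative d) (at \<xi>)" "V r - V t = (r - t) * d" by blast
    have \<xi>pq: "p < \<xi>" "\<xi> < q" using \<xi> tpq rs spq by auto
    obtain \<rho> where \<rho>: "(V has_real_derivative \<rho>) (at \<xi>)" "I (V \<xi>) \<le> l * \<rho>" using der[OF \<xi>pq] by blast
    have d: "I (V \<xi>) \<le> l * d" using \<rho> DERIV_unique[OF \<xi>(3) \<rho>(1)] by simp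
    have V\<xi>: "V t \<le> V \<xi>" "V \<xi> \<le> V r"
      using V(1)[of t \<xi>] V(1)[of \<xi> r] \<xi> \<xi>pq tpq rs spq measure_nonneg[of M "{t..\<xi>}"] measure_nonneg[of M "{\<xi>..r}"] by auto
    have s0: "0 \<le> \<sigma>" using \<sigma>(1) measure_nonneg[of M] order_trans by blast
    have s1: "\<sigma> \<le> V t" using \<sigma>(2) measure_nonneg[of M "T \<inter> {..t}"] by linarith
    have "0 \<le> I (V \<xi>)" using s0 s1 V\<xi> V(3) by (intro I(3)) auto
    then have "0 \<le> l * d" using d by linarith
    have gap: "h * I (V \<xi>) \<le> l * (V r - V t)"
    proof -
      have "h * I (V \<xi>) \<le> h * (l * d)" using d h by (intro mult_left_mono) auto
      also have "\<dots> \<le> (r - t) * (l * d)" using tr \<open>0 \<le> l * d\<close> by (intro mult_right_mono)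
      finally show ?thesis using \<xi>(4) by (simp add: mult.left_commute)
    qed
    have Ts: "T \<inter> {..s} = T \<inter> {..t}" using t by force
    have "F \<inter> {..s} \<subseteq> (F \<inter> {..t}) \<union> {r..s}" using r(3) by force
    then have "measure M (F \<inter> {..s}) \<le> measure M ((F \<inter> {..t}) \<union> {r..s})"
      using mF by (intro finite_measure_mono) (auto simp: M)
    also have "\<dots> \<le> measure M (F \<inter> {..t}) + measure M {r..s}"
      using mF by (intro measure_Un_le) (auto simp: M)
    also have "measure M {r..s} = V s - V r" using rs spq tr tpq h by (intro V(1)) auto
    finally have Fs: "measure M (F \<inter> {..s}) \<le> measure M (F \<inter> {..t}) + (V s - V r)" .
    show ?thesis
    proof (intro exI[of _ "V \<xi> - \<sigma>"] conjI)
      show "measure M (T \<inter> {..s}) \<le> V \<xi> - \<sigma>" unfolding Ts using \<sigma>(2) V\<xi> by linarith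
      show "V \<xi> - \<sigma> \<le> V s - measure M (F \<inter> {..s})" using Fs \<sigma>(1) V\<xi> by linarith
      have "I (V \<xi> - \<sigma>) \<le> I (V \<xi>) + I \<sigma>" using s0 s1 V\<xi> V(3)[of \<xi>] by (intro I(2)) auto
      then have "h * I (V \<xi> - \<sigma>) \<le> h * I (V \<xi>) + h * I \<sigma>"
        using h by (simp add: distrib_left[symmetric])
      also have "\<dots> \<le> l * (V r - V t) + l * (V t - measure M (T \<inter> {..t}) - measure M (F \<inter> {..t}))"
        using gap \<sigma>(3) by linarith
      also have "\<dots> = l * (V r - measure M (T \<inter> {..t}) - measure M (F \<inter> {..t}))" by (simp add: algebra_simps)
      also have "\<dots> \<le> l * (V s - measure M (F \<inter> {..s}) - measure M (T \<inter> {..s}))"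
        using Fs Ts l by (intro mult_left_mono) auto
      finally show "h * I (V \<xi> - \<sigma>) \<le> l * (V s - measure M (F \<inter> {..s}) - measure M (T \<inter> {..s}))" .
    qed
  qed
qed

text \<open>The sweep is run up to the rightmost point of the two sets. If this point lies in
  \<open>T\<close>, the roles are exchanged and \<sigma> is replaced by \<open>1 - \<sigma>\<close>,
  which the symmetry of \<open>I\<close> permits. Only an interval for \<sigma> is known, since
  \<sigma> measures a union of intervals that separates \<open>T\<close> from
  \<open>F\<close>.\<close>

lemma gap_isoperimetry:
  fixes M :: "real measure" and I V :: "real \<Rightarrow> real"
  assumes M: "finite_measure M" "sets M = sets borel"
    and V: "\<And>a b. p \<le> a \<Longrightarrow> a \<le> b \<Longrightarrow> b \<le> q \<Longrightarrow> measure M {a..b} = V b - V a"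
      "\<And>t. p \<le> t \<Longrightarrow> t \<le> q \<Longrightarrow> measure M {..t} = V t" "\<And>t. V t \<le> 1"
    and cont: "continuous_on {p..q} V"
    and der: "\<And>t. p < t \<Longrightarrow> t < q \<Longrightarrow> \<exists>\<rho>. (V has_real_derivative \<rho>) (at t) \<and> I (V t) \<le> l * \<rho>"
    and l: "0 < l" and h: "0 < h"
    and I: "I 0 = 0" "\<And>x y. 0 \<le> y \<Longrightarrow> y \<le> x \<Longrightarrow> x \<le> 1 \<Longrightarrow> I (x - y) \<le> I x + I y"
      "\<And>x. 0 \<le> x \<Longrightarrow> x \<le> 1 \<Longrightarrow> 0 \<le> I x" "\<And>x. I (1 - x) = I x"
    and FT: "compact F" "compact T" "F \<subseteq> {p..q}" "T \<subseteq> {p..q}"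
      "\<And>a b. a \<in> F \<Longrightarrow> b \<in> T \<Longrightarrow> h \<le> \<bar>a - b\<bar>"
  shows "\<exists>\<sigma>. measure M T \<le> \<sigma> \<and> \<sigma> \<le> 1 - measure M F \<and> h * I \<sigma> \<le> l * (1 - measure M F - measure M T)"
proof -
  have sweep: "\<exists>\<sigma>. measure M T \<le> \<sigma> \<and> \<sigma> \<le> 1 - measure M F \<and> h * I \<sigma> \<le> l * (1 - measure M F - measure M T)"
    if FT: "compact F" "compact T" "F \<subseteq> {p..q}" "T \<subseteq> {p..q}" "\<And>a b. a \<in> F \<Longrightarrow> b \<in> T \<Longrightarrow> h \<le> \<bar>a - b\<bar>"
      and s: "s \<in> F" "\<And>x. x \<in> F \<union> T \<Longrightarrow> x \<le> s" for F T s
  proof -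
    obtain k :: nat where "(s - p) / h \<le> real k" using real_arch_simple by blast
    then have "s \<le> p + real k * h" using h by (simp add: pos_divide_le_eq)
    then have "\<exists>\<sigma>. measure M (T \<inter> {..s}) \<le> \<sigma> \<and> \<sigma> \<le> V s - measure M (F \<inter> {..s}) \<and>
           h * I \<sigma> \<le> l * (V s - measure M (F \<inter> {..s}) - measure M (T \<inter> {..s}))"
      by (rule gap_sweep[where p = p and q = q and I = I and V = V and l = l and h = h and k = k, rotated -1])
        (fact M V cont der l h I FT s)+
    moreover have "F \<inter> {..s} = F" "T \<inter> {..s} = T" using s by auto
    ultimately obtain \<sigma> where \<sigma>: "measure M T \<le> \<sigma>" "\<sigma> \<le> V s - measure M F" "h * I \<sigma> \<le> l * (V s - measure M F - measure M T)"
      by auto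
    have "l * (V s - measure M F - measure M T) \<le> l * (1 - measure M F - measure M T)"
      using V(3)[of s] l by (intro mult_left_mono) auto
    then show ?thesis using \<sigma> V(3)[of s] by (intro exI[of _ \<sigma>]) auto
  qed
  show ?thesis
  proof (cases "F \<union> T = {}")
    case True
    then show ?thesis using I(1) l by (intro exI[of _ 0]) auto
  next
    case False
    have "compact (F \<union> T)" using FT by auto
    from compact_attains_sup[OF this False] obtain s where s: "s \<in> F \<union> T" "\<And>x. x \<in> F \<union> T \<Longrightarrow> x \<le> s" by auto
    show ?thesis
    proof (cases "s \<in> F")
      case True
      then show ?thesis using sweep[OF FT] s by blast
    next
      case False
      have "\<And>a b. a \<in> T \<Longrightarrow> b \<in> F \<Longrightarrow> h \<le> \<bar>a - b\<bar>" using FT(5) by (metis abs_minus_commute)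
      then obtain \<sigma> where "measure M F \<le> \<sigma>" "\<sigma> \<le> 1 - measure M T" "h * I \<sigma> \<le> l * (1 - measure M T - measure M F)"
        using sweep[OF FT(2,1,4,3), of s] s False by blast
      then show ?thesis using I(4)[of \<sigma>] by (intro exI[of _ "1 - \<sigma>"]) (auto simp: algebra_simps)
    qed
  qed
qed

section \<open>The isoperimetric profile\<close>

lemma cone_profile_nonneg:
  assumes "0 \<le> A" "0 \<le> B" "0 \<le> x" "x \<le> 1"
  shows "0 \<le> cone_profile n A B x"
  using assms by (auto simp: cone_profile_def intro!: divide_nonneg_nonneg sum_nonneg mult_nonneg_nonneg
      zero_le_power real_root_ge_zero add_nonneg_nonneg)

lemma cone_profile_sym: "cone_profile n A B x = cone_profile n B A (1 - x)"
proof -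
  have "(\<Sum>i<n. A ^ (n - Suc i) * B ^ i) = (\<Sum>i<n. B ^ (n - Suc i) * A ^ i)"
    by (subst sum.nat_diff_reindex[symmetric], rule sum.cong) (auto simp: mult.commute)
  then show ?thesis by (simp add: cone_profile_def add.commute)
qed

lemma cone_profile_scale:
  assumes "0 < A" "0 < n"
  shows "cone_profile n A B x = cone_profile n 1 (B / A) x"
proof -
  have "(\<Sum>i<n. A ^ (n - Suc i) * B ^ i) = A ^ (n - 1) * (\<Sum>i<n. (B / A) ^ i)"
    unfolding sum_distrib_left
  proof (rule sum.cong)
    fix i assume "i \<in> {..<n}"
    then have "A ^ (n - 1) = A ^ (n - Suc i) * A ^ i" by (simp add: power_add[symmetric])
    then show "A ^ (n - Suc i) * B ^ i = A ^ (n - 1) * (B / A) ^ i" using assms by (simp add: power_divide)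
  qed simp
  moreover have "(1 - x) * A ^ n + x * B ^ n = A ^ n * ((1 - x) + x * (B / A) ^ n)"
    using assms by (simp add: power_divide algebra_simps)
  moreover have "root n (A ^ n * ((1 - x) + x * (B / A) ^ n)) ^ (n - 1) = A ^ (n - 1) * root n ((1 - x) + x * (B / A) ^ n) ^ (n - 1)"
    using assms by (simp add: real_root_mult real_root_power_cancel power_mult_distrib)
  ultimately show ?thesis using assms by (simp add: cone_profile_def)
qed

text \<open>In other words, \<open>cone_profile n A B x / x\<close> is nonincreasing in
  \<open>x\<close>: the quantity under the root is affine and nonnegative, and \<theta> raised to
  (n-1)/n is at least \<theta>. The property survives the infimum and yields both subadditivity and
  semicontinuity.\<close>

lemma cone_profile_star:
  assumes n: "0 < n" and AB: "0 \<le> A" "0 \<le> B" and \<theta>: "0 \<le> \<theta>" "\<theta> \<le> 1" and s: "0 \<le> s" "s \<le> 1"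
  shows "\<theta> * cone_profile n A B s \<le> cone_profile n A B (\<theta> * s)"
proof -
  let ?z = "\<lambda>x. (1 - x) * A ^ n + x * B ^ n"
  have z0: "0 \<le> ?z s" using AB s by (intro add_nonneg_nonneg mult_nonneg_nonneg) auto
  have "?z (\<theta> * s) = (1 - \<theta>) * A ^ n + \<theta> * ?z s" by (simp add: algebra_simps)
  then have z: "\<theta> * ?z s \<le> ?z (\<theta> * s)" using AB \<theta> by simp
  have "\<theta> = root n \<theta> ^ n" using \<theta> n by (simp add: real_root_pow_pos2)
  also have "\<dots> \<le> root n \<theta> ^ (n - 1)" using \<theta> n by (intro power_decreasing) (auto simp: real_root_ge_zero)
  finally have "\<theta> * root n (?z s) ^ (n - 1) \<le> root n \<theta> ^ (n - 1) * root n (?z s) ^ (n - 1)"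
    using z0 by (intro mult_right_mono) (auto simp: real_root_ge_zero)
  also have "\<dots> = root n (\<theta> * ?z s) ^ (n - 1)" by (simp add: real_root_mult power_mult_distrib)
  also have "\<dots> \<le> root n (?z (\<theta> * s)) ^ (n - 1)"
    using z z0 \<theta> n by (intro power_mono) (auto simp: real_root_ge_zero)
  finally have "real n * (\<theta> * root n (?z s) ^ (n - 1)) / (\<Sum>i<n. A ^ (n - Suc i) * B ^ i)
      \<le> real n * root n (?z (\<theta> * s)) ^ (n - 1) / (\<Sum>i<n. A ^ (n - Suc i) * B ^ i)"
    using AB by (intro divide_right_mono mult_left_mono sum_nonneg) auto
  then show ?thesis by (simp add: cone_profile_def mult_ac)
qed

text \<open>The value \<open>0\<close> at both ends keeps the function subadditive for \<open>n = 1\<close>, where it is \<open>1\<close> in between.\<close>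

definition iso_profile :: "nat \<Rightarrow> real \<Rightarrow> real" where
  "iso_profile n x = (if 0 < x \<and> x < 1 then INF (A, B)\<in>{0<..} \<times> {0<..}. cone_profile n A B x else 0)"

lemma iso_profile_lower:
  assumes "0 < x" "x < 1" "0 < A" "0 < B"
  shows "iso_profile n x \<le> cone_profile n A B x"
proof -
  have "bdd_below ((\<lambda>(A, B). cone_profile n A B x) ` ({0<..} \<times> {0<..}))"
    using assms by (intro bdd_belowI[of _ 0]) (auto intro!: cone_profile_nonneg)
  then show ?thesis using assms cINF_lower[of "\<lambda>(A, B). cone_profile n A B x" "{0<..} \<times> {0<..}" "(A, B)"]
    by (simp add: iso_profile_def)
qed

lemma iso_profile_greatest:
  assumes "0 < x" "x < 1" "\<And>A B. 0 < A \<Longrightarrow> 0 < B \<Longrightarrow> c \<le> cone_profile n A B x"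
  shows "c \<le> iso_profile n x"
proof -
  have "{0<..} \<times> {0<..} \<noteq> ({} :: (real \<times> real) set)" using zero_less_one by auto
  then show ?thesis using assms by (auto simp: iso_profile_def intro!: cINF_greatest)
qed

lemma iso_profile_nonneg: "0 \<le> iso_profile n x"
proof (cases "0 < x \<and> x < 1")
  case True
  then show ?thesis by (intro iso_profile_greatest cone_profile_nonneg) auto
qed (auto simp: iso_profile_def)

lemma iso_profile_sym: "iso_profile n (1 - x) = iso_profile n x"
proof -
  have *: "iso_profile n y \<le> iso_profile n (1 - y)" if "0 < y" "y < 1" for y
  proof (rule iso_profile_greatest)
    fix A B :: real assume "0 < A" "0 < B"
    then show "iso_profile n y \<le> cone_profile n A B (1 - y)"
      using iso_profile_lower[of y B A n] that cone_profile_sym[of n B A y] by simp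
  qed (use that in auto)
  show ?thesis
  proof (cases "0 < x \<and> x < 1")
    case True
    then show ?thesis using *[of x] *[of "1 - x"] by simp
  qed (auto simp: iso_profile_def)
qed

text \<open>The infimum runs over truncated cones with two positive ends; a full cone, with apex at
  one end, is reached as a limit. Such cones do occur as comparison cones of needles.\<close>

lemma iso_profile_le_cone_profile:
  assumes x: "0 < x" "x < 1" and n: "0 < n" and AB: "0 \<le> A" "0 \<le> B" "0 < A \<or> 0 < B"
  shows "iso_profile n x \<le> cone_profile n A B x"
proof -
  have zero: "iso_profile n x \<le> cone_profile n 0 B x" if "0 < x" "x < 1" "0 < B" for B x
  proof (rule tendsto_lowerbound)
    have "(\<Sum>i<n. 0 ^ (n - Suc i) * B ^ i) = (\<Sum>i<n. if i = n - 1 then B ^ i else 0)"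
      using n by (intro sum.cong) (auto simp: power_0_left)
    also have "\<dots> = B ^ (n - 1)" using n by simp
    finally have S: "(\<Sum>i<n. 0 ^ (n - Suc i) * B ^ i) \<noteq> 0" using that by simp
    show "((\<lambda>a. cone_profile n a B x) \<longlongrightarrow> cone_profile n 0 B x) (at_right 0)"
      unfolding cone_profile_def by (intro tendsto_intros S)
    show "\<forall>\<^sub>F a in at_right 0. iso_profile n x \<le> cone_profile n a B x"
      using that by (auto simp: eventually_at_right_field intro!: iso_profile_lower exI[of _ 1])
  qed simp
  consider "0 < A" "0 < B" | "A = 0" "0 < B" | "0 < A" "B = 0" using AB by linarith
  then show ?thesis
  proof cases
    case 1 then show ?thesis using iso_profile_lower x by blast
  next
    case 2 then show ?thesis using zero x by blast
  next
    case 3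
    then show ?thesis using zero[of "1 - x" A] x cone_profile_sym[of n A 0 x] iso_profile_sym[of n x] by simp
  qed
qed

lemma iso_profile_star:
  assumes n: "0 < n" and as: "0 < a" "a \<le> s" "s < 1"
  shows "a / s * iso_profile n s \<le> iso_profile n a"
proof (rule iso_profile_greatest)
  fix A B :: real assume AB: "0 < A" "0 < B"
  have "a / s * iso_profile n s \<le> a / s * cone_profile n A B s"
    using as AB by (intro mult_left_mono iso_profile_lower) auto
  also have "\<dots> \<le> cone_profile n A B (a / s * s)"
    using as AB n by (intro cone_profile_star) auto
  finally show "a / s * iso_profile n s \<le> cone_profile n A B a" using as by simp
qed (use as in auto)

text \<open>By symmetry \<open>x - y\<close> may be replaced by \<open>(1 - x) + y\<close>. A
  function with \<open>I s / s\<close> nonincreasing is subadditive on the summands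
  \<open>1 - x\<close> and \<open>y\<close>.\<close>

lemma iso_profile_subadditive:
  assumes n: "0 < n" and xy: "0 \<le> y" "y \<le> x" "x \<le> 1"
  shows "iso_profile n (x - y) \<le> iso_profile n x + iso_profile n y"
proof (cases "y = 0 \<or> x = 1 \<or> x = y")
  case True
  then show ?thesis
    using iso_profile_nonneg[of n] iso_profile_sym[of n y] by (auto simp: iso_profile_def[of n 0] iso_profile_def[of n 1])
next
  case False
  define s where "s = (1 - x) + y"
  have s: "0 < y" "0 < 1 - x" "y \<le> s" "1 - x \<le> s" "s < 1" using xy False by (auto simp: s_def)
  have "iso_profile n (x - y) = iso_profile n s" using iso_profile_sym[of n s] by (simp add: s_def)
  also have "\<dots> = (1 - x) / s * iso_profile n s + y / s * iso_profile n s"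
    using s by (simp add: add_divide_distrib[symmetric] distrib_right[symmetric] s_def)
  also have "\<dots> \<le> iso_profile n (1 - x) + iso_profile n y"
    using s n by (intro add_mono iso_profile_star) auto
  finally show ?thesis by (simp add: iso_profile_sym)
qed

text \<open>The star property from both ends gives a continuous minorant,
  \<open>min (y / x) ((1 - y) / (1 - x))\<close> times the value at \<open>x\<close>, which is exact
  at \<open>x\<close>.\<close>

lemma iso_profile_lower_semicontinuous:
  assumes n: "0 < n" and x: "0 < x" "x < 1" and e: "0 < e"
  obtains d where "0 < d" "\<And>y. \<bar>y - x\<bar> < d \<Longrightarrow> iso_profile n x - e < iso_profile n y"
proof -
  let ?f = "\<lambda>y. min (y / x) ((1 - y) / (1 - x)) * iso_profile n x"
  have "isCont ?f x" using x by (intro continuous_intros) auto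
  moreover have "?f x = iso_profile n x" using x by simp
  ultimately have "eventually (\<lambda>y. ?f y > iso_profile n x - e) (at x)" "?f x > iso_profile n x - e"
    using e order_tendstoD(1)[of ?f "?f x" "at x" "iso_profile n x - e"] by (auto simp: isCont_def)
  then have "eventually (\<lambda>y. ?f y > iso_profile n x - e) (nhds x)"
    by (simp add: eventually_nhds_conv_at)
  then obtain d0 where d0: "d0 > 0" "\<And>y. dist y x < d0 \<Longrightarrow> ?f y > iso_profile n x - e"
    by (auto simp: eventually_nhds_metric)
  show thesis
  proof
    show "0 < Min {d0, x, 1 - x}" using d0 x by simp
    fix y assume y: "\<bar>y - x\<bar> < Min {d0, x, 1 - x}"
    then have y01: "0 < y" "y < 1" "dist y x < d0" by (auto simp: dist_real_def)
    have "?f y \<le> iso_profile n y"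
    proof (cases "y \<le> x")
      case True
      have "?f y \<le> y / x * iso_profile n x" by (intro mult_right_mono iso_profile_nonneg) auto
      also have "\<dots> \<le> iso_profile n y" using True y01 x n by (intro iso_profile_star) auto
      finally show ?thesis .
    next
      case False
      have "?f y \<le> (1 - y) / (1 - x) * iso_profile n (1 - x)"
        unfolding iso_profile_sym by (intro mult_right_mono iso_profile_nonneg) auto
      also have "\<dots> \<le> iso_profile n (1 - y)" using False y01 x n by (intro iso_profile_star) auto
      finally show ?thesis by (simp add: iso_profile_sym)
    qed
    then show "iso_profile n x - e < iso_profile n y" using d0(2)[OF y01(3)] by linarith
  qed
qed

section \<open>The ratio of ends that minimises the cone profile\<close>

definition psum :: "nat \<Rightarrow> real \<Rightarrow> real" where "psum n r = (\<Sum>i<n. r ^ i)"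
definition dpsum :: "nat \<Rightarrow> real \<Rightarrow> real" where "dpsum n r = (\<Sum>i<n. real i * r ^ (i - 1))"
text \<open>\<open>dpsum\<close> is the derivative of \<open>psum\<close>, and \<open>qpsum\<close>
  is the quotient of \<open>psum n r - n\<close> by \<open>r - 1\<close>. As polynomials with
  nonnegative coefficients they also make sense at \<open>r = 1\<close>, the cylinder, where the
  closed forms are 0/0.\<close>

definition qpsum :: "nat \<Rightarrow> real \<Rightarrow> real" where "qpsum n r = (\<Sum>k<n - 1. real (n - 1 - k) * r ^ k)"

lemma psum_Suc: "psum (Suc n) r = psum n r + r ^ n"
  by (simp add: psum_def)

lemma psum_geometric: "(r - 1) * psum n r = r ^ n - 1"
  by (induction n) (simp_all add: psum_def algebra_simps)

lemma psum_has_derivative: "(psum n has_real_derivative dpsum n r) (at r)"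
  unfolding psum_def dpsum_def by (auto intro!: derivative_eq_intros)

lemma dpsum_Suc: "dpsum (Suc n) r = dpsum n r + real n * r ^ (n - 1)"
  by (simp add: dpsum_def)

lemma dpsum_eq: "0 < n \<Longrightarrow> (r - 1) * dpsum n r = real n * r ^ (n - 1) - psum n r"
proof (induction n rule: nat_induct_non_zero)
  case 1 then show ?case by (simp add: dpsum_def psum_def)
next
  case (Suc n)
  have "r ^ n = r * r ^ (n - 1)" using Suc by (simp add: power_eq_if)
  then show ?case using Suc.IH by (simp add: dpsum_Suc psum_Suc algebra_simps)
qed

lemma qpsum_Suc: "0 < n \<Longrightarrow> qpsum (Suc n) r = qpsum n r + psum n r"
proof -
  assume n: "0 < n"
  have "qpsum (Suc n) r = (\<Sum>k<n. (real (n - 1 - k) * r ^ k + r ^ k))"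
    unfolding qpsum_def by (intro sum.cong) (auto simp: algebra_simps of_nat_diff)
  also have "\<dots> = (\<Sum>k<n. real (n - 1 - k) * r ^ k) + psum n r" by (simp add: sum.distrib psum_def)
  also have "(\<Sum>k<n. real (n - 1 - k) * r ^ k) = qpsum n r"
    using n by (cases n) (simp_all add: qpsum_def)
  finally show ?thesis .
qed

lemma qpsum_eq: "0 < n \<Longrightarrow> (r - 1) * qpsum n r = psum n r - real n"
proof (induction n rule: nat_induct_non_zero)
  case 1 then show ?case by (simp add: qpsum_def psum_def)
next
  case (Suc n)
  then have "(r - 1) * qpsum (Suc n) r = (psum n r - real n) + (r ^ n - 1)"
    by (simp add: qpsum_Suc distrib_left psum_geometric)
  then show ?case by (simp add: psum_Suc)
qed

text \<open>Splits the denominator of the critical abscissa into its numerator and a second positive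
  term, so that abscissae can be compared through the ratio of these two terms.\<close>

lemma psum_mult: "0 < n \<Longrightarrow> psum n r * psum (n - 1) r = dpsum n r + r ^ (n - 1) * qpsum n r"
proof (induction n rule: nat_induct_non_zero)
  case 1 then show ?case by (simp add: qpsum_def psum_def dpsum_def)
next
  case (Suc n)
  then obtain m where m: "n = Suc m" by (cases n) auto
  have q: "r * qpsum n r = qpsum n r + psum n r - real n" using qpsum_eq[OF Suc.hyps, of r] by (simp add: algebra_simps)
  have "psum (Suc n) r * psum (Suc n - 1) r = psum n r * (psum (n - 1) r + r ^ (n - 1) + r ^ n)"
    by (simp add: psum_Suc m algebra_simps)
  also have "\<dots> = dpsum n r + r ^ (n - 1) * qpsum n r + psum n r * (r ^ (n - 1) + r ^ n)"
    using Suc.IH by (simp add: algebra_simps)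
  also have "\<dots> = dpsum n r + real n * r ^ (n - 1) + r ^ (n - 1) * (qpsum n r + psum n r - real n) + psum n r * r ^ n"
    by (simp add: algebra_simps)
  also have "\<dots> = dpsum n r + real n * r ^ (n - 1) + r ^ n * (qpsum n r + psum n r)"
    unfolding q[symmetric] by (simp add: m algebra_simps)
  finally show ?case using Suc.hyps by (simp add: dpsum_Suc qpsum_Suc)
qed

lemma psum_pos:
  assumes "2 \<le> n" "0 < r"
  shows "0 < psum n r" "0 < psum (n - 1) r" "0 < dpsum n r" "0 < qpsum n r"
proof -
  show "0 < psum n r" "0 < psum (n - 1) r" "0 < qpsum n r"
    using assms unfolding psum_def qpsum_def by (auto intro!: sum_pos simp: lessThan_empty_iff bot_nat_def)
  show "0 < dpsum n r"
    unfolding dpsum_def by (rule sum_pos2[of _ 1]) (use assms in auto)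
qed

text \<open>The quotient \<open>dpsum / (psum n * psum (n-1))\<close> is the abscissa \<open>x\<close> at which \<open>r\<close> is the
  extremal ratio; it equals \<open>1 / (1 + r^(n-1) * qpsum / dpsum)\<close>.\<close>

lemma extremal_ratio_mono:
  assumes n: "2 \<le> n" and r: "0 < r" "r < s"
  shows "s * (r ^ (n - 1) * qpsum n r * dpsum n s) \<le> r * (s ^ (n - 1) * qpsum n s * dpsum n r)"
proof -
  \<comment> \<open>\<open>dpsum n\<close> has degree \<open>n - 2\<close>; divided by the power
    \<open>n - 2\<close> of its argument it is a sum of nonpositive powers and therefore
    nonincreasing. The extra factor \<open>s\<close> against \<open>r\<close> in the conclusion,
    linear growth rather than mere monotonicity, comes from splitting the power
    \<open>n - 1\<close>.\<close>
  have "r ^ (n - 2) * dpsum n s \<le> s ^ (n - 2) * dpsum n r"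
    unfolding dpsum_def sum_distrib_left
  proof (rule sum_mono)
    fix i assume i: "i \<in> {..<n}"
    show "r ^ (n - 2) * (real i * s ^ (i - 1)) \<le> s ^ (n - 2) * (real i * r ^ (i - 1))"
    proof (cases "i = 0")
      case False
      then have "n - 2 = (n - 1 - i) + (i - 1)" using i by auto
      then have e: "r ^ (n - 2) = r ^ (n - 1 - i) * r ^ (i - 1)" "s ^ (n - 2) = s ^ (n - 1 - i) * s ^ (i - 1)"
        by (simp_all add: power_add[symmetric])
      have "r ^ (n - 1 - i) \<le> s ^ (n - 1 - i)" using r by (intro power_mono) auto
      then have "r ^ (n - 1 - i) * (r ^ (i - 1) * (real i * s ^ (i - 1))) \<le> s ^ (n - 1 - i) * (r ^ (i - 1) * (real i * s ^ (i - 1)))"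
        using r by (intro mult_right_mono) auto
      then show ?thesis unfolding e by (simp add: mult_ac)
    qed simp
  qed
  moreover have "qpsum n r \<le> qpsum n s"
    unfolding qpsum_def using r by (intro sum_mono mult_left_mono power_mono) auto
  ultimately have "(r ^ (n - 2) * dpsum n s) * qpsum n r \<le> (s ^ (n - 2) * dpsum n r) * qpsum n s"
    using psum_pos[OF n, of r] r by (intro mult_mono[of "r ^ (n - 2) * dpsum n s"]) (auto simp: less_imp_le)
  then have "(r * s) * ((r ^ (n - 2) * dpsum n s) * qpsum n r) \<le> (r * s) * ((s ^ (n - 2) * dpsum n r) * qpsum n s)"
    using r by (intro mult_left_mono) auto
  moreover have "n - 1 = Suc (n - 2)" using n by auto
  then have "r ^ (n - 1) = r * r ^ (n - 2)" "s ^ (n - 1) = s * s ^ (n - 2)" by (metis power_Suc)+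
  ultimately show ?thesis by (simp add: mult_ac)
qed

definition extremal_abscissa :: "nat \<Rightarrow> real \<Rightarrow> real" where
  "extremal_abscissa n r = dpsum n r / (psum n r * psum (n - 1) r)"

lemma extremal_abscissa_strict_antimono:
  assumes n: "2 \<le> n" and r: "0 < r" "r < s"
  shows "extremal_abscissa n s < extremal_abscissa n r"
proof -
  have s: "0 < s" using r by simp
  note pr = psum_pos[OF n r(1)] and ps = psum_pos[OF n s]
  let ?a = "r ^ (n - 1) * qpsum n r * dpsum n s" and ?b = "s ^ (n - 1) * qpsum n s * dpsum n r"
  have b: "0 < ?b" using s pr ps by simp
  have "s * ?a \<le> r * ?b" using extremal_ratio_mono[OF n r] .
  also have "r * ?b < s * ?b" using b r by (intro mult_strict_right_mono)
  finally have ab: "?a < ?b" using s by simp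
  have "dpsum n s * (psum n r * psum (n - 1) r) < dpsum n r * (psum n s * psum (n - 1) s)"
    using ab psum_mult[of n] n by (simp add: algebra_simps)
  then show ?thesis unfolding extremal_abscissa_def using pr ps
    by (simp add: divide_less_eq less_divide_eq mult_ac)
qed

lemma extremal_abscissa_one:
  assumes n: "2 \<le> n" shows "extremal_abscissa n 1 = 1 / 2"
proof -
  have "2 * dpsum m 1 = real m * (real m - 1)" for m
    by (induction m) (simp_all add: dpsum_def algebra_simps)
  moreover have "psum n 1 * psum (n - 1) 1 = real n * (real n - 1)" using n by (simp add: psum_def of_nat_diff)
  ultimately have "psum n 1 * psum (n - 1) 1 = 2 * dpsum n 1" by simp
  then show ?thesis using psum_pos(3)[OF n zero_less_one] unfolding extremal_abscissa_def by simp
qed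

text \<open>Intermediate values between \<open>r = 1\<close>, where the abscissa is 1/2, and
  \<open>r = 1 / x\<close>. The upper end works because the ratio in
  \<open>extremal_ratio_mono\<close> grows at least linearly from its value 1 at
  \<open>r = 1\<close>, so the abscissa at \<open>s\<close> is at most \<open>1 / s\<close>.\<close>

lemma extremal_abscissa_exists:
  assumes n: "2 \<le> n" and x: "0 < x" "x \<le> 1 / 2"
  obtains r where "1 \<le> r" "extremal_abscissa n r = x"
proof -
  define s where "s = 1 / x"
  have s: "1 < s" "0 < s" using x by (auto simp: s_def field_simps)
  note p1 = psum_pos[OF n zero_less_one] and ps = psum_pos[OF n s(2)]
  have "dpsum n 1 = qpsum n 1"
    using extremal_abscissa_one[OF n] psum_mult[of n 1] n p1 by (simp add: extremal_abscissa_def field_simps)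
  then have "s * dpsum n s \<le> s ^ (n - 1) * qpsum n s"
    using extremal_ratio_mono[OF n zero_less_one s(1)] p1 by simp
  also have "\<dots> \<le> psum n s * psum (n - 1) s" using psum_mult[of n s] n ps by simp
  finally have le: "extremal_abscissa n s \<le> x"
    using ps s x by (simp add: extremal_abscissa_def s_def field_simps)
  have "continuous_on {1..s} (extremal_abscissa n)"
    unfolding extremal_abscissa_def[abs_def] dpsum_def psum_def[of "n - 1"]
  proof (intro continuous_intros ballI)
    show "continuous_on {1..s} (psum n)" unfolding psum_def[abs_def] by (intro continuous_intros)
    show "psum n r * (\<Sum>i<n - 1. r ^ i) \<noteq> 0" if "r \<in> {1..s}" for r
      using psum_pos[OF n, of r] that by (simp add: psum_def)
  qed
  then obtain r where "1 \<le> r" "r \<le> s" "extremal_abscissa n r = x"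
    using IVT2'[of "extremal_abscissa n" s x 1] le extremal_abscissa_one[OF n] x s by auto
  then show thesis using that by blast
qed

lemma cone_profile_one:
  "cone_profile n 1 r x = real n * root n (1 - x + x * r ^ n) ^ (n - 1) / psum n r"
  by (simp add: cone_profile_def psum_def)

text \<open>The n-th power \<psi> of the profile, up to the factor n, is free of roots. Its
  derivative at \<open>t\<close> has the sign of \<open>x\<close> minus the abscissa of
  \<open>t\<close>; as the abscissa decreases, \<psi> decreases up to \<open>r\<close> and increases
  afterwards.\<close>

lemma cone_profile_minimal:
  assumes n: "2 \<le> n" and x: "0 < x" "x < 1" and r: "0 < r" "extremal_abscissa n r = x" and s: "0 < s"
  shows "cone_profile n 1 r x \<le> cone_profile n 1 s x"
proof -
  define z where "z = (\<lambda>t. 1 - x + x * t ^ n)"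
  define \<psi> where "\<psi> = (\<lambda>t. z t ^ (n - 1) / psum n t ^ n)"
  define \<psi>' where "\<psi>' = (\<lambda>t. real n * z t ^ (n - 2) * psum n t ^ (n - 1) * (x * psum n t * psum (n - 1) t - dpsum n t) / (psum n t ^ n * psum n t ^ n))"
  have zpos: "0 < z t" if "0 < t" for t using that x by (auto simp: z_def intro!: add_pos_pos)
  have nn: "n - 1 = Suc (n - 2)" "n = Suc (n - 1)" and n0: "0 < n" using n by auto
  have der: "(\<psi> has_real_derivative \<psi>' t) (at t)" if t: "0 < t" for t
  proof -
    have p: "psum n t = psum (n - 1) t + t ^ (n - 1)" using psum_Suc[of "n - 1" t] n by simp
    have zt: "z t = 1 + x * ((t - 1) * psum n t)" unfolding psum_geometric by (simp add: z_def algebra_simps)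
    have "z t * dpsum n t = dpsum n t + x * ((t - 1) * psum n t * dpsum n t)"
      unfolding zt by (simp add: algebra_simps)
    also have "(t - 1) * psum n t * dpsum n t = psum n t * (real n * t ^ (n - 1) - psum n t)"
      unfolding dpsum_eq[OF n0, symmetric] by simp
    finally have zd: "z t * dpsum n t = dpsum n t + x * (psum n t * (real n * t ^ (n - 1) - psum n t))" .
    \<comment> \<open>Here the factor that decides the sign loses its dependence on
      \<open>z\<close>: \<open>dpsum_eq\<close> eliminates \<open>t - 1\<close>.\<close>
    have br: "(real n - 1) * x * t ^ (n - 1) * psum n t - z t * dpsum n t = x * psum n t * psum (n - 1) t - dpsum n t"
      unfolding zd by (simp add: p algebra_simps)
    have "(\<psi> has_real_derivative
       ((real (n - 1) * z t ^ (n - 2) * (x * (real n * t ^ (n - 1)))) * psum n t ^ n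
         - z t ^ (n - 1) * (real n * psum n t ^ (n - 1) * dpsum n t)) / (psum n t ^ n * psum n t ^ n)) (at t)"
      unfolding \<psi>_def
    proof (rule DERIV_divide)
      have "(z has_real_derivative x * (real n * t ^ (n - 1))) (at t)"
        unfolding z_def by (auto intro!: derivative_eq_intros)
      from DERIV_power[OF this, of "n - 1"]
      show "((\<lambda>t. z t ^ (n - 1)) has_real_derivative real (n - 1) * z t ^ (n - 2) * (x * (real n * t ^ (n - 1)))) (at t)"
        by (simp add: numeral_2_eq_2 mult_ac)
      from DERIV_power[OF psum_has_derivative[of n t], of n]
      show "((\<lambda>t. psum n t ^ n) has_real_derivative real n * psum n t ^ (n - 1) * dpsum n t) (at t)"
        by (simp add: mult_ac)
      show "psum n t ^ n \<noteq> 0" using psum_pos[OF n t] by simp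
    qed
    moreover have "(real (n - 1) * z t ^ (n - 2) * (x * (real n * t ^ (n - 1)))) * psum n t ^ n
         - z t ^ (n - 1) * (real n * psum n t ^ (n - 1) * dpsum n t)
       = real n * z t ^ (n - 2) * psum n t ^ (n - 1) * ((real n - 1) * x * t ^ (n - 1) * psum n t - z t * dpsum n t)"
    proof -
      have "psum n t ^ n = psum n t ^ (n - 1) * psum n t" "z t ^ (n - 1) = z t ^ (n - 2) * z t"
        using nn by (metis power_Suc2)+
      then show ?thesis using n by (simp only: of_nat_diff) (simp add: algebra_simps of_nat_diff)
    qed
    ultimately show ?thesis by (simp only: br \<psi>'_def)
  qed
  have sign: "\<psi>' t \<le> 0" if "0 < t" "t \<le> r" for t
  proof -
    have "x \<le> extremal_abscissa n t"
      using extremal_abscissa_strict_antimono[OF n that(1), of r] r that by (cases "t = r") auto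
    then have "x * psum n t * psum (n - 1) t - dpsum n t \<le> 0"
      using psum_pos[OF n that(1)] by (simp add: extremal_abscissa_def pos_le_divide_eq mult_ac)
    then show ?thesis unfolding \<psi>'_def using psum_pos[OF n that(1)] zpos[OF that(1)]
      by (intro divide_nonpos_pos mult_nonneg_nonpos) auto
  qed
  have sign': "0 \<le> \<psi>' t" if "r \<le> t" for t
  proof -
    have t: "0 < t" using r that by simp
    have "extremal_abscissa n t \<le> x"
      using extremal_abscissa_strict_antimono[OF n r(1), of t] r that by (cases "t = r") auto
    then have "0 \<le> x * psum n t * psum (n - 1) t - dpsum n t"
      using psum_pos[OF n t] by (simp add: extremal_abscissa_def pos_divide_le_eq mult_ac)
    then show ?thesis unfolding \<psi>'_def using psum_pos[OF n t] zpos[OF t]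
      by (intro divide_nonneg_pos mult_nonneg_nonneg) auto
  qed
  have "\<psi> r \<le> \<psi> s"
  proof (cases "s \<le> r")
    case True
    show ?thesis
    proof (rule DERIV_nonpos_imp_nonincreasing[OF True])
      fix t assume t: "s \<le> t" "t \<le> r"
      then have "0 < t" using s by simp
      then show "\<exists>y. (\<psi> has_real_derivative y) (at t) \<and> y \<le> 0" using der sign t by blast
    qed
  next
    case False
    then have "r \<le> s" by simp
    then show ?thesis
    proof (rule DERIV_nonneg_imp_nondecreasing)
      fix t assume t: "r \<le> t" "t \<le> s"
      then have "0 < t" using r by simp
      then show "\<exists>y. (\<psi> has_real_derivative y) (at t) \<and> 0 \<le> y" using der sign' t by blast
    qed
  qed
  moreover have "cone_profile n 1 t x = real n * root n (\<psi> t)" if t: "0 < t" for t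
  proof -
    have "root n (\<psi> t) = root n (z t ^ (n - 1)) / root n (psum n t ^ n)" by (simp add: \<psi>_def real_root_divide)
    also have "root n (psum n t ^ n) = psum n t" using psum_pos(1)[OF n t] n by (simp add: real_root_power_cancel)
    also have "root n (z t ^ (n - 1)) = root n (z t) ^ (n - 1)" using n by (simp add: real_root_power)
    finally show ?thesis by (simp add: cone_profile_one z_def)
  qed
  ultimately show ?thesis using r s n by (simp add: mult_left_mono)
qed

lemma iso_profile_attained:
  assumes n: "2 \<le> n" and x: "0 < x" "x < 1" and r: "0 < r" "extremal_abscissa n r = x"
  shows "iso_profile n x = cone_profile n 1 r x"
proof (rule antisym)
  show "iso_profile n x \<le> cone_profile n 1 r x" using x r by (intro iso_profile_lower) auto
  show "cone_profile n 1 r x \<le> iso_profile n x"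
  proof (rule iso_profile_greatest[OF x])
    fix A B :: real assume "0 < A" "0 < B"
    then show "cone_profile n 1 r x \<le> cone_profile n A B x"
      using cone_profile_scale[of A n B x] cone_profile_minimal[OF n x r, of "B / A"] n by simp
  qed
qed

section \<open>The parametric formula for the profile\<close>

lemma Gx_eq_extremal_abscissa:
  assumes n: "2 \<le> n" and \<gamma>: "0 < \<gamma>"
  shows "Gx n \<gamma> = extremal_abscissa n (1 + \<gamma>)"
proof -
  define r where "r = 1 + \<gamma>"
  have r: "0 < r" "1 < r" "\<gamma> = r - 1" using \<gamma> by (auto simp: r_def)
  obtain m where m: "n = Suc m" using n by (cases n) auto
  have d: "(r - 1) * ((r - 1) * dpsum n r) = r ^ (n - 1) * ((r - 1) * real (n - 1) - 1) + 1"
  proof -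
    have "(r - 1) * ((r - 1) * dpsum n r) = (r - 1) * (real n * r ^ (n - 1)) - (r ^ n - 1)"
      using dpsum_eq[of n r] n by (simp add: right_diff_distrib psum_geometric)
    then show ?thesis by (simp add: m algebra_simps)
  qed
  have "Gx n \<gamma> = ((r - 1) * ((r - 1) * dpsum n r)) / (((r - 1) * psum (n - 1) r) * ((r - 1) * psum n r))"
    unfolding d psum_geometric by (simp add: Gx_def r(3))
  also have "\<dots> = extremal_abscissa n r"
  proof -
    have "(k * (k * d)) / ((k * b) * (k * a)) = d / (a * b)" if "k \<noteq> 0" "a \<noteq> 0" "b \<noteq> 0" for k d a b :: real
      using that by (simp add: field_simps)
    then show ?thesis using psum_pos[OF n r(1)] r(2) by (simp add: extremal_abscissa_def)
  qed
  finally show ?thesis by (simp add: r_def)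
qed

text \<open>With \<open>r = 1 + \<gamma>\<close>, the prefactor of \<open>Gval\<close> is
  \<open>n / psum n r\<close>, and its bracket equals \<open>1 - x + x * r ^ n\<close> at the
  abscissa \<open>x = Gx n \<gamma>\<close>.\<close>

lemma Gval_eq_cone_profile:
  assumes n: "2 \<le> n" and \<gamma>: "0 < \<gamma>"
  shows "Gval n \<gamma> = cone_profile n 1 (1 + \<gamma>) (Gx n \<gamma>)"
proof -
  define r x where "r = 1 + \<gamma>" and "x = Gx n \<gamma>"
  have r: "0 < r" "1 < r" "\<gamma> = r - 1" using \<gamma> by (auto simp: r_def)
  note p = psum_pos[OF n r(1)]
  have x: "x = dpsum n r / (psum n r * psum (n - 1) r)"
    unfolding x_def Gx_eq_extremal_abscissa[OF assms] extremal_abscissa_def r_def ..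
  have pp: "psum n r = psum (n - 1) r + r ^ (n - 1)" using psum_Suc[of "n - 1" r] n by simp
  have "1 - x + x * r ^ n = 1 + x * ((r - 1) * psum n r)" unfolding psum_geometric by (simp add: algebra_simps)
  also have "x * ((r - 1) * psum n r) = (r - 1) * dpsum n r / psum (n - 1) r"
    using p by (simp add: x field_simps)
  also have "(r - 1) * dpsum n r = real n * r ^ (n - 1) - psum n r" using dpsum_eq n by simp
  also have "1 + (real n * r ^ (n - 1) - psum n r) / psum (n - 1) r = r ^ (n - 1) * real (n - 1) / psum (n - 1) r"
    using p n by (simp add: pp field_simps of_nat_diff)
  also have "\<dots> = r ^ (n - 1) * (r - 1) * real (n - 1) / (r ^ (n - 1) - 1)"
    unfolding psum_geometric[symmetric] using r by simp
  finally have z: "1 - x + x * r ^ n = r ^ (n - 1) * (r - 1) * real (n - 1) / (r ^ (n - 1) - 1)" .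
  have zpos: "0 < r ^ (n - 1) * (r - 1) * real (n - 1) / (r ^ (n - 1) - 1)"
    unfolding psum_geometric[symmetric] using r p n by simp
  have pw: "y powr (1 - 1 / real n) = root n y ^ (n - 1)" if "0 < y" for y
  proof -
    have "1 - 1 / real n = (1 / real n) * real (n - 1)" using n by (simp add: field_simps of_nat_diff)
    then have "y powr (1 - 1 / real n) = (y powr (1 / real n)) powr real (n - 1)" by (simp only: powr_powr)
    also have "y powr (1 / real n) = root n y" using that n by (simp add: root_powr_inverse)
    also have "root n y powr real (n - 1) = root n y ^ (n - 1)" using that n by (intro powr_realpow) auto
    finally show ?thesis .
  qed
  have "Gval n \<gamma> = (r - 1) * real n / ((r - 1) * psum n r) * (1 - x + x * r ^ n) powr (1 - 1 / real n)"
    unfolding z psum_geometric by (simp add: Gval_def r(3))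
  also have "\<dots> = real n / psum n r * root n (1 - x + x * r ^ n) ^ (n - 1)"
    using pw[OF zpos[folded z]] r by simp
  finally show ?thesis by (simp add: cone_profile_one r_def x_def)
qed

text \<open>For \<open>x < 1/2\<close> the parameter \<gamma> is unique because the abscissa is
  strictly decreasing, so the definite description in \<open>G\<close> denotes. The value
  \<open>x = 1/2\<close> belongs to \<open>r = 1\<close>, that is to \<gamma> = 0, which the formula
  excludes; there the cylinder has profile 1. The second claim supplies the cone used for
  sharpness.\<close>

lemma G_eq_iso_profile:
  assumes n: "0 < n" and x: "0 < x" "x \<le> 1 / 2"
  shows "x * G n (1 / x) = iso_profile n x"
    and "\<exists>r\<ge>1. cone_profile n 1 r x = iso_profile n x"
proof -
  have x1: "x < 1" using x by simp
  have "x * G n (1 / x) = iso_profile n x \<and> (\<exists>r\<ge>1. cone_profile n 1 r x = iso_profile n x)"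
  proof (cases "n = 1")
    case True
    have one: "cone_profile n A B x = 1" for A B by (simp add: cone_profile_def True)
    then have "iso_profile n x = 1"
      using iso_profile_lower[OF x(1) x1 zero_less_one zero_less_one, of n] iso_profile_greatest[OF x(1) x1, of 1 n]
      by (intro antisym) auto
    then show ?thesis using x one by (auto simp: G_def True)
  next
    case False
    then have n2: "2 \<le> n" using n by simp
    obtain r where r: "1 \<le> r" "extremal_abscissa n r = x" using extremal_abscissa_exists[OF n2 x] .
    have I: "iso_profile n x = cone_profile n 1 r x" using iso_profile_attained[OF n2 x(1) x1 _ r(2)] r by simp
    have "x * G n (1 / x) = iso_profile n x"
    proof (cases "x = 1 / 2")
      case True
      then have "r = 1"
        using extremal_abscissa_strict_antimono[OF n2 zero_less_one, of r] extremal_abscissa_one[OF n2] r by force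
      moreover have "1 / x = 2" unfolding True by simp
      ultimately show ?thesis using False n I True by (simp only: G_def) (simp add: cone_profile_const)
    next
      case half: False
      define \<gamma> where "\<gamma> = r - 1"
      have "r \<noteq> 1" using half r extremal_abscissa_one[OF n2] by auto
      then have \<gamma>: "0 < \<gamma>" "r = 1 + \<gamma>" using r by (auto simp: \<gamma>_def)
      have gx: "Gx n \<gamma> = x" using Gx_eq_extremal_abscissa[OF n2 \<gamma>(1)] r \<gamma> by simp
      have uniq: "\<gamma>' = \<gamma>" if "0 < \<gamma>'" "Gx n \<gamma>' = x" for \<gamma>'
        using that Gx_eq_extremal_abscissa[OF n2 that(1)] r \<gamma>
          extremal_abscissa_strict_antimono[OF n2, of "1 + \<gamma>" "1 + \<gamma>'"]
          extremal_abscissa_strict_antimono[OF n2, of "1 + \<gamma>'" "1 + \<gamma>"]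
        by (cases \<gamma> \<gamma>' rule: linorder_cases) auto
      have "G n (1 / x) = (THE y. \<exists>\<gamma>>0. x = Gx n \<gamma> \<and> y * x = Gval n \<gamma>)"
        using False half x by (simp add: G_def divide_eq_eq)
      also have "\<dots> = Gval n \<gamma> / x"
      proof (rule the_equality)
        show "\<exists>\<gamma>'>0. x = Gx n \<gamma>' \<and> Gval n \<gamma> / x * x = Gval n \<gamma>'" using \<gamma> gx x by (intro exI[of _ \<gamma>]) auto
        fix y assume "\<exists>\<gamma>'>0. x = Gx n \<gamma>' \<and> y * x = Gval n \<gamma>'"
        then obtain \<gamma>' where "0 < \<gamma>'" "x = Gx n \<gamma>'" "y * x = Gval n \<gamma>'" by blast
        then show "y = Gval n \<gamma> / x" using uniq[of \<gamma>'] x by (simp add: field_simps)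
      qed
      finally show ?thesis using Gval_eq_cone_profile[OF n2 \<gamma>(1)] gx I \<gamma> x by simp
    qed
    then show ?thesis using I r by auto
  qed
  then show "x * G n (1 / x) = iso_profile n x" "\<exists>r\<ge>1. cone_profile n 1 r x = iso_profile n x" by auto
qed

section \<open>Separated sets in thin convex bodies\<close>

lemma measure_slab:
  fixes K :: "'a::euclidean_space set"
  assumes K: "K \<in> lmeasurable" and e: "e \<noteq> 0" and ab: "a \<le> b"
  shows "vol (K \<inter> {y. a < y \<bullet> e \<and> y \<bullet> e < b})
       = vol (K \<inter> {y. y \<bullet> e < b}) - vol (K \<inter> {y. y \<bullet> e < a})" (is ?A)
    and "vol (K \<inter> {y. a \<le> y \<bullet> e \<and> y \<bullet> e \<le> b})
       = vol (K \<inter> {y. y \<bullet> e < b}) - vol (K \<inter> {y. y \<bullet> e < a})"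
proof -
  have Kb: "K \<inter> {y. y \<bullet> e < b} \<in> lmeasurable" by (rule lmeasurable_Int_halfspaces[OF K])
  have "K \<inter> {y. y \<bullet> e < b} \<inter> {y. y \<bullet> e < a} = K \<inter> {y. y \<bullet> e < a}"
    "K \<inter> {y. y \<bullet> e < b} \<inter> {y. a < y \<bullet> e} = K \<inter> {y. a < y \<bullet> e \<and> y \<bullet> e < b}" using ab by auto
  then show A: ?A using measure_split_halfspaces[OF Kb e, of a] by simp
  have "vol (K \<inter> {y. a \<le> y \<bullet> e \<and> y \<bullet> e \<le> b}) = vol (K \<inter> {y. a < y \<bullet> e \<and> y \<bullet> e < b})"
  proof (rule measure_negligible_symdiff)
    have "K \<inter> {y. y \<bullet> e < b} \<inter> {y. a < y \<bullet> e} \<in> lmeasurable" by (rule lmeasurable_Int_halfspaces[OF Kb])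
    then show "K \<inter> {y. a < y \<bullet> e \<and> y \<bullet> e < b} \<in> lmeasurable" by (simp add: Collect_conj_eq Int_ac)
    show "negligible (K \<inter> {y. a < y \<bullet> e \<and> y \<bullet> e < b} - K \<inter> {y. a \<le> y \<bullet> e \<and> y \<bullet> e \<le> b} \<union>
       (K \<inter> {y. a \<le> y \<bullet> e \<and> y \<bullet> e \<le> b} - K \<inter> {y. a < y \<bullet> e \<and> y \<bullet> e < b}))"
    proof (rule negligible_subset)
      show "negligible ({y. e \<bullet> y = a} \<union> {y. e \<bullet> y = b})" using e by (intro negligible_Un negligible_hyperplane) auto
    qed (auto simp: inner_commute)
  qed
  then show "vol (K \<inter> {y. a \<le> y \<bullet> e \<and> y \<bullet> e \<le> b})
       = vol (K \<inter> {y. y \<bullet> e < b}) - vol (K \<inter> {y. y \<bullet> e < a})" using A by simp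
qed

text \<open>The inequality for slabs is Brunn-Minkowski divided by the n-th root of
  \<open>vol K\<close>. Strict growth of \<open>V\<close> requires each open slab that meets
  \<open>K\<close> to contain interior points of \<open>K\<close>.\<close>

lemma convex_body_marginal_needle:
  fixes K :: "'a::euclidean_space set" and e :: 'a
  defines "V \<equiv> \<lambda>t. vol (K \<inter> {y. y \<bullet> e < t}) / vol K"
  assumes K: "compact K" "convex K" and pos: "vol K > 0" and e: "e \<noteq> 0"
  obtains p q yp yq where "needle DIM('a) p q V" "yp \<in> K" "yq \<in> K" "yp \<bullet> e = p" "yq \<bullet> e = q"
    "\<And>y. y \<in> K \<Longrightarrow> p \<le> y \<bullet> e \<and> y \<bullet> e \<le> q"
proof -
  let ?S = "\<lambda>a b. K \<inter> {y. a < y \<bullet> e \<and> y \<bullet> e < b}"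
  have ne: "K \<noteq> {}" using pos by auto
  have Km: "K \<in> lmeasurable" using K by (simp add: lmeasurable_compact)
  have c: "continuous_on K (\<lambda>y. y \<bullet> e)" by (intro continuous_intros)
  obtain yp where yp: "yp \<in> K" "\<And>y. y \<in> K \<Longrightarrow> yp \<bullet> e \<le> y \<bullet> e" using continuous_attains_inf[OF K(1) ne c] by blast
  obtain yq where yq: "yq \<in> K" "\<And>y. y \<in> K \<Longrightarrow> y \<bullet> e \<le> yq \<bullet> e" using continuous_attains_sup[OF K(1) ne c] by blast
  define p q where "p = yp \<bullet> e" and "q = yq \<bullet> e"
  have pq: "\<And>y. y \<in> K \<Longrightarrow> p \<le> y \<bullet> e \<and> y \<bullet> e \<le> q" using yp yq by (auto simp: p_def q_def)
  have intK: "interior K \<noteq> {}"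
    using pos negligible_convex_interior[OF K(2)] negligible_imp_measure0 by force
  have "p < q"
  proof (rule ccontr)
    assume "\<not> p < q"
    then have "K \<subseteq> {y. e \<bullet> y = p}" using pq by (force simp: inner_commute)
    then have "negligible K" using negligible_hyperplane[of e p] e negligible_subset by blast
    then show False using pos negligible_imp_measure0 by force
  qed
  have slab: "V b - V a = vol (?S a b) / vol K" if "a \<le> b" for a b
    unfolding V_def measure_slab(1)[OF Km e that] by (simp add: diff_divide_distrib)
  have "V a < V b" if ab: "p \<le> a" "a < b" "b \<le> q" for a b
  proof -
    \<comment> \<open>\<open>z\<close> is the point at height \<open>(a + b) / 2\<close> on the
      segment from a lowest to a highest point. It need not be interior, but it is a limit of
      interior points, and these give the slab positive volume.\<close>
    define u where "u = ((a + b) / 2 - p) / (q - p)"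
    define z where "z = (1 - u) *\<^sub>R yp + u *\<^sub>R yq"
    have u: "0 \<le> u" "u \<le> 1" using ab \<open>p < q\<close> by (auto simp: u_def)
    then have "z \<in> K" unfolding z_def using yp yq by (intro convexD[OF K(2)]) auto
    have "z \<bullet> e = p + u * (q - p)" by (simp add: z_def inner_add_left p_def q_def algebra_simps)
    also have "\<dots> = (a + b) / 2" using \<open>p < q\<close> by (simp add: u_def)
    finally have ze: "a < z \<bullet> e" "z \<bullet> e < b" using ab by auto
    let ?H = "{y. a < y \<bullet> e \<and> y \<bullet> e < b}"
    have opH: "open ?H" by (intro open_Collect_conj open_Collect_less continuous_intros)
    have "z \<in> closure (interior K)" using \<open>z \<in> K\<close> convex_closure_interior[OF K(2) intK] closure_subset by blast
    then have "interior K \<inter> ?H \<noteq> {}" using open_Int_closure_eq_empty[OF opH, of "interior K"] ze by auto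
    then have "0 < vol (interior K \<inter> ?H)"
      by (intro open_measure_pos open_Int open_interior opH bounded_Int disjI1 bounded_interior compact_imp_bounded K(1))
    also have "\<dots> \<le> vol (?S a b)"
    proof (rule measure_mono_fmeasurable)
      show "?S a b \<in> lmeasurable" using K(1) opH
        by (intro fmeasurable_Int_fmeasurable[OF Km]) auto
      show "interior K \<inter> ?H \<in> sets lebesgue" using opH by auto
    qed (use interior_subset in blast)
    finally show ?thesis using slab[of a b] ab pos by (metis diff_gt_0_iff_gt divide_pos_pos less_imp_le)
  qed
  note mono = this
  have BM: "(1 - u) * root DIM('a) (V b - V a) + u * root DIM('a) (V d - V c)
          \<le> root DIM('a) (V ((1 - u) * b + u * d) - V ((1 - u) * a + u * c))"
    if ab: "p \<le> a" "a < b" "b \<le> q" "p \<le> c" "c < d" "d \<le> q" and u: "0 < u" "u < 1" for a b c d u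
  proof -
    have "vol (?S a b) / vol K > 0" "vol (?S c d) / vol K > 0" using slab[of a b] slab[of c d] mono[of a b] mono[of c d] ab by auto
    then have "vol (?S a b) > 0" "vol (?S c d) > 0" using pos by (auto simp: zero_less_divide_iff)
    from convex_slab_concave[OF compact_imp_bounded[OF K(1)] K(2) this u]
    have "((1 - u) * root DIM('a) (vol (?S a b)) + u * root DIM('a) (vol (?S c d))) / root DIM('a) (vol K)
       \<le> root DIM('a) (vol (?S ((1 - u) * a + u * c) ((1 - u) * b + u * d))) / root DIM('a) (vol K)"
      using pos by (intro divide_right_mono) (auto simp: real_root_ge_zero)
    moreover have "(1 - u) * a + u * c \<le> (1 - u) * b + u * d" using ab u by (intro add_mono mult_left_mono) auto
    ultimately show ?thesis using ab by (simp add: slab real_root_divide add_divide_distrib)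
  qed
  have "K \<inter> {y. y \<bullet> e < p} = {}" using pq by force
  then have Vp: "V p = 0" by (simp add: V_def)
  have "K \<inter> {y. q < y \<bullet> e} = {}" using pq by force
  then have Vq: "V q = 1" using measure_split_halfspaces[OF Km e, of q] pos by (simp add: V_def)
  have "continuous_on {p..q} V"
    unfolding V_def using pos by (intro continuous_on_divide continuous_on_subset[OF continuous_on_measure_less[OF Km e]] continuous_intros) auto
  then have N: "needle DIM('a) p q V" unfolding needle_def using \<open>p < q\<close> Vp Vq mono BM by blast
  show thesis by (rule that[OF N yp(1) yq(1) p_def[symmetric] q_def[symmetric] pq])
qed

text \<open>Everything is projected by the functional \<open>y \<bullet> e\<close>. The images of
  \<open>F\<close> and \<open>T\<close> stay compact and \<open>h\<close>-separated, and their
  measure under the marginal is at least that of \<open>F\<close> and \<open>T\<close>, which only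
  narrows the interval for \<sigma> and lowers the uncovered mass.\<close>

lemma convex_body_gap_isoperimetry:
  fixes K :: "'a::euclidean_space set"
  assumes K: "compact K" "convex K" and pos: "vol K > 0" and e: "e \<noteq> 0"
    and FT: "compact F" "compact T" "F \<subseteq> K" "T \<subseteq> K"
    and h: "0 < h" "\<And>a b. a \<in> F \<Longrightarrow> b \<in> T \<Longrightarrow> h \<le> \<bar>a \<bullet> e - b \<bullet> e\<bar>"
    and l: "\<And>y z. y \<in> K \<Longrightarrow> z \<in> K \<Longrightarrow> (y - z) \<bullet> e \<le> l"
  shows "\<exists>\<sigma>. vol T / vol K \<le> \<sigma> \<and> \<sigma> \<le> 1 - vol F / vol K \<and>
    h * iso_profile DIM('a) \<sigma> \<le> l * (1 - vol F / vol K - vol T / vol K)"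
proof -
  let ?n = "DIM('a)"
  define V where "V = (\<lambda>t. vol (K \<inter> {y. y \<bullet> e < t}) / vol K)"
  have Km: "K \<in> lmeasurable" using K by (simp add: lmeasurable_compact)
  obtain p q yp yq where N: "needle ?n p q V" and ypq: "yp \<in> K" "yq \<in> K" "yp \<bullet> e = p" "yq \<bullet> e = q"
    and pq: "\<And>y. y \<in> K \<Longrightarrow> p \<le> y \<bullet> e \<and> y \<bullet> e \<le> q"
    using convex_body_marginal_needle[OF K pos e, folded V_def] by blast
  have V: "p < q" "V p = 0" "V q = 1" "continuous_on {p..q} V" using N by (auto simp: needle_def)
  have ql: "q - p \<le> l" using l[OF ypq(2,1)] ypq by (simp add: inner_diff_left)
  define M where "M = distr (uniform_measure lebesgue K) borel (\<lambda>y. y \<bullet> e)"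
  have meas: "(\<lambda>y. y \<bullet> e) \<in> uniform_measure lebesgue K \<rightarrow>\<^sub>M borel"
  proof -
    have "(\<lambda>y. y \<bullet> e) \<in> lebesgue \<rightarrow>\<^sub>M borel" by (rule measurable_completion) simp
    then show ?thesis
      using measurable_cong_sets[of "uniform_measure lebesgue K" lebesgue borel borel] by simp
  qed
  have emK: "emeasure lebesgue K \<noteq> 0" "emeasure lebesgue K \<noteq> \<infinity>"
    using pos Km by (auto simp: measure_def fmeasurable_def)
  have M_meas: "measure M A = vol (K \<inter> {y. y \<bullet> e \<in> A}) / vol K" if "A \<in> sets borel" for A
  proof -
    have "(\<lambda>y. y \<bullet> e) -` A \<inter> space (uniform_measure lebesgue K) \<in> sets lebesgue"
      using measurable_sets[OF meas that] by simp
    then show ?thesis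
      unfolding M_def measure_distr[OF meas that]
      by (subst measure_uniform_measure[OF emK]) (simp_all add: vimage_def)
  qed
  have finM: "finite_measure M"
  proof (rule finite_measureI)
    have "emeasure M (space M) = emeasure (uniform_measure lebesgue K) UNIV"
      unfolding M_def by (subst emeasure_distr[OF meas]) simp_all
    also have "\<dots> = emeasure lebesgue (K \<inter> UNIV) / emeasure lebesgue K"
      using fmeasurableD[OF Km] by (intro emeasure_uniform_measure) auto
    also have "\<dots> = 1" using emK by (simp add: ennreal_divide_self less_top)
    finally show "emeasure M (space M) \<noteq> \<infinity>" by simp
  qed
  define F' T' where "F' = (\<lambda>y. y \<bullet> e) ` F" and "T' = (\<lambda>y. y \<bullet> e) ` T"
  have cF: "compact F'" "compact T'" unfolding F'_def T'_def
    using FT by (auto intro!: compact_continuous_image continuous_intros)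
  have FM: "vol A / vol K \<le> measure M ((\<lambda>y. y \<bullet> e) ` A)" if A: "compact A" "A \<subseteq> K" for A
  proof -
    have b: "(\<lambda>y. y \<bullet> e) ` A \<in> sets borel" using A by (intro borel_compact compact_continuous_image continuous_intros)
    have "K \<inter> {y. y \<bullet> e \<in> (\<lambda>y. y \<bullet> e) ` A} \<in> lmeasurable"
    proof (rule fmeasurable_Int_fmeasurable[OF Km])
      have "(\<lambda>y. y \<bullet> e) -` ((\<lambda>y. y \<bullet> e) ` A) \<in> sets borel"
        using measurable_sets[of "\<lambda>y. y \<bullet> e" borel borel] b by simp
      then show "{y. y \<bullet> e \<in> (\<lambda>y. y \<bullet> e) ` A} \<in> sets lebesgue" by (simp add: vimage_def)
    qed
    then have "vol A \<le> vol (K \<inter> {y. y \<bullet> e \<in> (\<lambda>y. y \<bullet> e) ` A})"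
      using A by (intro measure_mono_fmeasurable) (auto simp: lmeasurable_compact fmeasurableD)
    then show ?thesis unfolding M_meas[OF b] using pos by (intro divide_right_mono) auto
  qed
  have "\<exists>\<sigma>. measure M T' \<le> \<sigma> \<and> \<sigma> \<le> 1 - measure M F' \<and> h * iso_profile ?n \<sigma> \<le> (q - p) * (1 - measure M F' - measure M T')"
  proof (rule gap_isoperimetry[where p = p and q = q and V = V])
    show "finite_measure M" "sets M = sets borel" using finM by (auto simp: M_def)
    show "measure M {a..b} = V b - V a" if "a \<le> b" for a b
      using measure_slab(2)[OF Km e that] by (simp add: M_meas V_def diff_divide_distrib)
    show "measure M {..t} = V t" if "p \<le> t" "t \<le> q" for t
    proof -
      have "K \<inter> {y. y \<bullet> e \<le> t} = K \<inter> {y. p \<le> y \<bullet> e \<and> y \<bullet> e \<le> t}" using pq by auto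
      then show ?thesis using measure_slab(2)[OF Km e that(1)] V(2) pos by (auto simp: M_meas V_def)
    qed
    show "V t \<le> 1" for t
    proof -
      have "vol (K \<inter> {y. y \<bullet> e < t}) \<le> vol K"
        using lmeasurable_Int_halfspaces(2)[OF Km] Km by (intro measure_mono_fmeasurable) (auto simp: fmeasurableD)
      then show ?thesis using pos by (simp add: V_def)
    qed
    show "continuous_on {p..q} V" by (rule V)
    show "\<exists>\<rho>. (V has_real_derivative \<rho>) (at t) \<and> iso_profile ?n (V t) \<le> (q - p) * \<rho>" if t: "p < t" "t < q" for t
    proof -
      have Vt: "0 < V t" "V t < 1" using needle_mono[OF N, of p t] needle_mono[OF N, of t q] t V by auto
      obtain \<rho> A B where "(V has_real_derivative \<rho>) (at t)" "0 \<le> A" "0 \<le> B" "0 < A \<or> 0 < B"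
        "cone_profile ?n A B (V t) \<le> (q - p) * \<rho>"
        using needle_profile[OF N DIM_positive t] by blast
      then show ?thesis using iso_profile_le_cone_profile[OF Vt DIM_positive] by (meson order_trans)
    qed
    show "iso_profile ?n 0 = 0" by (simp add: iso_profile_def)
    show "compact F'" "compact T'" by (fact cF)+
    show "F' \<subseteq> {p..q}" "T' \<subseteq> {p..q}" using pq FT by (auto simp: F'_def T'_def)
    show "h \<le> \<bar>a - b\<bar>" if "a \<in> F'" "b \<in> T'" for a b using that h by (auto simp: F'_def T'_def)
  qed (use V h iso_profile_subadditive iso_profile_nonneg iso_profile_sym in auto)
  then obtain \<sigma> where \<sigma>: "measure M T' \<le> \<sigma>" "\<sigma> \<le> 1 - measure M F'" "h * iso_profile ?n \<sigma> \<le> (q - p) * (1 - measure M F' - measure M T')"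
    by blast
  have FT': "vol F / vol K \<le> measure M F'" "vol T / vol K \<le> measure M T'"
    unfolding F'_def T'_def using FM FT by auto
  have "(q - p) * (1 - measure M F' - measure M T') \<le> l * (1 - vol F / vol K - vol T / vol K)"
    using FT' ql V(1) \<sigma>(1,2) by (intro mult_mono) auto
  then show ?thesis using \<sigma> FT' by (intro exI[of _ \<sigma>]) auto
qed

section \<open>Bisection\<close>

lemma halfplane_inner:
  fixes c s r1 r2 :: real
  assumes cs: "c\<^sup>2 + s\<^sup>2 = 1" and ij: "i \<noteq> j"
  shows "\<exists>(e :: real^'n) b. e \<noteq> 0 \<and> (\<forall>y. c * (y $ i - r1) + s * (y $ j - r2) = e \<bullet> y - b)"
proof (intro exI conjI allI)
  let ?e = "c *\<^sub>R axis i 1 + s *\<^sub>R (axis j 1 :: real^'n)"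
  show "?e \<noteq> 0"
  proof
    assume "?e = 0"
    then have "?e $ i = 0" "?e $ j = 0" by auto
    then have "c = 0" "s = 0" using ij by (auto simp: axis_def)
    then show False using cs by simp
  qed
  show "c * (y $ i - r1) + s * (y $ j - r2) = ?e \<bullet> y - (c * r1 + s * r2)" for y
    by (simp add: inner_add_left inner_axis' algebra_simps)
qed

text \<open>Rotating by \<pi> exchanges the two half-planes through the point
  \<open>(r1, r2)\<close>. Since \<open>F\<close> has proportion \<open>x\<close> in all of
  \<open>K\<close>, the excess on one side is minus the excess on the other, so it vanishes at some
  angle.\<close>

lemma halfplane_split:
  fixes K F :: "(real^'n) set"
  assumes K: "K \<in> lmeasurable" and F: "F \<in> lmeasurable" and ij: "i \<noteq> j" and x: "vol (F \<inter> K) = x * vol K"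
  obtains c s where "c\<^sup>2 + s\<^sup>2 = (1::real)"
    "vol (F \<inter> (K \<inter> {y. 0 \<le> c * (y $ i - r1) + s * (y $ j - r2)})) = x * vol (K \<inter> {y. 0 \<le> c * (y $ i - r1) + s * (y $ j - r2)})"
    "vol (F \<inter> (K \<inter> {y. c * (y $ i - r1) + s * (y $ j - r2) \<le> 0})) = x * vol (K \<inter> {y. c * (y $ i - r1) + s * (y $ j - r2) \<le> 0})"
proof -
  define g where "g = (\<lambda>\<theta> (y::real^'n). cos \<theta> * (y $ i - r1) + sin \<theta> * (y $ j - r2))"
  have "\<exists>e b. e \<noteq> 0 \<and> (\<forall>y. g \<theta> y = e \<bullet> y - b)" for \<theta>
    unfolding g_def by (rule halfplane_inner[OF _ ij]) (use sin_cos_squared_add2[of \<theta>] in auto)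
  then obtain e b where e0: "\<And>\<theta>. e \<theta> \<noteq> 0" and g_eq: "\<And>\<theta> y. g \<theta> y = e \<theta> \<bullet> y - b \<theta>" by metis
  have neg: "negligible {y. g \<theta> y = 0}" for \<theta>
    using negligible_hyperplane[of "e \<theta>" "b \<theta>"] e0[of \<theta>] by (simp add: g_eq)
  have bor: "{y. g \<theta> y > 0} \<in> sets borel" "{y. 0 \<le> g \<theta> y} \<in> sets borel" "{y. g \<theta> y \<le> 0} \<in> sets borel" for \<theta>
    unfolding g_eq by measurable
  have FK: "F \<inter> K \<in> lmeasurable" using F K by auto
  have contA: "continuous_on UNIV (\<lambda>\<theta>. vol (A \<inter> {y. g \<theta> y > 0}))" if "A \<in> lmeasurable" for A
  proof (rule continuous_on_measure_halfspace[OF that _ neg])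
    show "continuous_on UNIV (\<lambda>\<theta>. g \<theta> y)" for y unfolding g_def by (intro continuous_intros)
    show "{y. g \<theta> y > 0} \<in> sets lebesgue" for \<theta> using bor by auto
  qed
  have closed_eq: "vol (A \<inter> {y. 0 \<le> g \<theta> y}) = vol (A \<inter> {y. g \<theta> y > 0})" if A: "A \<in> lmeasurable" for A \<theta>
  proof (rule measure_negligible_symdiff)
    show "A \<inter> {y. g \<theta> y > 0} \<in> lmeasurable" using bor by (intro fmeasurable_Int_fmeasurable[OF A]) auto
    show "negligible (A \<inter> {y. g \<theta> y > 0} - A \<inter> {y. 0 \<le> g \<theta> y} \<union> (A \<inter> {y. 0 \<le> g \<theta> y} - A \<inter> {y. g \<theta> y > 0}))"
      by (rule negligible_subset[OF neg[of \<theta>]]) auto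
  qed
  have g_pi: "g (\<theta> + pi) y = - g \<theta> y" for \<theta> y by (simp add: g_def algebra_simps)
  have split: "vol A = vol (A \<inter> {y. 0 \<le> g \<theta> y}) + vol (A \<inter> {y. g \<theta> y \<le> 0})" if A: "A \<in> lmeasurable" for A \<theta>
  proof -
    have m: "A \<inter> {y. 0 \<le> g \<theta> y} \<in> lmeasurable" "A \<inter> {y. g \<theta> y \<le> 0} \<in> lmeasurable"
      using bor by (auto intro!: fmeasurable_Int_fmeasurable[OF A])
    have "vol ((A \<inter> {y. 0 \<le> g \<theta> y}) \<union> (A \<inter> {y. g \<theta> y \<le> 0})) = vol (A \<inter> {y. 0 \<le> g \<theta> y}) + vol (A \<inter> {y. g \<theta> y \<le> 0})"
    proof (rule measure_Un_AE[OF _ m])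
      have "AE y in lebesgue. y \<notin> {y. g \<theta> y = 0}"
        using neg[of \<theta>] by (intro AE_not_in) (simp add: negligible_iff_null_sets)
      then show "AE y in lebesgue. y \<notin> A \<inter> {y. 0 \<le> g \<theta> y} \<or> y \<notin> A \<inter> {y. g \<theta> y \<le> 0}"
        by eventually_elim auto
    qed
    moreover have "(A \<inter> {y. 0 \<le> g \<theta> y}) \<union> (A \<inter> {y. g \<theta> y \<le> 0}) = A" by auto
    ultimately show ?thesis by simp
  qed
  define D where "D = (\<lambda>\<theta>. vol ((F \<inter> K) \<inter> {y. g \<theta> y > 0}) - x * vol (K \<inter> {y. g \<theta> y > 0}))"
  have "continuous_on {0..pi} D"
    unfolding D_def by (intro continuous_intros continuous_on_subset[OF contA[OF FK]] continuous_on_subset[OF contA[OF K]]) auto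
  have sum0: "D \<theta> + D (\<theta> + pi) = 0" for \<theta>
  proof -
    have "{y. 0 \<le> - g \<theta> y} = {y. g \<theta> y \<le> 0}" by auto
    then have "D (\<theta> + pi) = vol ((F \<inter> K) \<inter> {y. g \<theta> y \<le> 0}) - x * vol (K \<inter> {y. g \<theta> y \<le> 0})"
      unfolding D_def closed_eq[OF FK, symmetric] closed_eq[OF K, symmetric] g_pi by simp
    moreover have "D \<theta> = vol ((F \<inter> K) \<inter> {y. 0 \<le> g \<theta> y}) - x * vol (K \<inter> {y. 0 \<le> g \<theta> y})"
      unfolding D_def closed_eq[OF FK] closed_eq[OF K] ..
    ultimately show ?thesis using split[OF FK, of \<theta>] split[OF K, of \<theta>] x by (simp add: algebra_simps)
  qed
  have "\<exists>\<theta>. D \<theta> = 0"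
  proof (cases "D 0 \<le> 0")
    case True
    then have "0 \<le> D pi" using sum0[of 0] by simp
    then show ?thesis using IVT'[of D 0 0 pi] True \<open>continuous_on {0..pi} D\<close> by auto
  next
    case False
    then have "D pi \<le> 0" using sum0[of 0] by simp
    then show ?thesis using IVT2'[of D pi 0 0] False \<open>continuous_on {0..pi} D\<close> by auto
  qed
  then obtain \<theta> where \<theta>: "D \<theta> = 0" by blast
  have 1: "vol ((F \<inter> K) \<inter> {y. 0 \<le> g \<theta> y}) = x * vol (K \<inter> {y. 0 \<le> g \<theta> y})"
    using \<theta> unfolding D_def closed_eq[OF FK] closed_eq[OF K] by simp
  then have 2: "vol ((F \<inter> K) \<inter> {y. g \<theta> y \<le> 0}) = x * vol (K \<inter> {y. g \<theta> y \<le> 0})"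
    using split[OF FK, of \<theta>] split[OF K, of \<theta>] x by (simp add: algebra_simps)
  show thesis
    by (rule that[of "cos \<theta>" "sin \<theta>"]) (use 1 2 in \<open>simp_all add: g_def Int_assoc\<close>)
qed

text \<open>Both halves of the balanced cut keep the proportion of \<open>F\<close>; as
  \<open>T\<close> has proportion at least \<open>y\<close> on average, one half serves. If a half
  has volume 0, then \<open>T\<close> is null there as well and the other half takes over, so the
  piece always has positive volume.\<close>

lemma halfplane_bisection:
  fixes K F T :: "(real^'n) set"
  assumes K: "compact K" "convex K" "vol K > 0" and FT: "F \<in> lmeasurable" "T \<in> lmeasurable"
    and x: "vol (F \<inter> K) = x * vol K" and y: "y * vol K \<le> vol (T \<inter> K)"
    and ij: "i \<noteq> j"
  obtains c s K' where "c\<^sup>2 + s\<^sup>2 = (1::real)" "compact K'" "convex K'" "vol K' > 0" "K' \<subseteq> K"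
    "vol (F \<inter> K') = x * vol K'" "y * vol K' \<le> vol (T \<inter> K')"
    "K' \<subseteq> {y. 0 \<le> c * (y $ i - r1) + s * (y $ j - r2)}"
proof -
  have Km: "K \<in> lmeasurable" using K by (simp add: lmeasurable_compact)
  obtain c s where cs: "c\<^sup>2 + s\<^sup>2 = (1::real)" and
    h: "vol (F \<inter> (K \<inter> {y. 0 \<le> c * (y $ i - r1) + s * (y $ j - r2)})) = x * vol (K \<inter> {y. 0 \<le> c * (y $ i - r1) + s * (y $ j - r2)})"
       "vol (F \<inter> (K \<inter> {y. c * (y $ i - r1) + s * (y $ j - r2) \<le> 0})) = x * vol (K \<inter> {y. c * (y $ i - r1) + s * (y $ j - r2) \<le> 0})"
    using halfplane_split[OF Km FT(1) ij x, where ?r1.0 = r1 and ?r2.0 = r2] by blast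
  define g where "g = (\<lambda>y::real^'n. c * (y $ i - r1) + s * (y $ j - r2))"
  obtain e b where e0: "e \<noteq> 0" and g_eq: "\<And>y. g y = e \<bullet> y - b"
    using halfplane_inner[OF cs ij] unfolding g_def by blast
  define P N where "P = K \<inter> {y. 0 \<le> g y}" and "N = K \<inter> {y. g y \<le> 0}"
  have cl: "closed {y. 0 \<le> g y}" "closed {y. g y \<le> 0}"
    unfolding g_def by (auto intro!: closed_Collect_le continuous_intros)
  have "convex {y. 0 \<le> g y}" "convex {y. g y \<le> 0}"
    using convex_halfspace_ge[of b e] convex_halfspace_le[of e b] by (auto simp: g_eq)
  then have cc: "compact P" "compact N" "convex P" "convex N"
    unfolding P_def N_def using K cl by (auto intro!: compact_Int_closed convex_Int)
  have PN: "P \<union> N = K" by (auto simp: P_def N_def)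
  have "negligible {y. g y = 0}" using negligible_hyperplane[of e b] e0 by (simp add: g_eq)
  then have AE: "AE y in lebesgue. y \<notin> {y. g y = 0}" by (intro AE_not_in) (simp add: negligible_iff_null_sets)
  have add: "vol (A \<inter> K) = vol (A \<inter> P) + vol (A \<inter> N)" if A: "A \<in> lmeasurable" for A
  proof -
    have "vol ((A \<inter> P) \<union> (A \<inter> N)) = vol (A \<inter> P) + vol (A \<inter> N)"
    proof (rule measure_Un_AE)
      show "AE y in lebesgue. y \<notin> A \<inter> P \<or> y \<notin> A \<inter> N"
        using AE by eventually_elim (auto simp: P_def N_def)
      show "A \<inter> P \<in> lmeasurable" "A \<inter> N \<in> lmeasurable"
        by (intro fmeasurable.Int A lmeasurable_compact cc)+
    qed
    then show ?thesis using PN by (simp add: Int_Un_distrib[symmetric])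
  qed
  have addK: "vol K = vol P + vol N"
    using add[OF Km] PN by (simp add: Int_absorb1 P_def N_def)
  have addT: "y * (vol P + vol N) \<le> vol (T \<inter> P) + vol (T \<inter> N)" using y add[OF FT(2)] addK by simp
  have nn: "0 \<le> vol P" "0 \<le> vol N" by auto
  have T0: "vol (T \<inter> A) = 0" if "vol A = 0" "compact A" for A
  proof -
    have "vol (T \<inter> A) \<le> vol A"
      using that(2) FT(2) by (intro measure_mono_fmeasurable) (auto simp: lmeasurable_compact fmeasurableD)
    then show ?thesis using that by (simp add: order_antisym)
  qed
  have "vol P > 0 \<and> y * vol P \<le> vol (T \<inter> P) \<or> vol N > 0 \<and> y * vol N \<le> vol (T \<inter> N)"
  proof (cases "vol P = 0 \<or> vol N = 0")
    case True
    then show ?thesis using T0[of P] T0[of N] cc addT addK K(3) by auto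
  next
    case False
    then have "0 < vol P" "0 < vol N" using nn by linarith+
    then show ?thesis using addT by (auto simp: distrib_left)
  qed
  then show thesis
  proof
    assume "vol P > 0 \<and> y * vol P \<le> vol (T \<inter> P)"
    then show thesis
      using h(1) cc cs by (intro that[of c s P]) (auto simp: P_def g_def)
  next
    assume a: "vol N > 0 \<and> y * vol N \<le> vol (T \<inter> N)"
    have "N \<subseteq> {y. 0 \<le> - c * (y $ i - r1) + - s * (y $ j - r2)}" by (auto simp: N_def g_def)
    then show thesis
      using h(2) cc cs a by (intro that[of "-c" "-s" N]) (auto simp: N_def g_def)
  qed
qed

lemma open_rational_point:
  fixes O' :: "(real \<times> real) set"
  assumes "open O'" "(u, v) \<in> O'"
  obtains r1 r2 :: rat where "(of_rat r1, of_rat r2) \<in> O'"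
proof -
  obtain A B where AB: "open A" "open B" "u \<in> A" "v \<in> B" "A \<times> B \<subseteq> O'"
    using open_prod_elim[OF assms] by (metis mem_Sigma_iff)
  have "\<exists>r::rat. of_rat r \<in> A" if A: "open A" "u \<in> A" for A and u :: real
  proof -
    obtain d where d: "d > 0" "ball u d \<subseteq> A" using A open_contains_ball by metis
    obtain r :: rat where "u < of_rat r" "of_rat r < u + d" using of_rat_dense[of u "u + d"] d by auto
    then have "of_rat r \<in> ball u d" by (auto simp: dist_real_def)
    then show ?thesis using d by blast
  qed
  then show thesis using AB that by (metis mem_Sigma_iff subsetD)
qed

text \<open>A nondegenerate triangle has a rational point in its interior; no half-plane whose boundary
  passes through this point contains the triangle.\<close>

lemma collinear_if_cut_at_rationals:
  fixes a1 a2 b1 b2 p1 p2 :: real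
  assumes cut: "\<And>r1 r2 :: rat. \<exists>c s. c\<^sup>2 + s\<^sup>2 = 1 \<and>
    (\<forall>(y1, y2) \<in> {(p1, p2), (p1 + a1, p2 + a2), (p1 + b1, p2 + b2)}. 0 \<le> c * (y1 - of_rat r1) + s * (y2 - of_rat r2))"
  shows "a1 * b2 = a2 * b1"
proof (rule ccontr)
  define D where "D = a1 * b2 - a2 * b1"
  assume "a1 * b2 \<noteq> a2 * b1"
  then have D: "D \<noteq> 0" by (simp add: D_def)
  \<comment> \<open>Barycentric coordinates with respect to the triangle, by Cramer's rule;
    \<open>O'\<close> is its interior, and the centroid shows that it is nonempty.\<close>
  define \<beta> \<gamma> where "\<beta> = (\<lambda>z. ((fst z - p1) * b2 - (snd z - p2) * b1) / D)"
    and "\<gamma> = (\<lambda>z. (a1 * (snd z - p2) - a2 * (fst z - p1)) / D)"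
  define O' where "O' = {z. 0 < \<beta> z \<and> 0 < \<gamma> z \<and> \<beta> z + \<gamma> z < 1}"
  have "open O'"
    unfolding O'_def \<beta>_def \<gamma>_def by (intro open_Collect_conj open_Collect_less continuous_intros) (use D in auto)
  moreover have "(p1 + (a1 + b1) / 3, p2 + (a2 + b2) / 3) \<in> O'"
  proof -
    have eq: "(a1 + b1) / 3 * b2 - (a2 + b2) / 3 * b1 = D / 3" "a1 * ((a2 + b2) / 3) - a2 * ((a1 + b1) / 3) = D / 3"
      by (simp_all add: D_def algebra_simps diff_divide_distrib add_divide_distrib)
    have "\<beta> (p1 + (a1 + b1) / 3, p2 + (a2 + b2) / 3) = 1 / 3" "\<gamma> (p1 + (a1 + b1) / 3, p2 + (a2 + b2) / 3) = 1 / 3"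
      unfolding \<beta>_def \<gamma>_def fst_conv snd_conv add_diff_cancel_left' eq using D by simp_all
    then show ?thesis by (simp add: O'_def)
  qed
  ultimately obtain r1 r2 :: rat where r: "(of_rat r1, of_rat r2) \<in> O'" using open_rational_point by metis
  define X Y where "X = (of_rat r1 :: real)" and "Y = (of_rat r2 :: real)"
  define B C where "B = \<beta> (X, Y)" and "C = \<gamma> (X, Y)"
  have BC: "0 < B" "0 < C" "B + C < 1" using r by (auto simp: O'_def B_def C_def X_def Y_def)
  have XY: "X - p1 = B * a1 + C * b1" "Y - p2 = B * a2 + C * b2"
  proof -
    have DBC: "D * B = (X - p1) * b2 - (Y - p2) * b1" "D * C = a1 * (Y - p2) - a2 * (X - p1)"
      using D by (auto simp: B_def C_def \<beta>_def \<gamma>_def)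
    have "D * (B * a1 + C * b1) = a1 * (D * B) + b1 * (D * C)" "D * (B * a2 + C * b2) = a2 * (D * B) + b2 * (D * C)"
      by (simp_all add: algebra_simps)
    then have "D * (B * a1 + C * b1) = D * (X - p1)" "D * (B * a2 + C * b2) = D * (Y - p2)"
      unfolding DBC by (simp_all add: D_def algebra_simps)
    then show "X - p1 = B * a1 + C * b1" "Y - p2 = B * a2 + C * b2" using D by auto
  qed
  obtain c s where cs: "c\<^sup>2 + s\<^sup>2 = 1" and
    L: "0 \<le> c * (p1 - X) + s * (p2 - Y)" "0 \<le> c * (p1 + a1 - X) + s * (p2 + a2 - Y)"
       "0 \<le> c * (p1 + b1 - X) + s * (p2 + b2 - Y)"
    using cut[of r1 r2] by (auto simp: X_def Y_def)
  define L0 where "L0 = c * (p1 - X) + s * (p2 - Y)"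
  define La Lb where "La = c * a1 + s * a2" and "Lb = c * b1 + s * b2"
  have 1: "0 \<le> L0" "0 \<le> L0 + La" "0 \<le> L0 + Lb" using L by (auto simp: L0_def La_def Lb_def algebra_simps)
  have "L0 = - (c * (X - p1) + s * (Y - p2))" by (simp add: L0_def algebra_simps)
  also have "\<dots> = - (B * La + C * Lb)" unfolding XY by (simp add: La_def Lb_def algebra_simps)
  \<comment> \<open>The affine functional vanishes at the rational point, so a combination with
    positive weights of its nonnegative values at the vertices is 0. All three vanish, and
    \<open>(c, s)\<close> is orthogonal to two independent edges.\<close>
  finally have "(1 - B - C) * L0 + B * (L0 + La) + C * (L0 + Lb) = 0" by (simp add: algebra_simps)
  moreover have "0 \<le> (1 - B - C) * L0" "0 \<le> B * (L0 + La)" "0 \<le> C * (L0 + Lb)" using 1 BC by auto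
  ultimately have "(1 - B - C) * L0 = 0" "B * (L0 + La) = 0" "C * (L0 + Lb) = 0" by linarith+
  then have "La = 0" "Lb = 0" using BC by auto
  then have "c * D = 0" "s * D = 0" unfolding La_def Lb_def D_def by algebra+
  then show False using D cs by simp
qed

text \<open>Multiplying the minor identities by \<open>a $ i\<close> and summing over
  \<open>i\<close> gives
  \<open>(a \<bullet> a) *\<^sub>R b = (b \<bullet> a) *\<^sub>R a\<close>.\<close>

lemma parallel_if_minors_vanish:
  fixes a b :: "real^'n"
  assumes "\<And>i j. a $ i * b $ j = a $ j * b $ i" and a: "a \<noteq> 0"
  shows "b = (b \<bullet> (a /\<^sub>R norm a)) *\<^sub>R (a /\<^sub>R norm a)"
proof -
  have "(a \<bullet> a) *\<^sub>R b = (b \<bullet> a) *\<^sub>R a"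
  proof (rule vec_eq_iff[THEN iffD2], rule allI)
    fix j
    have "(a \<bullet> a) * b $ j = (\<Sum>i\<in>UNIV. a $ i * (a $ i * b $ j))"
      by (simp add: inner_vec_def sum_distrib_right mult.assoc)
    also have "\<dots> = (\<Sum>i\<in>UNIV. b $ i * a $ i * a $ j)"
      by (rule sum.cong) (use assms(1) in \<open>simp_all add: mult_ac\<close>)
    also have "\<dots> = (b \<bullet> a) * a $ j" by (simp add: inner_vec_def sum_distrib_right)
    finally show "((a \<bullet> a) *\<^sub>R b) $ j = ((b \<bullet> a) *\<^sub>R a) $ j" by simp
  qed
  then have "(1 / (a \<bullet> a)) *\<^sub>R ((a \<bullet> a) *\<^sub>R b) = (1 / (a \<bullet> a)) *\<^sub>R ((b \<bullet> a) *\<^sub>R a)" by simp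
  then have "b = ((b \<bullet> a) / (a \<bullet> a)) *\<^sub>R a" using a by simp
  then show ?thesis by (simp add: dot_square_norm power2_eq_square divide_inverse mult_ac)
qed

text \<open>Pairs of coordinates with a rational point of their plane are countable, and stage
  \<open>k\<close> cuts through the k-th of them. The intersection of the nested pieces projects to
  no nondegenerate triangle in any coordinate plane, so it lies on a line; by compactness a finite
  stage already lies close to that line.\<close>

lemma thin_bisection:
  fixes K F T :: "(real^'n) set"
  assumes K: "compact K" "convex K" "vol K > 0" and FT: "F \<in> lmeasurable" "T \<in> lmeasurable"
    and x: "vol (F \<inter> K) = x * vol K" and y: "y * vol K \<le> vol (T \<inter> K)"
    and d: "0 < \<delta>"
  obtains K' e where "compact K'" "convex K'" "vol K' > 0" "K' \<subseteq> K"
    "vol (F \<inter> K') = x * vol K'" "y * vol K' \<le> vol (T \<inter> K')"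
    "norm e = 1" "\<And>p q. p \<in> K' \<Longrightarrow> q \<in> K' \<Longrightarrow> norm ((p - q) - ((p - q) \<bullet> e) *\<^sub>R e) \<le> \<delta>"
proof -
  define P where "P = (\<lambda>K'. K' \<subseteq> K \<and> compact K' \<and> convex K' \<and> vol K' > 0 \<and> vol (F \<inter> K') = x * vol K' \<and> y * vol K' \<le> vol (T \<inter> K'))"
  define fl :: "nat \<Rightarrow> 'n \<times> 'n \<times> rat \<times> rat" where "fl = from_nat_into UNIV"
  have "countable (UNIV :: ('n \<times> 'n \<times> rat \<times> rat) set)"
    unfolding UNIV_Times_UNIV[symmetric] by (intro countable_SIGMA countable_finite finite countableI_type)
  then have fl: "\<exists>k. fl k = z" for z unfolding fl_def by (metis UNIV_I UNIV_not_empty from_nat_into_surj)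
  define cut where "cut = (\<lambda>k K'. case fl k of (i, j, r1, r2) \<Rightarrow> i \<noteq> j \<longrightarrow>
    (\<exists>c s. c\<^sup>2 + s\<^sup>2 = (1::real) \<and> K' \<subseteq> {y. 0 \<le> c * (y $ i - of_rat r1) + s * (y $ j - of_rat r2)}))"
  have "\<exists>Ks. \<forall>n. P (Ks n) \<and> Ks (Suc n) \<subseteq> Ks n \<and> cut n (Ks (Suc n))"
  proof (rule dependent_nat_choice[where P = "\<lambda>_. P" and Q = "\<lambda>n L L'. L' \<subseteq> L \<and> cut n L'"])
    show "\<exists>K. P K" using K x y by (auto simp: P_def)
    fix L :: "(real^'n) set" and n assume PL: "P L"
    obtain i j r1 r2 where f: "fl n = (i, j, r1, r2)" by (metis surj_pair)
    show "\<exists>K'. P K' \<and> (K' \<subseteq> L \<and> cut n K')"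
    proof (cases "i = j")
      case True
      then show ?thesis using PL f by (auto simp: cut_def)
    next
      case False
      have L: "compact L" "convex L" "vol L > 0" "vol (F \<inter> L) = x * vol L" "y * vol L \<le> vol (T \<inter> L)" "L \<subseteq> K"
        using PL by (auto simp: P_def)
      obtain c s K' where "c\<^sup>2 + s\<^sup>2 = (1::real)" "compact K'" "convex K'" "vol K' > 0" "K' \<subseteq> L"
        "vol (F \<inter> K') = x * vol K'" "y * vol K' \<le> vol (T \<inter> K')"
        "K' \<subseteq> {y. 0 \<le> c * (y $ i - of_rat r1) + s * (y $ j - of_rat r2)}"
        using halfplane_bisection[OF L(1-3) FT L(4,5) False, where ?r1.0 = "of_rat r1" and ?r2.0 = "of_rat r2"] by blast
      then show ?thesis using f L(6) by (intro exI[of _ K']) (auto simp: P_def cut_def)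
    qed
  qed
  then obtain Ks where Ks: "\<And>n. P (Ks n)" "\<And>n. Ks (Suc n) \<subseteq> Ks n" "\<And>n. cut n (Ks (Suc n))" by blast
  have dec: "Ks n \<subseteq> Ks m" if "m \<le> n" for m n
    using that Ks(2) by (rule lift_Suc_antimono_le[rotated])
  have ne: "Ks n \<noteq> {}" "compact (Ks n)" for n using Ks(1)[of n] by (auto simp: P_def)
  have "\<Inter>(range Ks) \<noteq> {}" by (rule compact_nest) (fact ne dec)+
  then obtain p where p: "p \<in> \<Inter>(range Ks)" by blast
  have minors: "(q - p) $ i * (r - p) $ j = (q - p) $ j * (r - p) $ i"
    if qr: "q \<in> \<Inter>(range Ks)" "r \<in> \<Inter>(range Ks)" for q r i j
  proof (cases "i = j")
    case False
    show ?thesis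
    proof (rule collinear_if_cut_at_rationals[where ?p1.0 = "p $ i" and ?p2.0 = "p $ j"])
      fix r1 r2 :: rat
      obtain k where k: "fl k = (i, j, r1, r2)" using fl[of "(i, j, r1, r2)"] by blast
      have "\<exists>c s. c\<^sup>2 + s\<^sup>2 = (1::real) \<and>
        Ks (Suc k) \<subseteq> {y. 0 \<le> c * (y $ i - of_rat r1) + s * (y $ j - of_rat r2)}"
        using Ks(3)[of k] False by (simp only: cut_def k prod.case simp_thms)
      then obtain c s where "c\<^sup>2 + s\<^sup>2 = (1::real)"
        "Ks (Suc k) \<subseteq> {y. 0 \<le> c * (y $ i - of_rat r1) + s * (y $ j - of_rat r2)}" by blast
      moreover have "p \<in> Ks (Suc k)" "q \<in> Ks (Suc k)" "r \<in> Ks (Suc k)" using p qr by auto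
      ultimately show "\<exists>c s. c\<^sup>2 + s\<^sup>2 = 1 \<and> (\<forall>(y1, y2) \<in> {(p $ i, p $ j), (p $ i + (q - p) $ i, p $ j + (q - p) $ j),
          (p $ i + (r - p) $ i, p $ j + (r - p) $ j)}. 0 \<le> c * (y1 - of_rat r1) + s * (y2 - of_rat r2))"
        by (intro exI[of _ c] exI[of _ s]) auto
    qed
  qed simp
  \<comment> \<open>If the intersection is a single point, every unit vector is a valid
    direction.\<close>
  have "\<exists>e. norm e = 1 \<and> (\<forall>r \<in> \<Inter>(range Ks). (r - p) = ((r - p) \<bullet> e) *\<^sub>R e)"
  proof (cases "\<Inter>(range Ks) \<subseteq> {p}")
    case True
    obtain e :: "real^'n" where "e \<in> Basis" using nonempty_Basis by blast
    then show ?thesis using True by (intro exI[of _ e]) auto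
  next
    case False
    then obtain q where q: "q \<in> \<Inter>(range Ks)" "q \<noteq> p" by blast
    then show ?thesis using minors[OF q(1)] parallel_if_minors_vanish[of "q - p"]
      by (intro exI[of _ "(q - p) /\<^sub>R norm (q - p)"]) auto
  qed
  then obtain e where e: "norm e = 1" "\<And>r. r \<in> \<Inter>(range Ks) \<Longrightarrow> (r - p) = ((r - p) \<bullet> e) *\<^sub>R e" by blast
  \<comment> \<open>Half of \<delta>, because two points of the piece are compared through
    \<open>p\<close>.\<close>
  define U where "U = {r. norm ((r - p) - ((r - p) \<bullet> e) *\<^sub>R e) < \<delta> / 2}"
  have "open U" unfolding U_def by (intro open_Collect_less continuous_intros)
  have "\<exists>n. Ks n \<subseteq> U"
  proof (rule ccontr)
    assume "\<not> ?thesis"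
    then have "Ks n - U \<noteq> {}" "compact (Ks n - U)" for n
      using \<open>open U\<close> ne(2) by (auto intro: compact_diff)
    moreover have "Ks n - U \<subseteq> Ks m - U" if "m \<le> n" for m n using dec[OF that] by blast
    ultimately have "\<Inter>(range (\<lambda>n. Ks n - U)) \<noteq> {}" by (intro compact_nest)
    then obtain r where "r \<in> (\<Inter>n. Ks n - U)" by blast
    then have r: "r \<in> \<Inter>(range Ks)" "r \<notin> U" by auto
    have "norm ((r - p) - ((r - p) \<bullet> e) *\<^sub>R e) = 0" using e(2)[OF r(1)] by simp
    then show False using r(2) d by (simp add: U_def)
  qed
  then obtain n where n: "Ks n \<subseteq> U" by blast
  have thin: "norm ((a - b) - ((a - b) \<bullet> e) *\<^sub>R e) \<le> \<delta>" if "a \<in> Ks n" "b \<in> Ks n" for a b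
  proof -
    have "(a - b) - ((a - b) \<bullet> e) *\<^sub>R e = ((a - p) - ((a - p) \<bullet> e) *\<^sub>R e) - ((b - p) - ((b - p) \<bullet> e) *\<^sub>R e)"
      by (simp add: inner_diff_left algebra_simps)
    then have "norm ((a - b) - ((a - b) \<bullet> e) *\<^sub>R e)
        \<le> norm ((a - p) - ((a - p) \<bullet> e) *\<^sub>R e) + norm ((b - p) - ((b - p) \<bullet> e) *\<^sub>R e)"
      by (metis norm_triangle_ineq4)
    moreover have "a \<in> U" "b \<in> U" using n that by auto
    ultimately show ?thesis by (simp add: U_def)
  qed
  show thesis using Ks(1)[of n] by (intro that[of "Ks n" e] e(1) thin) (auto simp: P_def)
qed

section \<open>The lower bound\<close>

context
  fixes N :: "'a::euclidean_space \<Rightarrow> real"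
  assumes N: "is_norm N"
begin

lemma is_norm_zero: "N 0 = 0" and is_norm_scale: "N (c *\<^sub>R x) = \<bar>c\<bar> * N x"
  and is_norm_triangle: "N (x + y) \<le> N x + N y" and is_norm_eq_0: "N x = 0 \<longleftrightarrow> x = 0"
  using N by (auto simp: is_norm_def)

lemma is_norm_minus: "N (- x) = N x"
  using is_norm_scale[of "-1" x] by simp

lemma is_norm_commute: "N (x - y) = N (y - x)"
  using is_norm_minus[of "x - y"] by simp

lemma is_norm_nonneg: "0 \<le> N x"
  using is_norm_triangle[of x "- x"] is_norm_minus[of x] is_norm_zero by simp

lemma is_norm_pos: "x \<noteq> 0 \<Longrightarrow> 0 < N x"
  using is_norm_nonneg[of x] is_norm_eq_0[of x] by linarith

lemma is_norm_sum: "finite A \<Longrightarrow> N (\<Sum>i\<in>A. f i) \<le> (\<Sum>i\<in>A. N (f i))"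
proof (induction A rule: finite_induct)
  case (insert i A)
  then show ?case using is_norm_triangle[of "f i" "\<Sum>i\<in>A. f i"] by simp
qed (simp add: is_norm_zero)

lemma is_norm_upper:
  obtains C where "0 < C" "\<And>x. N x \<le> C * norm x"
proof
  have nn: "0 \<le> (\<Sum>i\<in>Basis. N i)" by (intro sum_nonneg is_norm_nonneg)
  show "0 < (\<Sum>i\<in>Basis. N i) + 1" using nn by simp
  fix x
  have "N x = N (\<Sum>i\<in>Basis. (x \<bullet> i) *\<^sub>R i)" by (simp add: euclidean_representation)
  also have "\<dots> \<le> (\<Sum>i\<in>Basis. \<bar>x \<bullet> i\<bar> * N i)"
    using is_norm_sum[OF finite_Basis, of "\<lambda>i. (x \<bullet> i) *\<^sub>R i"] by (simp add: is_norm_scale)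
  also have "\<dots> \<le> (\<Sum>i\<in>Basis. norm x * N i)"
    by (intro sum_mono mult_right_mono is_norm_nonneg) (simp add: Basis_le_norm)
  also have "\<dots> = (\<Sum>i\<in>Basis. N i) * norm x" by (simp only: sum_distrib_right mult.commute[of "norm x"])
  also have "\<dots> \<le> ((\<Sum>i\<in>Basis. N i) + 1) * norm x" by (intro mult_right_mono) auto
  finally show "N x \<le> ((\<Sum>i\<in>Basis. N i) + 1) * norm x" .
qed

lemma is_norm_continuous: "continuous_on UNIV N"
proof -
  obtain C where C: "0 < C" "\<And>x. N x \<le> C * norm x" using is_norm_upper by blast
  have "\<bar>N x - N y\<bar> \<le> C * norm (x - y)" for x y
    using is_norm_triangle[of "x - y" y] is_norm_triangle[of "y - x" x] C(2)[of "x - y"] is_norm_commute[of x y]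
    by (simp add: abs_le_iff)
  then have "C-lipschitz_on UNIV N" using C(1) by (intro lipschitz_onI) (auto simp: dist_norm)
  then show ?thesis by (rule lipschitz_on_continuous_on)
qed

lemma is_norm_continuous_on: "continuous_on A f \<Longrightarrow> continuous_on A (\<lambda>x. N (f x))"
  using continuous_on_compose2[OF is_norm_continuous] by blast

lemma norm_diam_upper:
  assumes "bounded K" "p \<in> K" "q \<in> K"
  shows "N (p - q) \<le> norm_diam N K"
proof -
  obtain C where C: "0 < C" "\<And>x. N x \<le> C * norm x" using is_norm_upper by blast
  obtain B where B: "\<And>x. x \<in> K \<Longrightarrow> norm x \<le> B" using assms(1) by (auto simp: bounded_iff)
  have "N (x - y) \<le> C * (B + B)" if "x \<in> K" "y \<in> K" for x y
  proof -
    have "norm (x - y) \<le> B + B" using norm_triangle_ineq4[of x y] B[OF that(1)] B[OF that(2)] by linarith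
    then have "C * norm (x - y) \<le> C * (B + B)" using C(1) by (intro mult_left_mono) auto
    then show ?thesis using C(2)[of "x - y"] by linarith
  qed
  then have "bdd_above ((\<lambda>z. N (fst z - snd z)) ` (K \<times> K))" by (auto intro!: bdd_aboveI)
  then show ?thesis unfolding norm_diam_def using assms by (intro cSUP_upper2[of _ _ "(p, q)"]) auto
qed

end

text \<open>In a \<delta>-thin piece with direction \<open>e\<close>, \<open>N (p - q)\<close>
  differs from the height difference times \<open>N e\<close> by at most
  \<open>C * \<delta>\<close>. So separation and width in the coordinate
  \<open>y \<bullet> e\<close> are \<open>h\<close> and \<open>D\<close> up to this error, divided
  by \<open>N e\<close>; that factor cancels and \<delta> tends to 0. The value \<sigma> depends on
  the piece, hence the uniform bound \<open>m\<close> over its possible range.\<close>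

lemma two_set_isoperimetry:
  fixes K F T :: "(real^'n) set"
  assumes N: "is_norm N" and K: "compact K" "convex K" "vol K > 0"
    and FT: "compact F" "compact T" "F \<subseteq> K" "T \<subseteq> K"
    and h: "0 < h" "\<And>a b. a \<in> F \<Longrightarrow> b \<in> T \<Longrightarrow> h \<le> N (a - b)"
    and D: "\<And>p q. p \<in> K \<Longrightarrow> q \<in> K \<Longrightarrow> N (p - q) \<le> D"
    and m: "\<And>\<sigma>. vol T / vol K \<le> \<sigma> \<Longrightarrow> \<sigma> \<le> 1 - vol F / vol K \<Longrightarrow> m \<le> iso_profile CARD('n) \<sigma>"
  shows "h * m \<le> D * (1 - vol F / vol K - vol T / vol K)"
proof -
  define x y where "x = vol F / vol K" and "y = vol T / vol K"
  obtain C where C: "0 < C" "\<And>x. N x \<le> C * norm x" using is_norm_upper[OF N] by blast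
  have FTm: "F \<in> lmeasurable" "T \<in> lmeasurable" using FT by (auto simp: lmeasurable_compact)
  have xy: "vol (F \<inter> K) = x * vol K" "y * vol K \<le> vol (T \<inter> K)"
    using FT K by (auto simp: x_def y_def Int_absorb2)
  have main: "(h - C * \<delta>) * m \<le> (D + C * \<delta>) * (1 - x - y)" if d: "0 < \<delta>" "\<delta> < h / C" for \<delta>
  proof -
    have hd: "0 < h - C * \<delta>" using d C by (simp add: pos_less_divide_eq mult.commute)
    obtain K' e where K': "compact K'" "convex K'" "vol K' > 0" "K' \<subseteq> K"
      "vol (F \<inter> K') = x * vol K'" "y * vol K' \<le> vol (T \<inter> K')" and e: "norm e = 1"
      and thin: "\<And>p q. p \<in> K' \<Longrightarrow> q \<in> K' \<Longrightarrow> norm ((p - q) - ((p - q) \<bullet> e) *\<^sub>R e) \<le> \<delta>"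
      using thin_bisection[OF K FTm xy d(1)] by blast
    have e0: "e \<noteq> 0" using e by auto
    have Ne: "0 < N e" using is_norm_pos[OF N e0] .
    have dev: "\<bar>N (p - q) - \<bar>(p - q) \<bullet> e\<bar> * N e\<bar> \<le> C * \<delta>" if pq: "p \<in> K'" "q \<in> K'" for p q
    proof -
      define w where "w = (p - q) - ((p - q) \<bullet> e) *\<^sub>R e"
      have "C * norm w \<le> C * \<delta>" using thin[OF pq] C(1) by (intro mult_left_mono) (auto simp: w_def)
      then have "N w \<le> C * \<delta>" using C(2)[of w] by linarith
      moreover have "N (p - q) \<le> N (((p - q) \<bullet> e) *\<^sub>R e) + N w"
        using is_norm_triangle[OF N, of "((p - q) \<bullet> e) *\<^sub>R e" w] by (simp add: w_def)
      moreover have "N (((p - q) \<bullet> e) *\<^sub>R e) \<le> N (p - q) + N w"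
        using is_norm_triangle[OF N, of "p - q" "- w"] is_norm_minus[OF N, of w] by (simp add: w_def)
      ultimately show ?thesis by (simp add: is_norm_scale[OF N] abs_le_iff)
    qed
    have cFT: "compact (F \<inter> K')" "compact (T \<inter> K')" using FT K' by (auto intro: compact_Int)
    define h' l where "h' = (h - C * \<delta>) / N e" and "l = (D + C * \<delta>) / N e"
    have h'0: "0 < h'" using hd Ne by (simp add: h'_def)
    have "\<exists>\<sigma>. vol (T \<inter> K') / vol K' \<le> \<sigma> \<and> \<sigma> \<le> 1 - vol (F \<inter> K') / vol K' \<and>
      h' * iso_profile DIM(real^'n) \<sigma> \<le> l * (1 - vol (F \<inter> K') / vol K' - vol (T \<inter> K') / vol K')"
    proof (rule convex_body_gap_isoperimetry[OF K'(1-3) e0 cFT _ _ h'0])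
      show "h' \<le> \<bar>a \<bullet> e - b \<bullet> e\<bar>" if "a \<in> F \<inter> K'" "b \<in> T \<inter> K'" for a b
      proof -
        have "h - C * \<delta> \<le> \<bar>(a - b) \<bullet> e\<bar> * N e" using dev[of a b] h(2)[of a b] that by auto
        then show ?thesis using Ne by (simp add: h'_def pos_divide_le_eq inner_diff_left)
      qed
      show "(p - q) \<bullet> e \<le> l" if "p \<in> K'" "q \<in> K'" for p q
      proof -
        have "\<bar>(p - q) \<bullet> e\<bar> * N e \<le> D + C * \<delta>" 
        proof -
          have "N (p - q) \<le> D" using D K'(4) that by blast
          then show ?thesis using dev[OF that] by linarith
        qed
        then have "\<bar>(p - q) \<bullet> e\<bar> \<le> l" using Ne by (simp add: l_def pos_le_divide_eq)
        then show ?thesis by simp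
      qed
    qed auto
    then obtain \<sigma> where s: "vol (T \<inter> K') / vol K' \<le> \<sigma>" "\<sigma> \<le> 1 - x"
      "h' * iso_profile CARD('n) \<sigma> \<le> l * (1 - x - vol (T \<inter> K') / vol K')"
      using K'(3,5) by auto
    have yT: "y \<le> vol (T \<inter> K') / vol K'" using K'(3,6) by (simp add: pos_le_divide_eq)
    obtain p where "p \<in> K'" using K'(3) by (metis all_not_in_conv measure_empty less_irrefl)
    then have "0 \<le> D" using D[of p p] K'(4) is_norm_zero[OF N] by auto
    then have l0: "0 \<le> l" using C d Ne by (simp add: l_def)
    have "m \<le> iso_profile CARD('n) \<sigma>" using s yT by (intro m) (auto simp: x_def y_def)
    then have "h' * m \<le> h' * iso_profile CARD('n) \<sigma>" using h'0 by (intro mult_left_mono) auto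
    also have "\<dots> \<le> l * (1 - x - y)" using s(3) l0 yT by (meson diff_left_mono mult_left_mono order_trans)
    finally have "h' * m * N e \<le> l * (1 - x - y) * N e" using Ne by (intro mult_right_mono) auto
    then show ?thesis using Ne by (simp add: h'_def l_def)
  qed
  have "h * m \<le> D * (1 - x - y)"
  proof (rule tendsto_le)
    have id: "((\<lambda>\<delta>::real. \<delta>) \<longlongrightarrow> 0) (at_right 0)" by (rule tendsto_ident_at)
    show "((\<lambda>\<delta>. (h - C * \<delta>) * m) \<longlongrightarrow> h * m) (at_right 0)"
      using tendsto_mult_right[OF tendsto_diff[OF tendsto_const tendsto_mult_left[OF id]], of h C m] by simp
    show "((\<lambda>\<delta>. (D + C * \<delta>) * (1 - x - y)) \<longlongrightarrow> D * (1 - x - y)) (at_right 0)"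
      using tendsto_mult_right[OF tendsto_add[OF tendsto_const tendsto_mult_left[OF id]], of D C "1 - x - y"] by simp
    show "\<forall>\<^sub>F \<delta> in at_right 0. (h - C * \<delta>) * m \<le> (D + C * \<delta>) * (1 - x - y)"
      unfolding eventually_at_right_field using main h C by (intro exI[of _ "h / C"]) auto
  qed simp
  then show ?thesis by (simp add: x_def y_def)
qed


text \<open>The two-set inequality is applied to a compact \<open>F\<close> inside \<open>S\<close>
  of almost full measure and to \<open>T\<close>, the part of \<open>K\<close> outside the open
  \<open>h\<close>-neighbourhood \<open>U h\<close>. The closed neighbourhood in
  \<open>has_boundary_measure\<close> is handled only at continuity points of \<open>M\<close>,
  where it agrees with \<open>U h\<close> inside \<open>K\<close> up to a null set; this also
  settles its measurability there.\<close>

lemma boundary_measure_lower_bound: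
  fixes K S :: "(real^'n) set"
  assumes N: "is_norm N" and K: "convex_body K" "vol K > 0" and S: "S \<in> sets lebesgue" "S \<subseteq> K"
    and x: "0 < unif_meas K S" "unif_meas K S < 1" and L: "has_boundary_measure N K S L"
  shows "iso_profile CARD('n) (unif_meas K S) \<le> norm_diam N K * L"
proof -
  let ?I = "iso_profile CARD('n)"
  define x D where "x = unif_meas K S" and "D = norm_diam N K"
  have Kc: "compact K" "convex K" "bounded K" using K(1) by (auto simp: convex_body_def compact_eq_bounded_closed)
  have Km: "K \<in> lmeasurable" using Kc by (simp add: lmeasurable_compact)
  have Sm: "S \<in> lmeasurable" by (rule fmeasurableI2[OF Km S(2,1)])
  have SK: "S \<inter> K = S" using S by auto
  have x_eq: "x = vol S / vol K" by (simp add: x_def unif_meas_def SK)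
  have D_upper: "N (p - q) \<le> D" if "p \<in> K" "q \<in> K" for p q
    unfolding D_def by (rule norm_diam_upper[OF N Kc(3) that])
  obtain p where "p \<in> K" using K(2) by (metis all_not_in_conv measure_empty less_irrefl)
  then have D0: "0 \<le> D" using D_upper[of p p] is_norm_zero[OF N] by simp
  define U where "U = (\<lambda>h. \<Union>s\<in>S. {y. N (y - s) < h})"
  have opU: "open (U h)" for h
    unfolding U_def by (intro open_UN ballI open_Collect_less is_norm_continuous_on[OF N] continuous_on_const continuous_on_diff continuous_on_id)
  have UKm: "U h \<inter> K \<in> lmeasurable" for h
    using fmeasurable_Int_fmeasurable[OF Km, of "U h"] opU by (simp add: Int_commute borel_open)
  define M where "M = (\<lambda>h. vol (U h \<inter> K))"
  have Umono: "U h \<subseteq> U h'" if "h \<le> h'" for h h' using that by (force simp: U_def)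
  have "mono M" unfolding M_def
    using Umono UKm by (intro monoI measure_mono_fmeasurable) (auto simp: fmeasurableD)
  then have ctb: "countable {a. \<not> isCont M a}" by (rule mono_ctble_discont)
  define f where "f = (\<lambda>h. unif_meas K (norm_nbhd N S h - S))"
  have SU: "S \<subseteq> U h" if "0 < h" for h
    using that is_norm_zero[OF N] by (force simp: U_def)
  have f_eq: "f h = M h / vol K - x" if h: "0 < h" "isCont M h" for h
  proof -
    have sub: "U h \<subseteq> norm_nbhd N S h" "norm_nbhd N S h \<subseteq> U h'" if "h < h'" for h'
      using that by (force simp: U_def norm_nbhd_def)+
    have "negligible (norm_nbhd N S h \<inter> K - U h)"
      unfolding negligible_outer
    proof (intro allI impI)
      fix e :: real assume "0 < e"
      then obtain d where d: "0 < d" "\<And>h'. \<bar>h' - h\<bar> < d \<Longrightarrow> \<bar>M h' - M h\<bar> < e"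
        using h(2) unfolding isCont_def LIM_eq by (metis abs_zero diff_self real_norm_def)
      define h' where "h' = h + d / 2"
      have h': "h < h'" "\<bar>h' - h\<bar> < d" using d by (auto simp: h'_def)
      have "vol (U h' \<inter> K - U h \<inter> K) = M h' - M h"
        unfolding M_def using UKm Umono[of h h'] h' by (intro measurable_measure_Diff) (auto simp: fmeasurableD)
      then have "vol (U h' \<inter> K - U h \<inter> K) < e" using d(2)[OF h'(2)] by linarith
      moreover have "norm_nbhd N S h \<inter> K - U h \<subseteq> U h' \<inter> K - U h \<inter> K" using sub(2)[OF h'(1)] by blast
      ultimately show "\<exists>T. norm_nbhd N S h \<inter> K - U h \<subseteq> T \<and> T \<in> lmeasurable \<and> vol T < e"
        using UKm by blast
    qed
    moreover have "U h \<subseteq> norm_nbhd N S h" using sub(1)[of "h + 1"] by simp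
    ultimately have "vol ((norm_nbhd N S h - S) \<inter> K) = vol (U h \<inter> K - S)"
      using UKm Sm by (intro measure_negligible_symdiff) (auto intro!: negligible_subset[of "norm_nbhd N S h \<inter> K - U h"])
    also have "\<dots> = M h - vol S"
      unfolding M_def using UKm Sm SU[OF h(1)] S by (intro measurable_measure_Diff) (auto simp: fmeasurableD)
    finally show ?thesis unfolding f_def unif_meas_def x_eq by (simp add: diff_divide_distrib)
  qed
  have fL: "((\<lambda>h. f h / h) \<longlongrightarrow> L) (at_right 0)" using L by (simp add: has_boundary_measure_def f_def)
  have id: "((\<lambda>h::real. h) \<longlongrightarrow> 0) (at_right 0)" by (rule tendsto_ident_at)
  \<comment> \<open>A finite boundary measure forces the added mass to vanish with \<open>h\<close>,
    so the range of \<sigma> shrinks to \<open>1 - x\<close>.\<close>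
  have "((\<lambda>h. f h / h * h) \<longlongrightarrow> L * 0) (at_right 0)" by (intro tendsto_mult fL id)
  moreover have "\<forall>\<^sub>F h in at_right 0. f h / h * h = f h"
    by (auto simp: eventually_at_right_field intro: exI[of _ 1])
  ultimately have f0: "(f \<longlongrightarrow> 0) (at_right 0)" by (simp add: tendsto_cong)
  have key: "h * m \<le> D * f h"
    if h: "0 < h" "isCont M h" and d: "0 < d" "f h < d"
      and m: "\<And>\<sigma>. \<bar>\<sigma> - (1 - x)\<bar> < d \<Longrightarrow> m \<le> ?I \<sigma>" for h m d
  proof (rule tendsto_lowerbound)
    show "((\<lambda>\<eta>. D * (f h + \<eta>)) \<longlongrightarrow> D * f h) (at_right 0)"
      using tendsto_mult_left[OF tendsto_add[OF tendsto_const id], of D "f h"] by simp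
    have "h * m \<le> D * (f h + \<eta>)" if \<eta>: "0 < \<eta>" "\<eta> < d" for \<eta>
    proof -
      obtain F where F: "closed F" "F \<subseteq> S" "S - F \<in> lmeasurable" "emeasure lebesgue (S - F) < ennreal (\<eta> * vol K)"
        using sets_lebesgue_inner_closed[OF S(1), of "\<eta> * vol K"] \<eta> K(2) by auto
      have cF: "compact F" using F(1,2) S(2) Kc(3) by (meson bounded_subset compact_eq_bounded_closed)
      have Fm: "F \<in> lmeasurable" using cF by (simp add: lmeasurable_compact)
      have "vol (S - F) < \<eta> * vol K"
        using F(3,4) by (simp add: emeasure_eq_measure2 ennreal_less_iff)
      moreover have "vol (S - F) = vol S - vol F"
        using F(2) Sm Fm by (intro measurable_measure_Diff) (auto simp: fmeasurableD)
      ultimately have "(vol S - vol F) / vol K < \<eta>" using K(2) by (simp add: pos_divide_less_eq)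
      then have muF: "x - \<eta> < vol F / vol K" by (simp add: x_eq diff_divide_distrib)
      have "vol F \<le> vol S" using F(2) Sm Fm by (intro measure_mono_fmeasurable) (auto simp: fmeasurableD)
      define T where "T = K - U h"
      have cT: "compact T" unfolding T_def using Kc opU by (intro compact_diff)
      have "vol (K - U h \<inter> K) = vol K - M h"
        unfolding M_def using UKm Km by (intro measurable_measure_Diff) (auto simp: fmeasurableD)
      moreover have "K - U h \<inter> K = T" by (auto simp: T_def)
      ultimately have muT: "vol T / vol K = 1 - x - f h"
        using f_eq[OF h] K(2) by (simp add: diff_divide_distrib)
      have "h * m \<le> D * (1 - vol F / vol K - vol T / vol K)"
      proof (rule two_set_isoperimetry[OF N Kc(1,2) K(2) cF cT _ _ h(1)])
        show "h \<le> N (a - b)" if "a \<in> F" "b \<in> T" for a b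
          using that F(2) is_norm_commute[OF N, of a b] by (force simp: T_def U_def)
        show "m \<le> ?I \<sigma>" if "vol T / vol K \<le> \<sigma>" "\<sigma> \<le> 1 - vol F / vol K" for \<sigma>
          using that muT muF d(2) \<eta> by (intro m) (auto simp: abs_less_iff)
      qed (use F S D_upper in \<open>auto simp: T_def\<close>)
      also have "\<dots> \<le> D * (f h + \<eta>)" using muF muT D0 by (intro mult_left_mono) auto
      finally show ?thesis .
    qed
    then show "\<forall>\<^sub>F \<eta> in at_right 0. h * m \<le> D * (f h + \<eta>)"
      using d by (auto simp: eventually_at_right_field intro!: exI[of _ d])
  qed simp
  have "?I x - e \<le> D * L" if e: "0 < e" for e
  proof (rule ccontr)
    assume neg: "\<not> ?I x - e \<le> D * L"
    have x1: "0 < 1 - x" "1 - x < 1" using x by (auto simp: x_def)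
    obtain d where d: "0 < d" "\<And>y. \<bar>y - (1 - x)\<bar> < d \<Longrightarrow> ?I (1 - x) - e < ?I y"
      using iso_profile_lower_semicontinuous[OF _ x1 e, of "CARD('n)"] by auto
    have "\<forall>\<^sub>F h in at_right 0. D * (f h / h) < ?I x - e"
      using neg by (intro order_tendstoD(2)[OF tendsto_mult_left[OF fL]]) auto
    moreover have "\<forall>\<^sub>F h in at_right 0. f h < d" by (rule order_tendstoD(2)[OF f0 d(1)])
    ultimately have "\<forall>\<^sub>F h in at_right 0. D * (f h / h) < ?I x - e \<and> f h < d" by eventually_elim auto
    then obtain b where b: "0 < b" "\<And>h. 0 < h \<Longrightarrow> h < b \<Longrightarrow> D * (f h / h) < ?I x - e \<and> f h < d"
      by (auto simp: eventually_at_right_field)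
    \<comment> \<open>A monotone function has countably many discontinuities, so continuity points
      exist arbitrarily close to 0.\<close>
    obtain h where h: "h \<in> {0<..<b}" "h \<notin> {a. \<not> isCont M a}"
      using open_minus_countable[OF ctb, of "{0<..<b}"] b(1) by auto
    have "h * (?I x - e) \<le> D * f h"
    proof (rule key)
      show "?I x - e \<le> ?I \<sigma>" if "\<bar>\<sigma> - (1 - x)\<bar> < d" for \<sigma>
        using d(2)[OF that] iso_profile_sym[of "CARD('n)" x] by simp
    qed (use h b d in auto)
    then have "?I x - e \<le> D * (f h / h)" using h by (simp add: field_simps)
    then show False using b(2)[of h] h by auto
  qed
  then show ?thesis unfolding x_def D_def by (meson field_le_epsilon diff_le_eq)
qed

section \<open>Sharpness\<close>

text \<open>The open unit ball is separated from a vector of norm 1 by a hyperplane; scaling its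
  normal to the value 1 at \<open>v\<close> gives a functional of dual norm 1 attained at
  \<open>v\<close>.\<close>

lemma support_functional:
  fixes N :: "'a::euclidean_space \<Rightarrow> real"
  assumes N: "is_norm N"
  obtains v w where "N v = 1" "v \<bullet> w = 1" "\<And>y. y \<bullet> w \<le> N y"
proof -
  obtain i :: 'a where i: "i \<in> Basis" using nonempty_Basis by blast
  define v where "v = i /\<^sub>R N i"
  have "0 < N i" using is_norm_pos[OF N nonzero_Basis[OF i]] .
  then have v: "N v = 1" by (simp add: v_def is_norm_scale[OF N])
  define B where "B = {y. N y < 1}"
  have "convex B"
  proof (rule convexI)
    fix x y u t :: real and a b assume ab: "a \<in> B" "b \<in> B" and ut: "0 \<le> u" "0 \<le> t" "u + t = 1"
    have "N (u *\<^sub>R a + t *\<^sub>R b) \<le> u * N a + t * N b"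
      using is_norm_triangle[OF N, of "u *\<^sub>R a" "t *\<^sub>R b"] ut by (simp add: is_norm_scale[OF N])
    also have "\<dots> < 1" using convex_bound_lt[of "N a" 1 "N b" u t] ab ut by (simp add: B_def)
    finally show "u *\<^sub>R a + t *\<^sub>R b \<in> B" by (simp add: B_def)
  qed
  moreover have "B \<noteq> {}" using is_norm_zero[OF N] by (auto simp: B_def intro!: exI[of _ 0])
  moreover have "B \<inter> {v} = {}" using v by (auto simp: B_def)
  ultimately obtain a b where ab: "a \<noteq> 0" "\<forall>x\<in>B. a \<bullet> x \<le> b" "\<forall>x\<in>{v}. a \<bullet> x \<ge> b"
    using separating_hyperplane_sets[of B "{v}"] by auto
  have le: "a \<bullet> y \<le> a \<bullet> v" if "N y < 1" for y
  proof -
    have "a \<bullet> y \<le> b" using ab(2) that by (simp add: B_def)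
    also have "b \<le> a \<bullet> v" using ab(3) by simp
    finally show ?thesis .
  qed
  have Na: "0 < N a" using is_norm_pos[OF N ab(1)] .
  \<comment> \<open>A small multiple of the normal lies in the unit ball and has positive value,
    which makes the normalisation by \<open>a \<bullet> v\<close> possible.\<close>
  have "0 < a \<bullet> ((1 / (2 * N a)) *\<^sub>R a)" using ab(1) Na by simp
  also have "\<dots> \<le> a \<bullet> v" using Na by (intro le) (simp add: is_norm_scale[OF N])
  finally have av: "0 < a \<bullet> v" .
  define w where "w = a /\<^sub>R (a \<bullet> v)"
  show thesis
  proof (rule that[OF v])
    show "v \<bullet> w = 1" using av by (simp add: w_def inner_commute)
    fix y
    show "y \<bullet> w \<le> N y"
    proof (rule ccontr)
      assume "\<not> y \<bullet> w \<le> N y"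
      then obtain c where c: "N y < c" "c < y \<bullet> w" using dense not_le by metis
      have c0: "0 < c" using c(1) is_norm_nonneg[OF N, of y] by linarith
      have "a \<bullet> (y /\<^sub>R c) \<le> a \<bullet> v" using c(1) c0 by (intro le) (simp add: is_norm_scale[OF N] field_simps)
      then have "a \<bullet> y \<le> c * (a \<bullet> v)" using c0 by (simp add: field_simps)
      then have "y \<bullet> w \<le> c" using av by (simp add: w_def inner_commute field_simps)
      then show False using c by simp
    qed
  qed
qed

text \<open>Height is measured by \<open>w\<close> rather than by the norm, and the cross-section at
  height \<open>s\<close> is a Euclidean ball of radius \<open>\<rho> * s\<close> about
  \<open>s *\<^sub>R v\<close> in that hyperplane. Thus caps are homothetic, and the slab between
  heights 1 and \<open>r\<close> is a truncated cone whose ends have ratio \<open>r\<close> for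
  every \<rho>.\<close>

definition thin_cone :: "'a::euclidean_space \<Rightarrow> 'a \<Rightarrow> real \<Rightarrow> 'a set" where
  "thin_cone v w \<rho> = {y. norm (y - (y \<bullet> w) *\<^sub>R v) \<le> \<rho> * (y \<bullet> w)}"

abbreviation cone_cap :: "'a::euclidean_space \<Rightarrow> 'a \<Rightarrow> real \<Rightarrow> real \<Rightarrow> 'a set" where
  "cone_cap v w \<rho> b \<equiv> thin_cone v w \<rho> \<inter> {y. y \<bullet> w \<le> b}"

abbreviation cone_slab :: "'a::euclidean_space \<Rightarrow> 'a \<Rightarrow> real \<Rightarrow> real \<Rightarrow> real \<Rightarrow> 'a set" where
  "cone_slab v w \<rho> a b \<equiv> thin_cone v w \<rho> \<inter> {y. a \<le> y \<bullet> w \<and> y \<bullet> w \<le> b}"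

context
  fixes v w :: "'a::euclidean_space" and \<rho> :: real
  assumes vw: "v \<bullet> w = 1" and rho: "0 < \<rho>"
begin

lemma thin_cone_nonneg: "y \<in> thin_cone v w \<rho> \<Longrightarrow> 0 \<le> y \<bullet> w"
proof -
  assume "y \<in> thin_cone v w \<rho>"
  then have "0 \<le> \<rho> * (y \<bullet> w)" unfolding thin_cone_def mem_Collect_eq by (rule order_trans[OF norm_ge_zero])
  then show ?thesis using rho by (simp add: zero_le_mult_iff)
qed

lemma closed_thin_cone: "closed (thin_cone v w \<rho>)"
  unfolding thin_cone_def by (intro closed_Collect_le continuous_intros)

lemma thin_cone_scale: "y \<in> thin_cone v w \<rho> \<Longrightarrow> 0 \<le> c \<Longrightarrow> c *\<^sub>R y \<in> thin_cone v w \<rho>"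
proof -
  assume y: "y \<in> thin_cone v w \<rho>" and c: "0 \<le> c"
  have "c *\<^sub>R y - (c *\<^sub>R y \<bullet> w) *\<^sub>R v = c *\<^sub>R (y - (y \<bullet> w) *\<^sub>R v)" by (simp add: algebra_simps)
  then have "norm (c *\<^sub>R y - (c *\<^sub>R y \<bullet> w) *\<^sub>R v) = c * norm (y - (y \<bullet> w) *\<^sub>R v)" using c by simp
  also have "\<dots> \<le> c * (\<rho> * (y \<bullet> w))" using y c by (intro mult_left_mono) (auto simp: thin_cone_def)
  finally show ?thesis by (simp add: thin_cone_def mult_ac)
qed

lemma thin_cone_add: "y \<in> thin_cone v w \<rho> \<Longrightarrow> z \<in> thin_cone v w \<rho> \<Longrightarrow> y + z \<in> thin_cone v w \<rho>"
proof -
  assume y: "y \<in> thin_cone v w \<rho>" and z: "z \<in> thin_cone v w \<rho>"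
  have "(y + z) - ((y + z) \<bullet> w) *\<^sub>R v = (y - (y \<bullet> w) *\<^sub>R v) + (z - (z \<bullet> w) *\<^sub>R v)"
    by (simp add: inner_add_left algebra_simps)
  then have "norm ((y + z) - ((y + z) \<bullet> w) *\<^sub>R v) \<le> norm (y - (y \<bullet> w) *\<^sub>R v) + norm (z - (z \<bullet> w) *\<^sub>R v)"
    by (metis norm_triangle_ineq)
  then show ?thesis using y z by (simp add: thin_cone_def inner_add_left distrib_left)
qed

lemma convex_thin_cone: "convex (thin_cone v w \<rho>)"
  by (intro convexI thin_cone_add thin_cone_scale)

lemma bounded_thin_cone: "bounded (cone_cap v w \<rho> b)"
proof (rule boundedI)
  fix y assume y: "y \<in> cone_cap v w \<rho> b"
  then have yw: "0 \<le> y \<bullet> w" "y \<bullet> w \<le> b" using thin_cone_nonneg by auto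
  have "norm y \<le> norm (y - (y \<bullet> w) *\<^sub>R v) + norm ((y \<bullet> w) *\<^sub>R v)"
    using norm_triangle_ineq[of "y - (y \<bullet> w) *\<^sub>R v" "(y \<bullet> w) *\<^sub>R v"] by simp
  also have "\<dots> \<le> \<rho> * (y \<bullet> w) + (y \<bullet> w) * norm v" using y yw by (simp add: thin_cone_def)
  also have "\<dots> \<le> \<rho> * b + b * norm v" using yw rho by (intro add_mono mult_left_mono mult_right_mono) auto
  finally show "norm y \<le> \<rho> * b + b * norm v" .
qed

lemma compact_thin_cone_le: "compact (cone_cap v w \<rho> b)"
proof -
  have "closed {y::'a. y \<bullet> w \<le> b}" by (intro closed_Collect_le continuous_intros)
  then show ?thesis using bounded_thin_cone closed_thin_cone by (simp add: compact_eq_bounded_closed closed_Int)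
qed

lemma measure_thin_cone_le:
  assumes "0 \<le> b"
  shows "vol (cone_cap v w \<rho> b)
       = b ^ DIM('a) * vol (cone_cap v w \<rho> 1)"
proof (cases "b = 0")
  case True
  have "cone_cap v w \<rho> 0 \<subseteq> {y. w \<bullet> y = 0}"
    using thin_cone_nonneg by (force simp: inner_commute)
  moreover have "w \<noteq> 0" using vw by auto
  ultimately have "negligible (cone_cap v w \<rho> 0)"
    using negligible_hyperplane[of w 0] negligible_subset by blast
  then show ?thesis using True by (simp add: negligible_imp_measure0)
next
  case False
  then have b: "0 < b" using assms by simp
  have "cone_cap v w \<rho> b = (\<lambda>y. b *\<^sub>R y) ` (cone_cap v w \<rho> 1)" (is "?L = ?R")
  proof
    show "?R \<subseteq> ?L" using b by (auto intro!: thin_cone_scale)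
    show "?L \<subseteq> ?R"
    proof
      fix y assume "y \<in> ?L"
      then have "(1 / b) *\<^sub>R y \<in> cone_cap v w \<rho> 1" using b by (auto intro!: thin_cone_scale)
      then show "y \<in> ?R" using b by (intro image_eqI[of _ _ "(1 / b) *\<^sub>R y"]) auto
    qed
  qed
  then show ?thesis
    using measure_lebesgue_affine[of b 0 "cone_cap v w \<rho> 1"] b by simp
qed

lemma measure_thin_cone_pos: "0 < vol (cone_cap v w \<rho> 1)"
proof -
  define O' where "O' = {y. norm (y - (y \<bullet> w) *\<^sub>R v) < \<rho> * (y \<bullet> w) \<and> y \<bullet> w < 1}"
  have "open O'" unfolding O'_def by (intro open_Collect_conj open_Collect_less continuous_intros)
  have sub: "O' \<subseteq> cone_cap v w \<rho> 1" by (auto simp: O'_def thin_cone_def)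
  have "(1 / 2) *\<^sub>R v \<in> O'" using vw rho by (simp add: O'_def)
  then have "0 < vol O'"
    using bounded_subset[OF bounded_thin_cone sub] \<open>open O'\<close> by (intro open_measure_pos) auto
  also have "\<dots> \<le> vol (cone_cap v w \<rho> 1)"
    using sub \<open>open O'\<close> compact_thin_cone_le by (intro measure_mono_fmeasurable) (auto simp: lmeasurable_compact borel_open)
  finally show ?thesis .
qed

lemma lmeasurable_thin_cone_slab: "thin_cone v w \<rho> \<inter> {y. a < y \<bullet> w \<and> y \<bullet> w \<le> b} \<in> lmeasurable"
proof -
  have "(cone_cap v w \<rho> b) \<inter> {y. a < y \<bullet> w} \<in> lmeasurable"
    by (intro lmeasurable_Int_halfspaces lmeasurable_compact compact_thin_cone_le)
  then show ?thesis by (simp add: Collect_conj_eq Int_ac)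
qed

lemma measure_thin_cone_slab:
  assumes ab: "0 \<le> a" "a \<le> b"
  shows "vol (thin_cone v w \<rho> \<inter> {y. a < y \<bullet> w \<and> y \<bullet> w \<le> b})
       = (b ^ DIM('a) - a ^ DIM('a)) * vol (cone_cap v w \<rho> 1)" (is ?A)
    and "vol (cone_slab v w \<rho> a b)
       = (b ^ DIM('a) - a ^ DIM('a)) * vol (cone_cap v w \<rho> 1)"
proof -
  let ?C = "\<lambda>b. cone_cap v w \<rho> b"
  have "thin_cone v w \<rho> \<inter> {y. a < y \<bullet> w \<and> y \<bullet> w \<le> b} = ?C b - ?C a" by auto
  moreover have "vol (?C b - ?C a) = vol (?C b) - vol (?C a)"
    using ab compact_thin_cone_le by (intro measurable_measure_Diff) (auto simp: lmeasurable_compact fmeasurableD)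
  ultimately show A: ?A
    using ab measure_thin_cone_le[of a] measure_thin_cone_le[of b] by (simp add: left_diff_distrib)
  have "vol (cone_slab v w \<rho> a b)
      = vol (thin_cone v w \<rho> \<inter> {y. a < y \<bullet> w \<and> y \<bullet> w \<le> b})"
  proof (rule measure_negligible_symdiff[OF lmeasurable_thin_cone_slab])
    have "w \<noteq> 0" using vw by auto
    then show "negligible (thin_cone v w \<rho> \<inter> {y. a < y \<bullet> w \<and> y \<bullet> w \<le> b} - cone_slab v w \<rho> a b \<union>
     (cone_slab v w \<rho> a b - thin_cone v w \<rho> \<inter> {y. a < y \<bullet> w \<and> y \<bullet> w \<le> b}))"
      by (intro negligible_subset[OF negligible_hyperplane[of w a]]) (auto simp: inner_commute)
  qed
  then show "vol (cone_slab v w \<rho> a b)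
       = (b ^ DIM('a) - a ^ DIM('a)) * vol (cone_cap v w \<rho> 1)" using A by simp
qed

lemma compact_thin_cone_slab: "compact (cone_slab v w \<rho> a b)"
proof -
  have "closed {y::'a. a \<le> y \<bullet> w}" by (intro closed_Collect_le continuous_intros)
  then have "compact ((cone_cap v w \<rho> b) \<inter> {y. a \<le> y \<bullet> w})"
    using compact_thin_cone_le compact_Int_closed by blast
  then show ?thesis by (simp add: Collect_conj_eq Int_ac)
qed

lemma convex_thin_cone_slab: "convex (cone_slab v w \<rho> a b)"
proof -
  have "{y::'a. a \<le> y \<bullet> w \<and> y \<bullet> w \<le> b} = {y. w \<bullet> y \<ge> a} \<inter> {y. w \<bullet> y \<le> b}" by (auto simp: inner_commute)
  then show ?thesis by (simp add: convex_Int convex_thin_cone convex_halfspace_le convex_halfspace_ge)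
qed

text \<open>The homothety with centre \<open>t v\<close> and ratio \<open>t / (t + h)\<close> moves the layer \<open>t < y \<bullet> w \<le> t + h\<close>
  of the cone into the part of that layer which projects along \<open>v\<close> into the slice \<open>y \<bullet> w = t\<close>.\<close>

lemma thin_cone_layer:
  fixes N :: "'a \<Rightarrow> real"
  assumes N: "is_norm N" and v: "N v = 1" and wN: "\<And>y. y \<bullet> w \<le> N y"
    and t: "1 \<le> t" "0 < h" "t + h \<le> r"
  defines "K \<equiv> cone_slab v w \<rho> 1 r"
    and "S \<equiv> cone_slab v w \<rho> 1 t"
    and "c \<equiv> vol (cone_cap v w \<rho> 1)"
  shows "vol ((norm_nbhd N S h - S) \<inter> K) \<le> ((t + h) ^ DIM('a) - t ^ DIM('a)) * c"
    and "(t / (t + h)) ^ DIM('a) * (((t + h) ^ DIM('a) - t ^ DIM('a)) * c) \<le> vol ((norm_nbhd N S h - S) \<inter> K)"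
proof -
  let ?W = "thin_cone v w \<rho> \<inter> {y. t < y \<bullet> w \<and> y \<bullet> w \<le> t + h}"
  have cS: "compact S" and cK: "compact K" unfolding S_def K_def by (rule compact_thin_cone_slab)+
  have "norm_nbhd N S h = sumset S {y. N y \<le> h}"
  proof (rule set_eqI)
    fix y
    have "y \<in> sumset S {y. N y \<le> h}" if "s \<in> S" "N (y - s) \<le> h" for s
      using that by (auto simp: sumset_iff intro!: bexI[of _ s] exI[of _ "y - s"])
    moreover have "\<exists>s\<in>S. N (y - s) \<le> h" if "s \<in> S" "N z \<le> h" "y = s + z" for s z
      using that by (intro bexI[of _ s]) simp_all
    ultimately show "y \<in> norm_nbhd N S h \<longleftrightarrow> y \<in> sumset S {y. N y \<le> h}"
      unfolding norm_nbhd_def by (auto simp only: sumset_iff mem_Collect_eq)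
  qed
  moreover have "closed {y. N y \<le> h}"
    by (intro closed_Collect_le is_norm_continuous[OF N] continuous_on_const)
  ultimately have "closed (norm_nbhd N S h)" using compact_closed_sums[OF cS] by (simp add: sumset_def)
  then have Am: "(norm_nbhd N S h - S) \<inter> K \<in> lmeasurable"
    using fmeasurable_Int_fmeasurable[OF lmeasurable_compact[OF cK], of "norm_nbhd N S h - S"] compact_imp_closed[OF cS]
    by (simp add: Int_commute sets.Diff borel_closed)
  have Wm: "?W \<in> lmeasurable" by (rule lmeasurable_thin_cone_slab)
  have mW: "vol ?W = ((t + h) ^ DIM('a) - t ^ DIM('a)) * c"
    unfolding c_def using t by (intro measure_thin_cone_slab) auto
  have "(norm_nbhd N S h - S) \<inter> K \<subseteq> ?W"
  proof
    fix y assume y: "y \<in> (norm_nbhd N S h - S) \<inter> K"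
    then obtain s where s: "s \<in> S" "N (y - s) \<le> h" by (auto simp: norm_nbhd_def)
    \<comment> \<open>As \<open>w\<close> is dominated by \<open>N\<close>, a step of norm at most
      \<open>h\<close> raises the height by at most \<open>h\<close>.\<close>
    have "(y - s) \<bullet> w \<le> h" using wN[of "y - s"] s(2) by linarith
    then show "y \<in> ?W" using y s(1) by (auto simp: S_def K_def inner_diff_left)
  qed
  then have "vol ((norm_nbhd N S h - S) \<inter> K) \<le> vol ?W"
    using Am Wm by (intro measure_mono_fmeasurable) (auto simp: fmeasurableD)
  then show "vol ((norm_nbhd N S h - S) \<inter> K) \<le> ((t + h) ^ DIM('a) - t ^ DIM('a)) * c" using mW by simp
  define l where "l = t / (t + h)"
  have l: "0 < l" "l \<le> 1" "l * (t + h) = t" using t by (auto simp: l_def)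
  define H where "H = (\<lambda>y. l *\<^sub>R y + ((1 - l) * t) *\<^sub>R v)"
  have "H ` ?W \<subseteq> (norm_nbhd N S h - S) \<inter> K"
  proof
    fix z assume "z \<in> H ` ?W"
    then obtain y where y: "y \<in> ?W" "z = H y" by blast
    have zw: "z \<bullet> w = t + l * (y \<bullet> w - t)" using vw by (simp add: y H_def inner_add_left algebra_simps)
    have yt: "0 < y \<bullet> w - t" "y \<bullet> w - t \<le> h" using y(1) by auto
    have "0 < l * (y \<bullet> w - t)" "l * (y \<bullet> w - t) \<le> h"
      using l yt by (auto intro: order_trans[OF mult_left_le_one_le])
    then have zt: "t < z \<bullet> w" "z \<bullet> w \<le> t + h" using zw by auto
    have "z - (z \<bullet> w) *\<^sub>R v = l *\<^sub>R (y - (y \<bullet> w) *\<^sub>R v)"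
      unfolding zw by (simp add: y H_def algebra_simps)
    then have "norm (z - (z \<bullet> w) *\<^sub>R v) = l * norm (y - (y \<bullet> w) *\<^sub>R v)" using l by simp
    also have "\<dots> \<le> l * (\<rho> * (y \<bullet> w))" using y(1) l by (intro mult_left_mono) (auto simp: thin_cone_def)
    also have "\<dots> \<le> l * (\<rho> * (t + h))" using y(1) l rho by (intro mult_left_mono) auto
    also have "\<dots> = \<rho> * t" using l(3) by (simp add: mult.left_commute)
    finally have nz: "norm (z - (z \<bullet> w) *\<^sub>R v) \<le> \<rho> * t" .
    moreover have "\<rho> * t \<le> \<rho> * (z \<bullet> w)" using zt rho by (intro mult_left_mono) auto
    ultimately have zC: "z \<in> thin_cone v w \<rho>" by (simp add: thin_cone_def)
    \<comment> \<open>Moving down along \<open>v\<close> reaches height \<open>t\<close> at norm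
      distance exactly the height difference, since \<open>N v = 1\<close>; the shrunken
      cross-section keeps the foot inside the cone.\<close>
    define s where "s = z - (z \<bullet> w - t) *\<^sub>R v"
    have sw: "s \<bullet> w = t" using vw by (simp add: s_def inner_diff_left)
    have "s - (s \<bullet> w) *\<^sub>R v = z - (z \<bullet> w) *\<^sub>R v" unfolding sw by (simp add: s_def algebra_simps)
    then have "s \<in> S" using nz sw t by (simp add: S_def thin_cone_def)
    moreover have "N (z - s) \<le> h" using zt v by (simp add: s_def is_norm_scale[OF N])
    ultimately show "z \<in> (norm_nbhd N S h - S) \<inter> K"
      using zC zt t by (auto simp: norm_nbhd_def S_def K_def)
  qed
  moreover have "vol (H ` ?W) = l ^ DIM('a) * vol ?W"
    unfolding H_def using l measure_lebesgue_affine[of l "((1 - l) * t) *\<^sub>R v" ?W] by simp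
  moreover have "vol (H ` ?W) \<le> vol ((norm_nbhd N S h - S) \<inter> K)" if "H ` ?W \<subseteq> (norm_nbhd N S h - S) \<inter> K"
  proof (cases "H ` ?W \<in> sets lebesgue")
    case True
    then show ?thesis using that Am by (intro measure_mono_fmeasurable)
  qed (simp add: measure_notin_sets)
  ultimately have "l ^ DIM('a) * vol ?W \<le> vol ((norm_nbhd N S h - S) \<inter> K)" by simp
  then show "(t / (t + h)) ^ DIM('a) * (((t + h) ^ DIM('a) - t ^ DIM('a)) * c) \<le> vol ((norm_nbhd N S h - S) \<inter> K)"
    using mW by (simp add: l_def)
qed

end

lemma isCont_cone_profile:
  assumes "0 < n" "0 < r"
  shows "isCont (\<lambda>r. cone_profile n 1 r x) r"
proof -
  have "0 < psum n r" using assms unfolding psum_def by (intro sum_pos) (auto simp: lessThan_empty_iff bot_nat_def)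
  moreover have "isCont (psum n) r" using psum_has_derivative DERIV_isCont by blast
  ultimately show ?thesis unfolding cone_profile_one by (intro continuous_intros) auto
qed

text \<open>The level \<open>t\<close> gives the lower part of the truncated cone the proportion
  \<open>x\<close>, and \<open>(r - 1) * L\<close> is its profile there. Volume proportions do not
  depend on \<rho>, so thinness can be chosen last; it only has to bring the diameter close to the
  height \<open>r - 1\<close>.\<close>

lemma boundary_measure_sharp:
  fixes N :: "real^'n \<Rightarrow> real"
  assumes N: "is_norm N" and x: "0 < x" "x \<le> 1 / 2" and \<epsilon>: "0 < \<epsilon>"
  shows "\<exists>(K :: (real^'n) set) S L.
            convex_body K \<and> vol K > 0 \<and>
            S \<in> sets lebesgue \<and> S \<subseteq> K \<and> unif_meas K S = x \<and>
            has_boundary_measure N K S L \<and>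
            norm_diam N K * L / x < G CARD('n) (1 / x) + \<epsilon>"
proof -
  define n where "n = CARD('n)"
  have n: "0 < n" "DIM(real^'n) = n" by (simp_all add: n_def)
  have G: "G n (1 / x) = iso_profile n x / x"
    using G_eq_iso_profile(1)[OF n(1) x] x by (simp add: field_simps)
  obtain r0 where r0: "1 \<le> r0" "cone_profile n 1 r0 x = iso_profile n x" using G_eq_iso_profile(2)[OF n(1) x] by blast
  have "((\<lambda>r. cone_profile n 1 r x) \<longlongrightarrow> cone_profile n 1 r0 x) (at_right r0)"
    using isCont_cone_profile[OF n(1), of r0 x] r0 by (auto simp: isCont_def intro: filterlim_mono[OF _ order_refl at_le])
  then have "\<forall>\<^sub>F r in at_right r0. cone_profile n 1 r x < iso_profile n x + \<epsilon> * x / 2"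
    using x \<epsilon> r0 by (intro order_tendstoD(2)) auto
  then obtain b where b: "r0 < b" "\<And>r. r0 < r \<Longrightarrow> r < b \<Longrightarrow> cone_profile n 1 r x < iso_profile n x + \<epsilon> * x / 2"
    by (auto simp: eventually_at_right_field)
  \<comment> \<open>\<open>r0 = 1\<close> stands for a cylinder, which is not a slab of
    \<open>thin_cone\<close>. A slightly larger \<open>r\<close> exceeds 1 and by continuity costs
    less than \<open>\<epsilon> * x / 2\<close>.\<close>
  obtain r where "r0 < r" "r < b" using dense[OF b(1)] by blast
  then have r: "1 < r" "cone_profile n 1 r x < iso_profile n x + \<epsilon> * x / 2" using b r0 by auto
  have rn: "1 < r ^ n" using r n by simp
  define t where "t = root n (1 - x + x * r ^ n)"
  have z: "1 < 1 - x + x * r ^ n" "1 - x + x * r ^ n < r ^ n"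
  proof -
    have "0 < x * (r ^ n - 1)" "0 < (1 - x) * (r ^ n - 1)" using x rn by (auto intro!: mult_pos_pos)
    then show "1 < 1 - x + x * r ^ n" "1 - x + x * r ^ n < r ^ n" by (auto simp: algebra_simps)
  qed
  have tn: "t ^ n = 1 - x + x * r ^ n" using z n by (simp add: t_def)
  have t: "1 < t" "t < r"
  proof -
    have "root n 1 < t" "t < root n (r ^ n)" unfolding t_def using z n by auto
    then show "1 < t" "t < r" using n r by (auto simp: real_root_power_cancel)
  qed
  define L where "L = n * t ^ (n - 1) / (r ^ n - 1)"
  have L0: "0 < L" using n t rn by (simp add: L_def)
  have prof: "(r - 1) * L = cone_profile n 1 r x"
  proof -
    have "cone_profile n 1 r x = n * t ^ (n - 1) / psum n r" by (simp add: cone_profile_one t_def)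
    also have "\<dots> = (r - 1) * (n * t ^ (n - 1)) / ((r - 1) * psum n r)" using r by simp
    finally show ?thesis by (simp add: psum_geometric L_def)
  qed
  obtain v w where vw: "N v = 1" "v \<bullet> w = 1" "\<And>y. y \<bullet> w \<le> N y" using support_functional[OF N] by blast
  obtain C where C: "0 < C" "\<And>y. N y \<le> C * norm y" using is_norm_upper[OF N] by blast
  \<comment> \<open>Chosen so that the sideways contribution \<open>2 * C * \<rho> * r\<close> to
    the diameter, times \<open>L\<close>, is \<open>\<epsilon> * x / 4\<close>; together with the
    loss from \<open>r\<close> this stays below \<open>\<epsilon> * x\<close>.\<close>
  define \<rho> where "\<rho> = \<epsilon> * x / (8 * C * r * L)"
  have \<rho>: "0 < \<rho>" "2 * C * \<rho> * r * L = \<epsilon> * x / 4" using \<epsilon> x C L0 r by (simp_all add: \<rho>_def)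
  define K where "K = cone_slab v w \<rho> 1 r"
  define S where "S = cone_slab v w \<rho> 1 t"
  define c where "c = vol (cone_cap v w \<rho> 1)"
  have c: "0 < c" unfolding c_def by (rule measure_thin_cone_pos[OF vw(2) \<rho>(1)])
  have mK: "vol K = (r ^ n - 1) * c" "vol S = (t ^ n - 1) * c"
    unfolding K_def S_def c_def using measure_thin_cone_slab(2)[OF vw(2) \<rho>(1), of 1] r t n by auto
  have K0: "0 < vol K" using mK c rn by simp
  have SK: "S \<subseteq> K" using t by (auto simp: S_def K_def)
  have body: "convex_body K"
    unfolding convex_body_def K_def
    using compact_thin_cone_slab[OF vw(2) \<rho>(1), of 1 r] convex_thin_cone_slab[OF vw(2) \<rho>(1), of 1 r]
    by (simp add: compact_imp_closed compact_imp_bounded)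
  have Ss: "S \<in> sets lebesgue"
    unfolding S_def using compact_thin_cone_slab[OF vw(2) \<rho>(1), of 1 t] by (intro fmeasurableD lmeasurable_compact)
  have "S \<inter> K = S" using SK by auto
  then have "unif_meas K S = (t ^ n - 1) / (r ^ n - 1)" using c by (simp add: unif_meas_def mK)
  also have "\<dots> = x" using rn tn by (simp add: field_simps)
  finally have Sx: "unif_meas K S = x" .
  define u where "u = (\<lambda>h. ((t + h) ^ n - t ^ n) / h / (r ^ n - 1))"
  have bm: "has_boundary_measure N K S L"
    unfolding has_boundary_measure_def
  proof (rule tendsto_sandwich[where f = "\<lambda>h. (t / (t + h)) ^ n * u h" and h = u])
    have "((\<lambda>s. s ^ n) has_real_derivative n * t ^ (n - 1)) (at t)" by (auto intro!: derivative_eq_intros)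
    from secant_at_right[OF this zero_less_one]
    have "((\<lambda>h. ((t + h) ^ n - t ^ n) / h) \<longlongrightarrow> n * t ^ (n - 1)) (at_right 0)" by simp
    then show u: "(u \<longlongrightarrow> L) (at_right 0)" unfolding u_def L_def using rn by (intro tendsto_divide tendsto_const) auto
    have "((\<lambda>h. (t / (t + h)) ^ n) \<longlongrightarrow> (t / (t + 0)) ^ n) (at_right 0)"
      using t by (intro tendsto_power tendsto_divide tendsto_add tendsto_const tendsto_ident_at) auto
    from tendsto_mult[OF this u] show "((\<lambda>h. (t / (t + h)) ^ n * u h) \<longlongrightarrow> L) (at_right 0)" using t by simp
    have both: "(t / (t + h)) ^ n * u h \<le> unif_meas K (norm_nbhd N S h - S) / h \<and>
        unif_meas K (norm_nbhd N S h - S) / h \<le> u h" if h: "0 < h" "h < r - t" for h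
    proof -
      let ?A = "vol ((norm_nbhd N S h - S) \<inter> K)"
      let ?d = "((t + h) ^ n - t ^ n) * c"
      have "1 \<le> t" "t + h \<le> r" using t h by auto
      note layer = thin_cone_layer[OF vw(2) \<rho>(1) N vw(1,3) this(1) h(1) this(2), folded K_def S_def c_def, unfolded n(2)]
      have U: "unif_meas K (norm_nbhd N S h - S) / h = ?A / ((r ^ n - 1) * c) / h" by (simp add: unif_meas_def mK)
      have u_eq: "u h = ?d / ((r ^ n - 1) * c) / h" using c by (simp add: u_def)
      have p: "0 \<le> (r ^ n - 1) * c" using rn c by simp
      have "(t / (t + h)) ^ n * ?d / ((r ^ n - 1) * c) / h \<le> ?A / ((r ^ n - 1) * c) / h"
        using layer(2) h p by (intro divide_right_mono) auto
      moreover have "?A / ((r ^ n - 1) * c) / h \<le> ?d / ((r ^ n - 1) * c) / h"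
        using layer(1) h p by (intro divide_right_mono) auto
      ultimately show ?thesis unfolding U u_eq by (simp only: times_divide_eq_right simp_thms)
    qed
    show "\<forall>\<^sub>F h in at_right 0. (t / (t + h)) ^ n * u h \<le> unif_meas K (norm_nbhd N S h - S) / h"
      "\<forall>\<^sub>F h in at_right 0. unif_meas K (norm_nbhd N S h - S) / h \<le> u h"
      unfolding eventually_at_right_field using both t by (auto intro!: exI[of _ "r - t"])
  qed
  have diam: "norm_diam N K \<le> (r - 1) + 2 * C * \<rho> * r"
    unfolding norm_diam_def
  proof (rule cSUP_least)
    show "K \<times> K \<noteq> {}" using K0 by auto
    fix z assume "z \<in> K \<times> K"
    then obtain p q where z: "z = (p, q)" "p \<in> K" "q \<in> K" by blast
    have dev: "N (y - (y \<bullet> w) *\<^sub>R v) \<le> C * \<rho> * r" if "y \<in> K" for y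
    proof -
      have "norm (y - (y \<bullet> w) *\<^sub>R v) \<le> \<rho> * (y \<bullet> w)" "y \<bullet> w \<le> r" using that by (auto simp: K_def thin_cone_def)
      then have "norm (y - (y \<bullet> w) *\<^sub>R v) \<le> \<rho> * r" using \<rho>(1) by (meson mult_left_mono less_imp_le order_trans)
      then have "C * norm (y - (y \<bullet> w) *\<^sub>R v) \<le> C * (\<rho> * r)" using C(1) by (intro mult_left_mono) auto
      then show ?thesis using C(2)[of "y - (y \<bullet> w) *\<^sub>R v"] by (simp add: mult.assoc)
    qed
    have "p - q = (p \<bullet> w - q \<bullet> w) *\<^sub>R v + ((p - (p \<bullet> w) *\<^sub>R v) - (q - (q \<bullet> w) *\<^sub>R v))"
      by (simp add: algebra_simps)
    then have "N (p - q) \<le> N ((p \<bullet> w - q \<bullet> w) *\<^sub>R v) + N ((p - (p \<bullet> w) *\<^sub>R v) - (q - (q \<bullet> w) *\<^sub>R v))"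
      by (metis is_norm_triangle[OF N])
    moreover have "N ((p - (p \<bullet> w) *\<^sub>R v) - (q - (q \<bullet> w) *\<^sub>R v)) \<le> N (p - (p \<bullet> w) *\<^sub>R v) + N (q - (q \<bullet> w) *\<^sub>R v)"
      using is_norm_triangle[OF N, of "p - (p \<bullet> w) *\<^sub>R v" "- (q - (q \<bullet> w) *\<^sub>R v)"] is_norm_minus[OF N, of "q - (q \<bullet> w) *\<^sub>R v"]
      by (simp only: diff_conv_add_uminus)
    moreover have "N ((p \<bullet> w - q \<bullet> w) *\<^sub>R v) \<le> r - 1"
      using z by (auto simp: is_norm_scale[OF N] vw(1) K_def abs_le_iff)
    ultimately show "N (fst z - snd z) \<le> (r - 1) + 2 * C * \<rho> * r"
      using dev[OF z(2)] dev[OF z(3)] z(1) by simp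
  qed
  have "norm_diam N K * L \<le> ((r - 1) + 2 * C * \<rho> * r) * L" using diam L0 by (intro mult_right_mono) auto
  also have "\<dots> = cone_profile n 1 r x + \<epsilon> * x / 4" unfolding distrib_right prof \<rho>(2) ..
  also have "\<dots> < iso_profile n x + \<epsilon> * x"
    using r(2) mult_pos_pos[OF \<epsilon> x(1)] by linarith
  finally have "norm_diam N K * L / x < (iso_profile n x + \<epsilon> * x) / x"
    using x by (intro divide_strict_right_mono) auto
  also have "\<dots> = G CARD('n) (1 / x) + \<epsilon>" using x G by (simp add: add_divide_distrib n_def)
  finally show ?thesis using body K0 Ss SK Sx bm by blast
qed

theorem theorem4p1:
  fixes N :: "real^'n \<Rightarrow> real"
  assumes "is_norm N"
  shows
    "(\<forall>(K :: (real^'n) set) S L.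
        convex_body K \<and> measure lebesgue K > 0 \<and>
        S \<in> sets lebesgue \<and> S \<subseteq> K \<and>
        0 < unif_meas K S \<and> unif_meas K S \<le> 1/2 \<and>
        has_boundary_measure N K S L \<longrightarrow>
        norm_diam N K * L \<ge> unif_meas K S * G CARD('n) (1 / unif_meas K S))
   \<and>
     (\<forall>x::real. 0 < x \<and> x \<le> 1/2 \<longrightarrow>
        (\<forall>\<epsilon>>0. \<exists>(K :: (real^'n) set) S L.
            convex_body K \<and> measure lebesgue K > 0 \<and>
            S \<in> sets lebesgue \<and> S \<subseteq> K \<and> unif_meas K S = x \<and>
            has_boundary_measure N K S L \<and>
            norm_diam N K * L / x < G CARD('n) (1 / x) + \<epsilon>))"
proof (intro conjI allI impI)
  fix K S :: "(real^'n) set" and L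
  assume a: "convex_body K \<and> measure lebesgue K > 0 \<and> S \<in> sets lebesgue \<and> S \<subseteq> K \<and>
        0 < unif_meas K S \<and> unif_meas K S \<le> 1/2 \<and> has_boundary_measure N K S L"
  then have "unif_meas K S * G CARD('n) (1 / unif_meas K S) = iso_profile CARD('n) (unif_meas K S)"
    by (intro G_eq_iso_profile) auto
  also have "\<dots> \<le> norm_diam N K * L" using a by (intro boundary_measure_lower_bound[OF assms]) auto
  finally show "norm_diam N K * L \<ge> unif_meas K S * G CARD('n) (1 / unif_meas K S)" .
next
  fix x \<epsilon> :: real
  assume "0 < x \<and> x \<le> 1/2" "0 < \<epsilon>"
  then show "\<exists>(K :: (real^'n) set) S L.
            convex_body K \<and> measure lebesgue K > 0 \<and>
            S \<in> sets lebesgue \<and> S \<subseteq> K \<and> unif_meas K S = x \<and>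
            has_boundary_measure N K S L \<and>
            norm_diam N K * L / x < G CARD('n) (1 / x) + \<epsilon>"
    by (intro boundary_measure_sharp[OF assms]) auto
qed

end
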